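(* Let $n \geq 2$ and let $p$ be a polynomial with non-negative coefficients of degree $d$ in $n$ dimensions (that is, in the variables $x=(x_1,\dots,x_n)$) such that $p(x)=1$ whenever $x_1+\cdots+x_n=1$. Then the following inequality holds and is sharp: $$ d \leq \begin{cases} 2N(p)-3 & \text{if } n=2,\\[2pt] \dfrac{N(p)-1}{n-1} & \text{if } n\geq 3. \end{cases} $$
   Context: For a polynomial $p$, $N(p)$ denotes the number of nonzero coefficients of $p$, i.e. the number of distinct monomials appearing in $p$ with nonzero coefficient. For $n\geq 3$, "sharp" means that for every $n$ and every $d$ there exist examples for which equality holds. For $n=2$, equality can only hold for odd degree, and examples with equality occur for any odd degree; for even degree there exist examples for which the right-hand side is exactly one larger than $d$.
   Formalization: For n=2 the inequality is stated for degree d ≥ 1 and the even-degree examples for even d ≥ 2, since the constant polynomial p=1 (d=0, N(p)=1, 2N(p)-3=-1) violates the claim as written. *)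

theory Defs
  imports Complex_Main "HOL-Library.Poly_Mapping"
begin

text \<open>
  Polynomials over the reals in the variables \<open>x 0, x 1, \<dots>\<close>: a monomial is a finitely supported
  exponent function, and a polynomial is a finitely supported function from monomials to
  coefficients, so \<^term>\<open>Poly_Mapping.keys p\<close> is the set of monomials with nonzero coefficient.
\<close>

type_synonym rpoly = "(nat \<Rightarrow>\<^sub>0 nat) \<Rightarrow>\<^sub>0 real"

definition monom_degree :: "(nat \<Rightarrow>\<^sub>0 nat) \<Rightarrow> nat" where
  "monom_degree m = (\<Sum>i\<in>Poly_Mapping.keys m. Poly_Mapping.lookup m i)"

text \<open>The zero polynomial gets degree \<open>0\<close>.\<close>

definition poly_degree :: "rpoly \<Rightarrow> nat" where
  "poly_degree p = Max (insert 0 (monom_degree ` Poly_Mapping.keys p))"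

definition num_terms :: "rpoly \<Rightarrow> nat" where
  "num_terms p = card (Poly_Mapping.keys p)"

definition poly_eval :: "rpoly \<Rightarrow> (nat \<Rightarrow> real) \<Rightarrow> real" where
  "poly_eval p x =
    (\<Sum>m\<in>Poly_Mapping.keys p. Poly_Mapping.lookup p m *
      (\<Prod>i\<in>Poly_Mapping.keys m. x i ^ Poly_Mapping.lookup m i))"

definition polys_in :: "nat \<Rightarrow> rpoly set" where
  "polys_in n = {p. \<forall>m\<in>Poly_Mapping.keys p. Poly_Mapping.keys m \<subseteq> {..<n}}"

text \<open>
  Points of \<open>n\<close>-dimensional space are functions \<^typ>\<open>nat \<Rightarrow> real\<close> of which only the values below \<open>n\<close>
  matter, since only those variables occur in \<open>p\<close>.
\<close>

definition hyperplane_polys :: "nat \<Rightarrow> rpoly set" where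
  "hyperplane_polys n =
    {p \<in> polys_in n.
      (\<forall>m. Poly_Mapping.lookup p m \<ge> 0) \<and>
      (\<forall>x. (\<Sum>i<n. x i) = 1 \<longrightarrow> poly_eval p x = 1)}"

text \<open>
  Real-valued, so neither subtraction nor division truncates. For \<open>n = 2\<close> and \<open>N = 1\<close> (the constant
  polynomial \<open>1\<close>) the value is \<open>-1\<close>, so as a bound on the degree it is only meaningful for
  polynomials of positive degree when \<open>n = 2\<close>.
\<close>

definition degree_bound :: "nat \<Rightarrow> nat \<Rightarrow> real" where
  "degree_bound n N =
    (if n = 2 then 2 * real N - 3 else (real N - 1) / (real n - 1))"

end

theory Submission
  imports Defs "HOL-Computational_Algebra.Polynomial"
begin

text \<open>
  Single out the variable \<open>x = x\<^sub>0\<close>, call the others \<open>y\<close>, let \<open>\<Pi>\<close> be the sum of the others, \<open>w = 1 - x\<close>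
  and \<open>m = n - 1\<close>. Write \<open>p = \<Sum> x\<^sup>k a\<^sub>k\<^sub>u(y)\<close> with \<open>a\<^sub>k\<^sub>u\<close> homogeneous of degree \<open>u\<close>, and call \<open>(k, u)\<close> a node if
  \<open>a\<^sub>k\<^sub>u \<noteq> 0\<close>. The point \<open>(x, y w / \<Pi>)\<close> lies on the hyperplane, so clearing denominators gives, with
  \<open>D\<close> the degree of \<open>p\<close>, the identity \<open>\<Sum> w\<^sup>u \<Pi>\<^bsup>D-u\<^esup> x\<^sup>k a\<^sub>k\<^sub>u = \<Pi>\<^sup>D\<close> between polynomials in \<open>x\<close> over the
  polynomials in \<open>y\<close> (locale \<open>node_system\<close>). The number of terms of \<open>p\<close> is the sum of the numbers of
  terms of the \<open>a\<^sub>k\<^sub>u\<close>. A node with \<open>u \<ge> 1\<close> casts the shadow \<open>{k..k+u-1}\<close>, and these shadows cover all of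
  \<open>{0..D-1}\<close> (\<open>shade_upper\<close>): at a column that no shadow covers, the identity would split into a left
  and a right part, and the right part would vanish, although all coefficients are nonnegative. So it
  suffices to bound from below how many terms must be paid for every covered column. A node with
  \<open>u = 0\<close> supplies one further term.

  For \<open>n = 2\<close> put \<open>y = 1\<close>. The nodes with \<open>u \<ge> 1\<close> then sum up to \<open>1\<close> minus a polynomial with nonnegative
  coefficients, and such a coefficient sequence alternates in sign at most twice. On the other hand
  multiplication by \<open>w\<close> creates an alternation, while adding a monomial in one column destroys at
  most two. Building up the sum by rows, the \<open>r\<close> nodes with \<open>u \<ge> 1\<close> must leave at least \<open>D + 1 - 2r + 2\<close>
  alternations (\<open>positive_family_alternates\<close>), whence \<open>D + 1 \<le> 2r\<close>.

  For \<open>n \<ge> 4\<close> the number of terms is controlled by divisibility. A nonzero homogeneous multiple of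
  \<open>\<Pi>\<^sup>v\<close> in \<open>m \<ge> 3\<close> variables has at least \<open>m v\<close> terms (\<open>num_terms_ge_mult\<close>). Since cancelling \<open>w\<close> does not
  affect divisibility by powers of \<open>\<Pi>\<close>, an induction from lower to higher rows shows that a set of
  nodes whose sum is divisible by an excess power \<open>\<Pi>\<^sup>v\<close> needs \<open>m\<close> terms for each column and each
  excess factor beyond the first (\<open>sum_num_terms_ge_shade\<close>).

  For \<open>n = 3\<close> a multiple of \<open>\<Pi>\<^sup>v\<close> may have only \<open>v + 1\<close> terms, and both ideas have to be combined. The
  nodes are grouped into blocks, processed from the top row down, such that no combination of
  blocks of equal divisibility becomes more divisible than its members (\<open>independent\<close>). If such a
  gain occurs, the blocks concerned and the new row elements involved are merged into a single
  block. To bound the terms that such a merger costs, apply a linear functional that kills all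
  multiples of \<open>\<Pi>\<^sup>v\<close>: the merged sum disappears, so the row elements are mapped to the negative of
  a combination of the old blocks. The latter has many sign alternations (\<open>family_alternates\<close>), whereas the
  functional can be chosen so that the row elements change sign only where a column depends
  linearly on earlier ones (\<open>ex_separating_functional\<close>); and every such dependence costs a term.

  Equality for \<open>n \<ge> 3\<close> is attained by expanding \<open>1 = x\<^sub>0 + (x\<^sub>1 + \<dots> + x\<^sub>m)\<close> repeatedly at the pure power of
  \<open>x\<^sub>0\<close>, and for \<open>n = 2\<close> by Lucas polynomials, whose value on the line is \<open>1 + (-x\<^sub>1)\<^sup>d\<close>.
\<close>

section \<open>Sign alternations of a sequence\<close>

text \<open>
  The factor \<open>e\<close> fixes the sign of the first entry and only matters up to sign; for \<open>L > 0\<close> it cannot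
  be \<open>0\<close>. Every sequence alternates \<open>0\<close> times.
\<close>

definition alternates :: "(nat \<Rightarrow> real) \<Rightarrow> nat \<Rightarrow> bool" where
  "alternates a L \<longleftrightarrow> (\<exists>f e. (\<forall>i j. i < j \<longrightarrow> j < L \<longrightarrow> f i < f j) \<and>
     (\<forall>i<L. e * (-1) ^ i * a (f i) > 0))"

text \<open>
  The bound is an integer because the estimates below subtract from it; a nonpositive bound says
  nothing.
\<close>

definition alternates_ge :: "(nat \<Rightarrow> real) \<Rightarrow> int \<Rightarrow> bool" where
  "alternates_ge a z \<longleftrightarrow> (\<exists>L. int L \<ge> z \<and> alternates a L)"

lemma alternates_ge_mono: "alternates_ge a z \<Longrightarrow> z' \<le> z \<Longrightarrow> alternates_ge a z'"
  unfolding alternates_ge_def by force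

lemma alternates_ge_nonpos: "z \<le> 0 \<Longrightarrow> alternates_ge a z"
  unfolding alternates_ge_def alternates_def by (rule exI[of _ 0]) auto

lemma alternates_ge_one:
  assumes "a k \<noteq> 0" shows "alternates_ge a 1"
proof -
  have "alternates a 1"
    unfolding alternates_def using assms
    by (intro exI[of _ "\<lambda>_. k"] exI[of _ "a k"]) (auto simp: zero_less_mult_iff)
  then show ?thesis unfolding alternates_ge_def by (intro exI[of _ 1]) auto
qed

lemma alternates_le_card:
  assumes "alternates a L" "\<And>k. a k \<noteq> 0 \<Longrightarrow> k \<in> S" "finite S"
  shows "L \<le> card S"
proof -
  from assms(1) obtain f e where f: "\<And>i j. i < j \<Longrightarrow> j < L \<Longrightarrow> f i < f j"
    and e: "\<And>i. i < L \<Longrightarrow> e * (-1) ^ i * a (f i) > 0"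
    unfolding alternates_def by blast
  have inj: "inj_on f {..<L}"
  proof (rule inj_onI)
    fix i j assume "i \<in> {..<L}" "j \<in> {..<L}" "f i = f j"
    then show "i = j" using f[of i j] f[of j i] by (metis lessThan_iff less_irrefl linorder_neqE_nat)
  qed
  have "f ` {..<L} \<subseteq> S"
  proof (rule image_subsetI)
    fix i assume "i \<in> {..<L}"
    then have "a (f i) \<noteq> 0" using e[of i] by auto
    then show "f i \<in> S" by (rule assms(2))
  qed
  then have "card (f ` {..<L}) \<le> card S" using assms(3) by (rule card_mono[rotated])
  then show ?thesis using inj by (simp add: card_image)
qed

text \<open>
  Two consecutive entries of an alternation have opposite strict signs, so at most one
  of them has a nonpositive value; beyond index \<open>0\<close> all values are nonpositive.
\<close>

lemma alternates_le_2:
  assumes "alternates a L" "\<And>k. k \<ge> 1 \<Longrightarrow> a k \<le> 0"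
  shows "L \<le> 2"
proof (rule ccontr)
  assume "\<not> L \<le> 2"
  from assms(1) obtain f e where f: "\<And>i j. i < j \<Longrightarrow> j < L \<Longrightarrow> f i < f j"
    and e: "\<And>i. i < L \<Longrightarrow> e * (-1) ^ i * a (f i) > 0"
    unfolding alternates_def by blast
  have "f 0 < f 1" "f 1 < f 2" using f \<open>\<not> L \<le> 2\<close> by auto
  then have "a (f 1) \<le> 0" "a (f 2) \<le> 0" using assms(2) by auto
  moreover have "e * a (f 1) < 0" "e * a (f 2) > 0" using e[of 1] e[of 2] \<open>\<not> L \<le> 2\<close> by auto
  ultimately show False by (auto simp: zero_less_mult_iff mult_less_0_iff)
qed

text \<open>
  Deleting an entry of an alternation together with its successor restores the alternation.
\<close>

lemma alternates_ge_change_one: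
  assumes "alternates_ge a z" "\<And>k. k \<noteq> c \<Longrightarrow> a k \<noteq> 0 \<Longrightarrow> b k = a k"
  shows "alternates_ge b (z - 2)"
proof -
  from assms(1) obtain L where L: "int L \<ge> z" "alternates a L" unfolding alternates_ge_def by blast
  from L(2) obtain f e where f: "\<And>i j. i < j \<Longrightarrow> j < L \<Longrightarrow> f i < f j"
    and e: "\<And>i. i < L \<Longrightarrow> e * (-1) ^ i * a (f i) > 0"
    unfolding alternates_def by blast
  have nz: "a (f i) \<noteq> 0" if "i < L" for i using e[OF that] by auto
  have "alternates b (L - 2)"
  proof (cases "\<exists>i<L. f i = c")
    case False
    then show ?thesis unfolding alternates_def
      using assms(2) f e by (intro exI[of _ f] exI[of _ e]) (auto simp: nz)
  next
    case True
    then obtain i0 where i0: "i0 < L" "f i0 = c" by blast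
    have ne: "f i \<noteq> c" if "i < L" "i \<noteq> i0" for i
      using that i0 f[of i i0] f[of i0 i] by (metis less_irrefl linorder_neqE_nat)
    define g where "g i = (if i < i0 then f i else f (i + 2))" for i
    have "g i < g j" if "i < j" "j < L - 2" for i j
      unfolding g_def using that f[of i j] f[of i "j+2"] f[of "i+2" "j+2"] by auto
    moreover have "e * (-1) ^ i * b (g i) > 0" if "i < L - 2" for i
    proof (cases "i < i0")
      case True
      then show ?thesis using that assms(2)[of "f i"] ne[of i] nz[of i] e[of i] by (auto simp: g_def)
    next
      case False
      then show ?thesis using that assms(2)[of "f (i+2)"] ne[of "i+2"] nz[of "i+2"] e[of "i+2"] by (auto simp: g_def)
    qed
    ultimately show ?thesis unfolding alternates_def by blast
  qed
  then show ?thesis unfolding alternates_ge_def using L(1) by (intro exI[of _ "L - 2"]) auto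
qed

text \<open>
  Only columns in which the old sequence is nonzero can carry an entry of an alternation, so
  changes elsewhere are free.
\<close>

lemma alternates_ge_change:
  assumes "finite S" "alternates_ge a z" "\<And>k. k \<notin> S \<Longrightarrow> a k \<noteq> 0 \<Longrightarrow> b k = a k"
  shows "alternates_ge b (z - 2 * int (card S))"
  using assms(1,3)
proof (induction S arbitrary: b rule: finite_induct)
  case empty
  have "alternates b L" if "alternates a L" for L
  proof -
    from that obtain f e where f: "\<And>i j. i < j \<Longrightarrow> j < L \<Longrightarrow> f i < f j"
      and e: "\<And>i. i < L \<Longrightarrow> e * (-1) ^ i * a (f i) > 0"
      unfolding alternates_def by blast
    have "b (f i) = a (f i)" if "i < L" for i
      using e[OF that] empty[of "f i"] by (cases "a (f i) = 0") auto
    then show ?thesis unfolding alternates_def using f e by (intro exI[of _ f] exI[of _ e]) auto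
  qed
  then show ?case using assms(2) unfolding alternates_ge_def by auto
next
  case (insert c S)
  have "alternates_ge (b(c := a c)) (z - 2 * int (card S))"
    by (rule insert.IH) (use insert.prems in auto)
  from alternates_ge_change_one[OF this, of c b] show ?case using insert(1,2)
    by (auto simp: algebra_simps)
qed

text \<open>
  The two alternations are written one after the other; one entry is lost if the signs at the seam agree.
\<close>

lemma alternates_ge_append:
  assumes "alternates_ge a z1" "alternates_ge b z2"
    and a: "\<And>k. k > g \<Longrightarrow> a k = 0" and b: "\<And>k. k \<le> g \<Longrightarrow> b k = 0"
  shows "alternates_ge (\<lambda>k. a k + b k) (z1 + z2 - 1)"
proof -
  from assms(1) obtain L where L: "int L \<ge> z1" "alternates a L" unfolding alternates_ge_def by blast
  from L(2) obtain f e where f: "\<And>i j. i < j \<Longrightarrow> j < L \<Longrightarrow> f i < f j"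
    and e: "\<And>i. i < L \<Longrightarrow> e * (-1) ^ i * a (f i) > 0"
    unfolding alternates_def by blast
  from assms(2) obtain M where M: "int M \<ge> z2" "alternates b M" unfolding alternates_ge_def by blast
  from M(2) obtain h c where h: "\<And>i j. i < j \<Longrightarrow> j < M \<Longrightarrow> h i < h j"
    and c: "\<And>i. i < M \<Longrightarrow> c * (-1) ^ i * b (h i) > 0"
    unfolding alternates_def by blast
  have fg: "f i \<le> g" if "i < L" for i using e[OF that] a[of "f i"] by (cases "f i \<le> g") auto
  have hg: "h i > g" if "i < M" for i using c[OF that] b[of "h i"] by (cases "h i > g") auto
  have main: "alternates (\<lambda>k. a k + b k) (L + (M - s))"
    if s: "\<And>i. i < M - s \<Longrightarrow> e * (-1) ^ (L + i) * b (h (i + s)) > 0" for s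
  proof -
    \<comment> \<open>the first \<open>s\<close> entries of the second alternation are dropped\<close>
    define t where "t i = (if i < L then f i else h (i - L + s))" for i
    have "t i < t j" if "i < j" "j < L + (M - s)" for i j
    proof (cases "j < L")
      case True then show ?thesis using that f[of i j] by (auto simp: t_def)
    next
      case False
      then show ?thesis using that fg[of i] hg[of "j - L + s"] h[of "i - L + s" "j - L + s"]
        by (cases "i < L") (auto simp: t_def intro: le_less_trans)
    qed
    moreover have "e * (-1) ^ i * (a (t i) + b (t i)) > 0" if "i < L + (M - s)" for i
    proof (cases "i < L")
      case True
      then show ?thesis using e[of i] fg[of i] b[of "f i"] by (auto simp: t_def)
    next
      case False
      then show ?thesis using that s[of "i - L"] hg[of "i - L + s"] a[of "h (i - L + s)"] by (auto simp: t_def)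
    qed
    ultimately show ?thesis unfolding alternates_def by blast
  qed
  show ?thesis
  proof (cases "L = 0 \<or> M = 0")
    case True
    then consider "L = 0" | "M = 0" by blast
    then show ?thesis
    proof cases
      case 1
      have "alternates (\<lambda>k. a k + b k) M" unfolding alternates_def
      proof (intro exI[of _ h] exI[of _ c] conjI allI impI)
        fix i assume "i < M" then show "c * (- 1) ^ i * (a (h i) + b (h i)) > 0"
          using hg[of i] a[of "h i"] c[of i] by auto
      qed (use h in auto)
      then show ?thesis unfolding alternates_ge_def using 1 L M by (intro exI[of _ M]) auto
    next
      case 2
      then show ?thesis using main[of 0] L M unfolding alternates_ge_def by (intro exI[of _ L]) auto
    qed
  next
    case False
    then have "c \<noteq> 0" "e \<noteq> 0" using c[of 0] e[of 0] by auto
    have "e * (-1)^L * c \<noteq> 0" using \<open>c \<noteq> 0\<close> \<open>e \<noteq> 0\<close> by simp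
    then have "e * (-1)^L * c > 0 \<or> e * (-1)^L * c < 0" by linarith
    then show ?thesis
    proof
      assume pos: "e * (-1)^L * c > 0"
      have "e * (-1) ^ (L + i) * b (h (i + 0)) > 0" if "i < M - 0" for i
      proof -
        have "0 < (e * (-1)^L * c) * (c * (-1) ^ i * b (h i))"
          using that by (intro mult_pos_pos[OF pos] c) auto
        also have "\<dots> = c^2 * (e * (-1) ^ (L + i) * b (h (i + 0)))"
          by (simp add: power_add power2_eq_square algebra_simps)
        finally show ?thesis by (simp add: zero_less_mult_iff)
      qed
      from main[of 0, OF this] show ?thesis using L M unfolding alternates_ge_def by (intro exI[of _ "L + M"]) auto
    next
      assume neg: "e * (-1)^L * c < 0"
      have "e * (-1) ^ (L + i) * b (h (i + 1)) > 0" if "i < M - 1" for i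
      proof -
        have "0 > (e * (-1)^L * c) * (c * (-1) ^ (i+1) * b (h (i+1)))"
          using that by (intro mult_neg_pos[OF neg] c) auto
        also have "(e * (-1)^L * c) * (c * (-1) ^ (i+1) * b (h (i+1))) = - (c^2 * (e * (-1) ^ (L + i) * b (h (i + 1))))"
          by (simp add: power_add power2_eq_square algebra_simps)
        finally show ?thesis by (simp add: zero_less_mult_iff)
      qed
      from main[of 1, OF this] show ?thesis using L M False unfolding alternates_ge_def
        by (intro exI[of _ "L + (M - 1)"]) auto
    qed
  qed
qed

lemma coeff_one_minus_x_mult:
  fixes A :: "'a::comm_ring_1 poly"
  shows "coeff ([:1, -1:] * A) k = coeff A k - (if k = 0 then 0 else coeff A (k - 1))"
  by (cases k) auto

lemma sum_coeff_one_minus_x_mult: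
  fixes A :: "'a::comm_ring_1 poly"
  shows "(\<Sum>k<s. coeff ([:1, -1:] * A) k) = (if s = 0 then 0 else coeff A (s - 1))"
proof (induction s)
  case (Suc s) then show ?case unfolding sum.lessThan_Suc Suc coeff_one_minus_x_mult by simp
qed simp

text \<open>
  The partial sums of the coefficients of \<open>(1 - x) A\<close> are the coefficients of \<open>A\<close>. Between two
  consecutive entries of an alternation of \<open>A\<close> the partial sums move strictly in one direction, so some
  coefficient has that sign. The initial block, starting from the partial sum \<open>0\<close>, and the final
  block, returning to \<open>0\<close>, make one block more than there were entries.
\<close>

lemma alternates_ge_one_minus_x_mult:
  fixes A :: "real poly"
  assumes "alternates_ge (coeff A) z" "A \<noteq> 0"
  shows "alternates_ge (coeff ([:1, -1:] * A)) (z + 1)"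
proof -
  from assms(1) obtain L where L: "int L \<ge> z" "alternates (coeff A) L" unfolding alternates_ge_def by blast
  show ?thesis
  proof (cases "L = 0")
    case True
    have "[:1, -1:] * A \<noteq> 0" using assms(2) by (metis mult_eq_0_iff one_neq_zero pCons_eq_0_iff)
    then obtain k where "coeff ([:1, -1:] * A) k \<noteq> 0" by (metis leading_coeff_0_iff)
    from alternates_ge_one[of "coeff ([:1, -1:] * A)", OF this] show ?thesis using True L(1) alternates_ge_mono by auto
  next
    case False
    from L(2) obtain f e where f: "\<And>i j. i < j \<Longrightarrow> j < L \<Longrightarrow> f i < f j"
      and e: "\<And>i. i < L \<Longrightarrow> e * (-1) ^ i * coeff A (f i) > 0"
      unfolding alternates_def by blast
    define B where "B = [:1, -1:] * A"
    \<comment> \<open>block \<open>i\<close> consists of the columns from \<open>s i\<close> up to but excluding \<open>s (Suc i)\<close>\<close>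
    define s where "s i = (if i = 0 then 0 else if i \<le> L then f (i - 1) + 1 else max (degree A + 1) (f (L - 1) + 1) + 1)" for i
    have s: "s i < s (Suc i)" if "i \<le> L" for i
    proof (cases "i = L")
      case True then show ?thesis using False by (auto simp: s_def)
    next
      case False then show ?thesis using that f[of "i-1" i] by (auto simp: s_def)
    qed
    have ss: "s i \<le> s j" if "i \<le> j" "j \<le> L + 1" for i j
      using that
    proof (induction j)
      case (Suc j)
      then show ?case using s[of j] by (cases "i = Suc j") (auto simp: less_imp_le intro: le_trans)
    qed auto
    have pos: "e * (-1) ^ i * (\<Sum>k\<in>{s i..<s (Suc i)}. coeff B k) > 0" if "i \<le> L" for i
    proof -
      have "(\<Sum>k\<in>{s i..<s (Suc i)}. coeff B k) = (\<Sum>k<s (Suc i). coeff B k) - (\<Sum>k<s i. coeff B k)"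
        using s[OF that] by (metis atLeast0LessThan less_imp_le_nat sum_diff_nat_ivl zero_le)
      also have "\<dots> = coeff A (s (Suc i) - 1) - (if i = 0 then 0 else coeff A (f (i - 1)))"
        using s[OF that] that unfolding B_def sum_coeff_one_minus_x_mult
        by (auto simp: s_def)
      finally have eq: "(\<Sum>k\<in>{s i..<s (Suc i)}. coeff B k) = coeff A (s (Suc i) - 1) - (if i = 0 then 0 else coeff A (f (i - 1)))" .
      have 1: "e * (-1) ^ i * coeff A (s (Suc i) - 1) > 0 \<or> (i = L \<and> coeff A (s (Suc i) - 1) = 0)"
      proof (cases "i = L")
        case True
        then show ?thesis by (auto simp: s_def intro: coeff_eq_0)
      next
        case False
        then show ?thesis using that e[of i] by (auto simp: s_def)
      qed
      have 2: "e * (-1) ^ i * - coeff A (f (i - 1)) > 0" if "i \<noteq> 0"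
        using e[of "i-1"] that \<open>i \<le> L\<close> by (cases i) auto
      show ?thesis unfolding eq using 1 2 False by (cases "i = 0") (auto simp: algebra_simps)
    qed
    have "\<exists>k\<in>{s i..<s (Suc i)}. e * (-1) ^ i * coeff B k > 0" if "i \<le> L" for i
    proof (rule ccontr)
      assume "\<not> ?thesis"
      then have "(\<Sum>k\<in>{s i..<s (Suc i)}. e * (-1) ^ i * coeff B k) \<le> 0"
        by (intro sum_nonpos) (auto simp: not_less)
      then show False using pos[OF that] by (simp add: sum_distrib_left)
    qed
    then obtain g where g: "\<And>i. i \<le> L \<Longrightarrow> g i \<in> {s i..<s (Suc i)} \<and> e * (-1) ^ i * coeff B (g i) > 0"
      by metis
    have "alternates (coeff B) (L + 1)"
      unfolding alternates_def
    proof (intro exI[of _ g] exI[of _ e] conjI allI impI)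
      fix i j assume "i < j" "j < L + 1"
      then show "g i < g j" using g[of i] g[of j] ss[of "Suc i" j] by auto
    next
      fix i assume "i < L + 1" then show "e * (-1) ^ i * coeff B (g i) > 0" using g[of i] by auto
    qed
    then show ?thesis unfolding alternates_ge_def B_def using L(1) by (intro exI[of _ "L + 1"]) auto
  qed
qed

section \<open>Families of intervals and their aged sums\<close>

text \<open>
  If the union is not an interval, some \<open>g\<close> between its extreme points is not covered, and then every
  member lies on one side of \<open>g\<close>.
\<close>

lemma interval_or_gap:
  fixes l r :: "'i \<Rightarrow> nat"
  assumes "finite I" "I \<noteq> {}" "\<forall>i\<in>I. l i \<le> r i"
  shows "(\<exists>lo hi. lo \<le> hi \<and> (\<Union>i\<in>I. {l i..r i}) = {lo..hi}) \<or>
    (\<exists>g I1 I2. I = I1 \<union> I2 \<and> I1 \<inter> I2 = {} \<and> I1 \<noteq> {} \<and> I2 \<noteq> {} \<and>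
      (\<forall>i\<in>I1. r i < g) \<and> (\<forall>i\<in>I2. g < l i))"
proof -
  define U where "U = (\<Union>i\<in>I. {l i..r i})"
  have fin: "finite U" using assms(1) by (auto simp: U_def)
  have ne: "U \<noteq> {}" using assms(2,3) by (auto simp: U_def)
  have sub: "U \<subseteq> {Min U..Max U}" using fin by auto
  show ?thesis
  proof (cases "U = {Min U..Max U}")
    case True
    have "Min U \<in> U" using fin ne by (rule Min_in)
    then have "Min U \<le> Max U" using fin by simp
    with True show ?thesis unfolding U_def by blast
  next
    case False
    then obtain g where "g \<in> {Min U..Max U}" "g \<notin> U" using sub by blast
    then have g: "g \<notin> U" "Min U \<le> g" "g \<le> Max U" by auto
    have "Min U \<in> U" "Max U \<in> U" using fin ne by auto
    then obtain i1 i2 where i: "i1 \<in> I" "l i1 \<le> Min U" "i2 \<in> I" "Max U \<le> r i2"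
      unfolding U_def by auto
    have out: "r i < g \<or> g < l i" if "i \<in> I" for i using g(1) that unfolding U_def by auto
    have "l i1 \<le> g" using i g by simp
    then have "{i\<in>I. r i < g} \<noteq> {}" using out[OF i(1)] i(1) by auto
    moreover have "g \<le> r i2" using i g by simp
    then have "{i\<in>I. \<not> r i < g} \<noteq> {}" using i(3) by auto
    moreover have "\<forall>i\<in>{i\<in>I. \<not> r i < g}. g < l i" using out by auto
    moreover have "I = {i\<in>I. r i < g} \<union> {i\<in>I. \<not> r i < g}" "{i\<in>I. r i < g} \<inter> {i\<in>I. \<not> r i < g} = {}"
      "\<forall>i\<in>{i\<in>I. r i < g}. r i < g" by auto
    ultimately show ?thesis by blast
  qed
qed

lemma interval_grow:
  fixes l r :: "'i \<Rightarrow> nat"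
  assumes "(\<Union>i\<in>I. {l i..r i}) = {lo..hi}" "lo \<le> hi" "\<And>i. i \<in> I \<Longrightarrow> l i \<le> r i"
  shows "(\<Union>i\<in>I. {l i..Suc (r i)}) = {lo..Suc hi}"
proof
  have le: "lo \<le> l i \<and> r i \<le> hi" if "i \<in> I" for i
  proof -
    have "{l i..r i} \<subseteq> {lo..hi}" unfolding assms(1)[symmetric] using that by blast
    then show ?thesis using assms(3)[OF that] by auto
  qed
  then show "(\<Union>i\<in>I. {l i..Suc (r i)}) \<subseteq> {lo..Suc hi}" by fastforce
  obtain i where i: "i \<in> I" "l i \<le> hi" "hi \<le> r i" using assms(1,2) by fastforce
  have "Suc hi \<in> {l i..Suc (r i)}" using i by auto
  moreover have "{lo..hi} \<subseteq> (\<Union>i\<in>I. {l i..Suc (r i)})" unfolding assms(1)[symmetric] by auto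
  ultimately show "{lo..Suc hi} \<subseteq> (\<Union>i\<in>I. {l i..Suc (r i)})"
    using i(1) by (fastforce simp: atLeastAtMostSuc_conv le_Suc_eq)
qed

text \<open>
  Member \<open>i\<close> occupies the columns \<open>{p i..q i}\<close>, and multiplying it \<open>j i\<close> times by \<open>1 - x\<close> spreads it over \<open>j i\<close>
  further columns to the right. The number \<open>j i\<close> is called the age of the member.
\<close>

definition shadow :: "('i \<Rightarrow> nat) \<Rightarrow> ('i \<Rightarrow> nat) \<Rightarrow> ('i \<Rightarrow> nat) \<Rightarrow> 'i set \<Rightarrow> nat set" where
  "shadow p q j I = (\<Union>i\<in>I. {p i..q i + j i})"

lemma finite_shadow [simp]: "finite I \<Longrightarrow> finite (shadow p q j I)"
  by (auto simp: shadow_def)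

lemma shadow_Un: "shadow p q j (I \<union> J) = shadow p q j I \<union> shadow p q j J"
  by (auto simp: shadow_def)

text \<open>
  When a connected shadow ages by one, it grows by exactly one column; a disconnected one would grow
  in every component.
\<close>

lemma card_shadow_age:
  assumes "\<And>i. i \<in> I \<Longrightarrow> p i \<le> q i" "\<And>i. i \<in> I \<Longrightarrow> j i \<ge> 1"
    "shadow p q (\<lambda>i. j i - 1) I = {lo..hi}" "lo \<le> hi"
  shows "card (shadow p q j I) = card (shadow p q (\<lambda>i. j i - 1) I) + 1"
proof -
  have "(\<Union>i\<in>I. {p i..Suc (q i + (j i - 1))}) = {lo..Suc hi}"
    using assms(1,3,4) unfolding shadow_def by (intro interval_grow) (auto intro: trans_le_add1)
  moreover have "(\<Union>i\<in>I. {p i..Suc (q i + (j i - 1))}) = shadow p q j I"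
    unfolding shadow_def using assms(2) by (intro SUP_cong refl) force
  ultimately have "card (shadow p q j I) = card {lo..Suc hi}" by simp
  then show ?thesis using assms(3,4) by (simp add: Suc_diff_le)
qed

lemma shadow_interval_or_gap:
  fixes p q j :: "'i \<Rightarrow> nat"
  assumes "finite I" "I \<noteq> {}" "\<forall>i\<in>I. p i \<le> q i" "\<forall>i\<in>I. j i \<ge> 1"
  shows "(\<exists>lo hi. lo \<le> hi \<and> shadow p q (\<lambda>i. j i - 1) I = {lo..hi}) \<or>
    (\<exists>g I1 I2. I = I1 \<union> I2 \<and> I1 \<inter> I2 = {} \<and> I1 \<noteq> {} \<and> I2 \<noteq> {} \<and>
      (\<forall>i\<in>I1. q i + j i \<le> g) \<and> (\<forall>i\<in>I2. g < p i))"
proof -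
  have "\<forall>i\<in>I. p i \<le> q i + (j i - 1)" using assms(3) by (simp add: trans_le_add1)
  from interval_or_gap[of I p "\<lambda>i. q i + (j i - 1)", OF assms(1,2) this] show ?thesis
  proof (elim disjE exE conjE, goal_cases)
    case (1 lo hi)
    then show ?thesis unfolding shadow_def by blast
  next
    case gap: (2 g I1 I2)
    have "\<forall>i\<in>I1. q i + j i \<le> g"
    proof
      fix i assume i: "i \<in> I1"
      then have "i \<in> I" using gap(1) by blast
      then show "q i + j i \<le> g" using bspec[OF gap(5) i] assms(4) by fastforce
    qed
    then show ?thesis using gap by blast
  qed
qed

definition aged_sum :: "('i \<Rightarrow> real poly) \<Rightarrow> ('i \<Rightarrow> nat) \<Rightarrow> 'i set \<Rightarrow> real poly" where
  "aged_sum \<gamma> j I = (\<Sum>i\<in>I. [:1, -1:] ^ j i * \<gamma> i)"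

lemma coeff_aged:
  fixes c :: "'a::comm_ring_1 poly"
  assumes "\<And>k. coeff c k \<noteq> 0 \<Longrightarrow> p \<le> k \<and> k \<le> q" "coeff ([:1, -1:] ^ j * c) k \<noteq> 0"
  shows "p \<le> k \<and> k \<le> q + j"
  using assms(2)
proof (induction j arbitrary: k)
  case (Suc j)
  have "coeff ([:1, -1:] * ([:1, -1:] ^ j * c)) k \<noteq> 0" using Suc.prems by (simp only: power_Suc mult.assoc not_False_eq_True)
  then have "coeff ([:1, -1:] ^ j * c) k \<noteq> 0 \<or> (k > 0 \<and> coeff ([:1, -1:] ^ j * c) (k - 1) \<noteq> 0)"
    unfolding coeff_one_minus_x_mult by (auto split: if_splits)
  then show ?case using Suc.IH[of k] Suc.IH[of "k - 1"] by auto
qed (use assms(1) in auto)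

lemma coeff_aged_sum:
  assumes "\<And>i k. i \<in> I \<Longrightarrow> coeff (\<gamma> i) k \<noteq> 0 \<Longrightarrow> p i \<le> k \<and> k \<le> q i" "coeff (aged_sum \<gamma> j I) k \<noteq> 0"
  shows "k \<in> shadow p q j I"
proof -
  have "(\<Sum>i\<in>I. coeff ([:1, -1:] ^ j i * \<gamma> i) k) \<noteq> 0"
    using assms(2) by (simp add: aged_sum_def coeff_sum)
  then obtain i where "i \<in> I" "coeff ([:1, -1:] ^ j i * \<gamma> i) k \<noteq> 0" by (meson sum.neutral)
  then show ?thesis using coeff_aged[of "\<gamma> i" "p i" "q i" "j i" k] assms(1) by (auto simp: shadow_def)
qed

lemma aged_sum_Un:
  "finite I \<Longrightarrow> finite J \<Longrightarrow> I \<inter> J = {} \<Longrightarrow> aged_sum \<gamma> j (I \<union> J) = aged_sum \<gamma> j I + aged_sum \<gamma> j J"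
  by (simp add: aged_sum_def sum.union_disjoint)

lemma aged_sum_age:
  assumes "\<And>i. i \<in> I \<Longrightarrow> j i \<ge> 1"
  shows "aged_sum \<gamma> j I = [:1, -1:] * aged_sum \<gamma> (\<lambda>i. j i - 1) I"
  unfolding aged_sum_def sum_distrib_left
proof (intro sum.cong refl)
  fix i assume "i \<in> I"
  then obtain m where "j i = Suc m" using assms[of i] by (cases "j i") auto
  then show "[:1, - 1:] ^ j i * \<gamma> i = [:1, - 1:] * ([:1, - 1:] ^ (j i - 1) * \<gamma> i)"
    by (simp only: power_Suc diff_Suc_1 mult.assoc)
qed

text \<open>
  Induction on the total age. Members of age \<open>0\<close> are added last: each of them occupies one column,
  and a column already in the shadow of the others costs at most two alternations. If all members
  are older and the shadow one step earlier is connected, the whole sum is \<open>1 - x\<close> times the younger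
  sum, and one alternation is gained against one column. If it is disconnected, the two
  sides are treated separately. Positivity at \<open>x = 1/2\<close> guarantees that no partial sum vanishes.
\<close>

lemma positive_family_alternates:
  fixes u k :: "'i \<Rightarrow> nat" and c :: "'i \<Rightarrow> real"
  assumes "finite I" "I \<noteq> {}" "\<And>i. i \<in> I \<Longrightarrow> c i > 0"
  shows "alternates_ge (coeff (aged_sum (\<lambda>i. monom (c i) (k i)) u I))
           (int (card (shadow k k u I)) - 2 * int (card I) + 2)"
  using assms
proof (induction "\<Sum>i\<in>I. u i + 1" arbitrary: I u rule: less_induct)
  case less
  define A where "A u I = aged_sum (\<lambda>i. monom (c i) (k i)) u I" for u I
  define U where "U u I = shadow k k u I" for u I
  have ne0: "A u I \<noteq> 0" if "finite I" "I \<noteq> {}" "\<And>i. i \<in> I \<Longrightarrow> c i > 0" for u I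
  proof
    assume "A u I = 0"
    have "poly (A u I) (1/2) = (\<Sum>i\<in>I. (1/2) ^ u i * (c i * (1/2) ^ k i))"
      unfolding A_def aged_sum_def by (simp add: poly_sum poly_monom)
    also have "\<dots> > 0" using that by (intro sum_pos) auto
    finally show False using \<open>A u I = 0\<close> by simp
  qed
  have supp: "coeff (A u I) x \<noteq> 0 \<Longrightarrow> x \<in> U u I" for u I x
    unfolding A_def U_def by (rule coeff_aged_sum[rotated]) (auto split: if_splits)
  show ?case
  proof (cases "\<exists>i\<in>I. u i = 0")
    case True
    define F where "F = {i\<in>I. u i = 0}"
    define R where "R = I - F"
    have IFR: "I = R \<union> F" "R \<inter> F = {}" "F \<noteq> {}" using True by (auto simp: F_def R_def)
    have fin: "finite F" "finite R" using less.prems(1) by (auto simp: F_def R_def)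
    have cI: "card I = card R + card F" using IFR fin by (metis card_Un_disjoint)
    have UF: "card (U u F) \<le> card F"
    proof -
      have "U u F = k ` F" unfolding U_def shadow_def F_def by auto
      then show ?thesis using fin(1) by (simp add: card_image_le)
    qed
    have cF: "card F \<ge> 1" using IFR(3) fin by (simp add: Suc_le_eq card_gt_0_iff)
    show ?thesis
    proof (cases "R = {}")
      case True
      then have "I = F" using IFR by auto
      then have "int (card (U u I)) - 2 * int (card I) + 2 \<le> 1" using UF cF by auto
      moreover obtain x where "coeff (A u I) x \<noteq> 0"
        using ne0[OF less.prems] by (metis leading_coeff_0_iff)
      ultimately show ?thesis using alternates_ge_one alternates_ge_mono unfolding A_def U_def by blast
    next
      case False
      have sum: "(\<Sum>i\<in>R. u i + 1) < (\<Sum>i\<in>I. u i + 1)"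
      proof -
        have "(\<Sum>i\<in>I. u i + 1) = (\<Sum>i\<in>R. u i + 1) + (\<Sum>i\<in>F. u i + 1)"
          using IFR fin by (metis sum.union_disjoint)
        moreover have "(\<Sum>i\<in>F. u i + 1) > 0" using fin IFR(3) by (intro sum_pos) auto
        ultimately show ?thesis by simp
      qed
      define S where "S = U u R \<inter> U u F"
      have fS: "finite S" using fin by (auto simp: S_def U_def)
      have IH: "alternates_ge (coeff (A u R)) (int (card (U u R)) - 2 * int (card R) + 2)"
        unfolding A_def U_def using less.prems IFR False fin by (intro less.hyps[OF sum]) auto
      have "alternates_ge (coeff (A u I)) (int (card (U u R)) - 2 * int (card R) + 2 - 2 * int (card S))"
      proof (rule alternates_ge_change[OF fS IH])
        fix x assume x: "x \<notin> S" "coeff (A u R) x \<noteq> 0"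
        have "coeff (A u F) x = 0" using x supp[of u F x] supp[of u R x] unfolding S_def by blast
        then show "coeff (A u I) x = coeff (A u R) x"
          using aged_sum_Un[OF fin(2,1) IFR(2)] IFR(1) unfolding A_def by simp
      qed
      moreover have "card (U u I) + card S = card (U u R) + card (U u F)"
        using card_Un_Int[of "U u R" "U u F"] fin IFR(1) shadow_Un unfolding U_def S_def
        by (metis finite_shadow)
      moreover have "card S \<le> card (U u F)" using fin unfolding S_def U_def by (intro card_mono) auto
      ultimately show ?thesis using UF cI unfolding A_def[symmetric] U_def[symmetric]
        by (elim alternates_ge_mono) linarith
    qed
  next
    case False
    then have u1: "\<forall>i\<in>I. u i \<ge> 1" by (simp add: Suc_le_eq)
    have kk: "\<forall>i\<in>I. k i \<le> k i" by simp
    from shadow_interval_or_gap[of I k k u, OF less.prems(1,2) kk u1] show ?thesis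
    proof (elim disjE exE conjE, goal_cases)
      case interval: (1 lo hi)
      have "card (U u I) = card (U (\<lambda>i. u i - 1) I) + 1"
        unfolding U_def by (rule card_shadow_age[OF _ _ interval(2,1)]) (use u1 in auto)
      moreover have "(\<Sum>i\<in>I. u i - 1 + 1) < (\<Sum>i\<in>I. u i + 1)"
        using less.prems u1 by (intro sum_strict_mono) auto
      then have "alternates_ge (coeff (A (\<lambda>i. u i - 1) I)) (int (card (U (\<lambda>i. u i - 1) I)) - 2 * int (card I) + 2)"
        unfolding A_def U_def using less.prems by (intro less.hyps) auto
      then have "alternates_ge (coeff (A u I)) (int (card (U (\<lambda>i. u i - 1) I)) - 2 * int (card I) + 2 + 1)"
        using alternates_ge_one_minus_x_mult[OF _ ne0[OF less.prems]] aged_sum_age[of I u] u1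
        unfolding A_def by metis
      ultimately show ?thesis unfolding A_def U_def by (elim alternates_ge_mono) linarith
    next
      case gap: (2 g I1 I2)
      have fin: "finite I1" "finite I2" using gap(1) less.prems(1) by auto
      have sum: "(\<Sum>i\<in>I. u i + 1) = (\<Sum>i\<in>I1. u i + 1) + (\<Sum>i\<in>I2. u i + 1)"
        using gap(1,2) fin by (metis sum.union_disjoint)
      have pos: "(\<Sum>i\<in>I1. u i + 1) > 0" "(\<Sum>i\<in>I2. u i + 1) > 0" using fin gap(3,4) by (auto intro!: sum_pos)
      have IH1: "alternates_ge (coeff (A u I1)) (int (card (U u I1)) - 2 * int (card I1) + 2)"
        unfolding A_def U_def using less.prems gap(1,3,4) fin sum pos by (intro less.hyps) auto
      have IH2: "alternates_ge (coeff (A u I2)) (int (card (U u I2)) - 2 * int (card I2) + 2)"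
        unfolding A_def U_def using less.prems gap(1,3,4) fin sum pos by (intro less.hyps) auto
      have U1: "x \<le> g" if x: "x \<in> U u I1" for x
      proof -
        obtain i where "i \<in> I1" "x \<le> k i + u i" using x unfolding U_def shadow_def by auto
        then show ?thesis using gap(5) by (meson le_trans)
      qed
      have U2: "x > g" if x: "x \<in> U u I2" for x
      proof -
        obtain i where "i \<in> I2" "k i \<le> x" using x unfolding U_def shadow_def by auto
        then show ?thesis using gap(6) by (meson less_le_trans)
      qed
      have "alternates_ge (\<lambda>x. coeff (A u I1) x + coeff (A u I2) x)
        ((int (card (U u I1)) - 2 * int (card I1) + 2) + (int (card (U u I2)) - 2 * int (card I2) + 2) - 1)"
        using supp U1 U2 by (intro alternates_ge_append[OF IH1 IH2, of g]) (meson not_le)+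
      moreover have "(\<lambda>x. coeff (A u I1) x + coeff (A u I2) x) = coeff (A u I)"
        using aged_sum_Un[OF fin gap(2)] gap(1) unfolding A_def by auto
      moreover have "card (U u I) = card (U u I1) + card (U u I2)"
      proof -
        have "U u I1 \<inter> U u I2 = {}" using U1 U2 by (meson disjoint_iff not_le)
        then show ?thesis using fin gap(1) unfolding U_def shadow_Un gap(1)
          by (intro card_Un_disjoint) auto
      qed
      moreover have "card I = card I1 + card I2" using gap(1,2) fin by (simp add: card_Un_disjoint)
      ultimately show ?thesis unfolding A_def U_def by simp (elim alternates_ge_mono, linarith)
    qed
  qed
qed

text \<open>
  A lower bound for the number of alternations of a sum whose members have all aged and were connected
  one year before (\<open>interval_family_alternates\<close>): an interval of length \<open>c\<close> contributes \<open>1 - 2c\<close>, each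
  year of age costs one, and each column of the shadow earns two.
\<close>

definition height :: "('i \<Rightarrow> nat) \<Rightarrow> ('i \<Rightarrow> nat) \<Rightarrow> ('i \<Rightarrow> nat) \<Rightarrow> 'i set \<Rightarrow> int" where
  "height p q j I = (\<Sum>i\<in>I. 1 - int (j i) - 2 * int (q i - p i + 1)) + 2 * int (card (shadow p q j I))"

lemma height_age:
  assumes "finite I" "\<And>i. i \<in> I \<Longrightarrow> p i \<le> q i" "\<And>i. i \<in> I \<Longrightarrow> j i \<ge> 1"
    "shadow p q (\<lambda>i. j i - 1) I = {lo..hi}" "lo \<le> hi"
  shows "height p q j I = height p q (\<lambda>i. j i - 1) I - int (card I) + 2"
proof -
  have "(\<Sum>i\<in>I. 1 - int (j i - 1) - 2 * int (q i - p i + 1)) = (\<Sum>i\<in>I. (1 - int (j i) - 2 * int (q i - p i + 1)) + 1)"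
    using assms(3) by (intro sum.cong) (auto simp: of_nat_diff)
  also have "\<dots> = (\<Sum>i\<in>I. 1 - int (j i) - 2 * int (q i - p i + 1)) + int (card I)"
    by (simp only: sum.distrib) simp
  finally have 1: "(\<Sum>i\<in>I. 1 - int (j i - 1) - 2 * int (q i - p i + 1))
      = (\<Sum>i\<in>I. 1 - int (j i) - 2 * int (q i - p i + 1)) + int (card I)" .
  have 2: "card (shadow p q j I) = card (shadow p q (\<lambda>i. j i - 1) I) + 1"
    by (rule card_shadow_age) (use assms in auto)
  show ?thesis unfolding height_def using 1 2 by linarith
qed

text \<open>
  The same induction as for positive monomials, but now the members are arbitrary nonzero
  polynomials and the sum may vanish. In that case the height must be small: either the intervals
  of the youngest members overlap, or the sum of the older ones is supported in the overlap of
  their shadow with that of the youngest ones, which bounds the number of its alternations.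
\<close>

lemma family_alternates:
  fixes \<gamma> :: "'i \<Rightarrow> real poly"
  assumes "finite I" "I \<noteq> {}" "\<And>i. i \<in> I \<Longrightarrow> p i \<le> q i" "\<And>i. i \<in> I \<Longrightarrow> \<gamma> i \<noteq> 0"
    "\<And>i k. i \<in> I \<Longrightarrow> coeff (\<gamma> i) k \<noteq> 0 \<Longrightarrow> p i \<le> k \<and> k \<le> q i"
  shows "(aged_sum \<gamma> j I \<noteq> 0 \<longrightarrow> alternates_ge (coeff (aged_sum \<gamma> j I)) (height p q j I - int (card I) + 1))
     \<and> (aged_sum \<gamma> j I = 0 \<longrightarrow> height p q j I \<le> int (card I) - 2)"
  using assms
proof (induction "\<Sum>i\<in>I. j i + 1" arbitrary: I j rule: less_induct)
  case less
  define A where "A j I = aged_sum \<gamma> j I" for j I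
  define U where "U j I = shadow p q j I" for j I
  define h where "h j I = height p q j I" for j I
  have supp: "x \<in> U j J" if "coeff (A j J) x \<noteq> 0" "J \<subseteq> I" for j J x
    using that coeff_aged_sum[of J \<gamma> p q j x] less.prems(5) unfolding A_def U_def by blast
  have goal: "(A j I \<noteq> 0 \<longrightarrow> alternates_ge (coeff (A j I)) (h j I - int (card I) + 1))
     \<and> (A j I = 0 \<longrightarrow> h j I \<le> int (card I) - 2)"
  proof (cases "\<exists>i\<in>I. j i = 0")
    case True
    define F where "F = {i\<in>I. j i = 0}"
    define R where "R = I - F"
    have IFR: "I = R \<union> F" "R \<inter> F = {}" "F \<noteq> {}" using True by (auto simp: F_def R_def)
    have fin: "finite F" "finite R" using less.prems(1) by (auto simp: F_def R_def)
    have cI: "card I = card R + card F" using IFR fin by (metis card_Un_disjoint)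
    define S where "S = U j R \<inter> U j F"
    have fS: "finite S" using fin by (auto simp: S_def U_def)
    define c where "c = (\<Sum>i\<in>F. q i - p i + 1)"
    have UF: "U j F = (\<Union>i\<in>F. {p i..q i})" unfolding U_def shadow_def F_def by auto
    have ci: "card {p i..q i} = q i - p i + 1" if "i \<in> F" for i
      using less.prems(3)[of i] that by (simp add: Suc_diff_le F_def)
    have cF: "c = (\<Sum>i\<in>F. card {p i..q i})" unfolding c_def by (intro sum.cong refl) (simp only: ci)
    have cUF: "card (U j F) \<le> c"
      unfolding UF cF by (rule card_UN_le[OF fin(1)])
    have cS: "card (U j I) + card S = card (U j R) + card (U j F)"
      using card_Un_Int[of "U j R" "U j F"] fin IFR(1) shadow_Un unfolding U_def S_def
      by (metis finite_shadow)
    have "h j I = h j R + (\<Sum>i\<in>F. 1 - int (j i) - 2 * int (q i - p i + 1))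
        + 2 * int (card (U j I)) - 2 * int (card (U j R))"
      unfolding h_def height_def U_def[symmetric] using IFR(1,2) fin by (simp add: sum.union_disjoint)
    also have "(\<Sum>i\<in>F. 1 - int (j i) - 2 * int (q i - p i + 1)) = (\<Sum>i\<in>F. 1 - 2 * int (q i - p i + 1))"
      by (intro sum.cong) (auto simp: F_def)
    also have "\<dots> = int (card F) - 2 * int c"
      by (simp only: sum_subtractf sum_distrib_left[symmetric] c_def of_nat_sum) simp
    finally have hI: "h j I = h j R + int (card F) - 2 * int c + 2 * int (card (U j F)) - 2 * int (card S)"
      using cS by linarith
    have A: "A j I = A j R + A j F"
      using aged_sum_Un[OF fin(2,1) IFR(2)] IFR(1) unfolding A_def by simp
    show ?thesis
    proof (cases "R = {}")
      case True
      then have "I = F" "S = {}" "h j R = 0" using IFR by (auto simp: S_def U_def h_def height_def shadow_def)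
      show ?thesis
      proof (intro conjI impI)
        assume "A j I \<noteq> 0"
        then obtain x where "coeff (A j I) x \<noteq> 0" by (metis leading_coeff_0_iff)
        from alternates_ge_one[of "coeff (A j I)", OF this] show "alternates_ge (coeff (A j I)) (h j I - int (card I) + 1)"
          using hI cUF cI \<open>h j R = 0\<close> by (elim alternates_ge_mono) linarith
      next
        assume A0: "A j I = 0"
        obtain i where i: "i \<in> F" using IFR(3) by blast
        then obtain x where x: "coeff (\<gamma> i) x \<noteq> 0"
          using less.prems(4)[of i] IFR(1) by (metis UnI2 leading_coeff_0_iff)
        have "A j I = (\<Sum>i\<in>F. \<gamma> i)" unfolding A_def aged_sum_def \<open>I = F\<close>
          by (intro sum.cong refl) (auto simp: F_def)
        also have "\<dots> = \<gamma> i + (\<Sum>i\<in>F - {i}. \<gamma> i)" using fin(1) i by (rule sum.remove)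
        finally have "coeff (\<gamma> i) x + (\<Sum>i\<in>F - {i}. coeff (\<gamma> i) x) = 0"
          using A0 by (metis coeff_0 coeff_add coeff_sum)
        with x have "(\<Sum>i\<in>F - {i}. coeff (\<gamma> i) x) \<noteq> 0" by auto
        then obtain i' where i': "i' \<in> F - {i}" "coeff (\<gamma> i') x \<noteq> 0" by (meson sum.neutral)
        \<comment> \<open>a cancellation between the youngest members forces two of their intervals to overlap\<close>
        have "card (U j F) < c"
        proof -
          define V where "V = (\<Union>i\<in>F - {i}. {p i..q i})"
          have fV: "finite V" using fin(1) by (auto simp: V_def)
          have "U j F = {p i..q i} \<union> V" unfolding UF V_def using i by auto
          then have "card {p i..q i} + card V = card (U j F) + card ({p i..q i} \<inter> V)"
            using card_Un_Int[OF finite_atLeastAtMost fV] by metis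
          moreover have "x \<in> {p i..q i} \<inter> V"
            using less.prems(5)[of i x] less.prems(5)[of i' x] i i' x \<open>I = F\<close> by (auto simp: V_def)
          then have "card ({p i..q i} \<inter> V) \<ge> 1"
            using fV by (metis One_nat_def Suc_leI card_gt_0_iff empty_iff finite_Int)
          moreover have "card V \<le> (\<Sum>i\<in>F - {i}. card {p i..q i})"
            unfolding V_def using fin(1) by (intro card_UN_le) auto
          moreover have "c = card {p i..q i} + (\<Sum>i\<in>F - {i}. card {p i..q i})"
            unfolding cF by (rule sum.remove[OF fin(1) i])
          ultimately show ?thesis by linarith
        qed
        then show "h j I \<le> int (card I) - 2" using hI cI \<open>h j R = 0\<close> by linarith
      qed
    next
      case False
      have sum: "(\<Sum>i\<in>R. j i + 1) < (\<Sum>i\<in>I. j i + 1)"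
      proof -
        have "(\<Sum>i\<in>I. j i + 1) = (\<Sum>i\<in>R. j i + 1) + (\<Sum>i\<in>F. j i + 1)"
          using IFR fin by (metis sum.union_disjoint)
        moreover have "(\<Sum>i\<in>F. j i + 1) > 0" using fin IFR(3) by (intro sum_pos) auto
        ultimately show ?thesis by simp
      qed
      have IH: "(A j R \<noteq> 0 \<longrightarrow> alternates_ge (coeff (A j R)) (h j R - int (card R) + 1))
         \<and> (A j R = 0 \<longrightarrow> h j R \<le> int (card R) - 2)"
        unfolding A_def h_def using less.prems IFR False fin by (intro less.hyps[OF sum]) auto
      show ?thesis
      proof (cases "A j R = 0")
        case True
        then have "h j I \<le> int (card I) - 2" using IH hI cUF cI by linarith
        then show ?thesis by (auto intro: alternates_ge_nonpos)
      next
        case False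
        then have alt: "alternates_ge (coeff (A j R)) (h j R - int (card R) + 1)" using IH by blast
        show ?thesis
        proof (intro conjI impI)
          have "alternates_ge (coeff (A j I)) (h j R - int (card R) + 1 - 2 * int (card S))"
          proof (rule alternates_ge_change[OF fS alt])
            fix x assume x: "x \<notin> S" "coeff (A j R) x \<noteq> 0"
            have "coeff (A j F) x = 0" using x supp[of j F x] supp[of j R x] IFR(1) unfolding S_def by blast
            then show "coeff (A j I) x = coeff (A j R) x" unfolding A by simp
          qed
          then show "alternates_ge (coeff (A j I)) (h j I - int (card I) + 1)"
            using hI cUF cI by (elim alternates_ge_mono) linarith
        next
          assume "A j I = 0"
          then have AR: "coeff (A j R) x = - coeff (A j F) x" for x
            unfolding A by (metis add_eq_0_iff2 coeff_minus)
          have S: "x \<in> S" if "coeff (A j R) x \<noteq> 0" for x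
            using that AR[of x] supp[of j F x] supp[of j R x] IFR(1) unfolding S_def by auto
          from alt obtain L where "int L \<ge> h j R - int (card R) + 1" "alternates (coeff (A j R)) L"
            unfolding alternates_ge_def by blast
          then have "h j R - int (card R) + 1 \<le> int (card S)"
            using alternates_le_card[OF _ S fS] by fastforce
          moreover have "card S \<ge> 1"
          proof -
            obtain x where "coeff (A j R) x \<noteq> 0" using False by (metis leading_coeff_0_iff)
            then show ?thesis using S fS by (metis One_nat_def Suc_leI card_gt_0_iff empty_iff)
          qed
          ultimately show "h j I \<le> int (card I) - 2" using hI cUF cI by linarith
        qed
      qed
    qed
  next
    case False
    then have j1: "\<forall>i\<in>I. j i \<ge> 1" by (simp add: Suc_le_eq)
    have pq: "\<forall>i\<in>I. p i \<le> q i" using less.prems(3) by blast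
    from shadow_interval_or_gap[of I p q j, OF less.prems(1,2) pq j1] show ?thesis
    proof (elim disjE exE conjE, goal_cases)
      case interval: (1 lo hi)
      have hj: "h j I = h (\<lambda>i. j i - 1) I - int (card I) + 2"
        unfolding h_def by (rule height_age[OF less.prems(1) _ _ interval(2,1)]) (use pq j1 in auto)
      have Aj: "A j I = [:1, -1:] * A (\<lambda>i. j i - 1) I" unfolding A_def using j1 by (intro aged_sum_age) auto
      have "(\<Sum>i\<in>I. j i - 1 + 1) < (\<Sum>i\<in>I. j i + 1)"
        using less.prems j1 by (intro sum_strict_mono) auto
      then have IH: "(A (\<lambda>i. j i - 1) I \<noteq> 0 \<longrightarrow> alternates_ge (coeff (A (\<lambda>i. j i - 1) I)) (h (\<lambda>i. j i - 1) I - int (card I) + 1))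
         \<and> (A (\<lambda>i. j i - 1) I = 0 \<longrightarrow> h (\<lambda>i. j i - 1) I \<le> int (card I) - 2)"
        unfolding A_def h_def using less.prems by (intro less.hyps) auto
      have c1: "card I \<ge> 1" using less.prems by (simp add: Suc_le_eq card_gt_0_iff)
      show ?thesis
      proof (cases "A (\<lambda>i. j i - 1) I = 0")
        case True
        then have "A j I = 0" "h j I \<le> 0" using IH Aj hj by auto
        moreover have "card I \<noteq> 1"
        proof
          assume "card I = 1"
          then obtain i where "I = {i}" by (rule card_1_singletonE)
          then have "\<gamma> i = 0" using True by (auto simp: A_def aged_sum_def)
          then show False using less.prems(4)[of i] \<open>I = {i}\<close> by simp
        qed
        ultimately show ?thesis using c1 by auto
      next
        case False
        then have "alternates_ge (coeff (A j I)) (h (\<lambda>i. j i - 1) I - int (card I) + 1 + 1)"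
          unfolding Aj using IH by (intro alternates_ge_one_minus_x_mult) auto
        moreover have "A j I \<noteq> 0" unfolding Aj using False by (metis mult_eq_0_iff one_neq_zero pCons_eq_0_iff)
        ultimately show ?thesis using hj c1 by (auto elim: alternates_ge_mono)
      qed
    next
      case gap: (2 g I1 I2)
      have fin: "finite I1" "finite I2" using gap(1) less.prems(1) by auto
      have sum: "(\<Sum>i\<in>I. j i + 1) = (\<Sum>i\<in>I1. j i + 1) + (\<Sum>i\<in>I2. j i + 1)"
        using gap(1,2) fin by (metis sum.union_disjoint)
      have pos: "(\<Sum>i\<in>I1. j i + 1) > 0" "(\<Sum>i\<in>I2. j i + 1) > 0" using fin gap(3,4) by (auto intro!: sum_pos)
      have IH1: "(A j I1 \<noteq> 0 \<longrightarrow> alternates_ge (coeff (A j I1)) (h j I1 - int (card I1) + 1))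
         \<and> (A j I1 = 0 \<longrightarrow> h j I1 \<le> int (card I1) - 2)"
        unfolding A_def h_def using less.prems gap(1,3,4) fin sum pos by (intro less.hyps) auto
      have IH2: "(A j I2 \<noteq> 0 \<longrightarrow> alternates_ge (coeff (A j I2)) (h j I2 - int (card I2) + 1))
         \<and> (A j I2 = 0 \<longrightarrow> h j I2 \<le> int (card I2) - 2)"
        unfolding A_def h_def using less.prems gap(1,3,4) fin sum pos by (intro less.hyps) auto
      have U1: "x \<le> g" if x: "x \<in> U j I1" for x
      proof -
        obtain i where "i \<in> I1" "x \<le> q i + j i" using x unfolding U_def shadow_def by auto
        then show ?thesis using gap(5) by (meson le_trans)
      qed
      have U2: "x > g" if x: "x \<in> U j I2" for x
      proof -
        obtain i where "i \<in> I2" "p i \<le> x" using x unfolding U_def shadow_def by auto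
        then show ?thesis using gap(6) by (meson less_le_trans)
      qed
      have A: "A j I = A j I1 + A j I2"
        using aged_sum_Un[OF fin gap(2)] gap(1) unfolding A_def by auto
      have A1: "coeff (A j I1) x = 0" if "x > g" for x
        using supp[of j I1 x] U1[of x] gap(1) that by (meson Un_upper1 not_le)
      have A2: "coeff (A j I2) x = 0" if "x \<le> g" for x
        using supp[of j I2 x] U2[of x] gap(1) that by (meson Un_upper2 not_le)
      have h: "h j I = h j I1 + h j I2"
      proof -
        have "U j I1 \<inter> U j I2 = {}" using U1 U2 by (meson disjoint_iff not_le)
        then have "card (U j I) = card (U j I1) + card (U j I2)" using fin unfolding U_def gap(1) shadow_Un
          by (intro card_Un_disjoint) auto
        then show ?thesis unfolding h_def height_def U_def[symmetric] using gap(1,2) fin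
          by (simp add: sum.union_disjoint)
      qed
      have cI: "card I = card I1 + card I2" using gap(1,2) fin by (simp add: card_Un_disjoint)
      show ?thesis
      proof (cases "A j I1 = 0")
        case True
        then show ?thesis using IH1 IH2 A h cI by (auto elim!: alternates_ge_mono)
      next
        case n1: False
        show ?thesis
        proof (cases "A j I2 = 0")
          case True
          then show ?thesis using IH1 IH2 A h cI n1 by (auto elim!: alternates_ge_mono)
        next
          case False
          have "alternates_ge (\<lambda>x. coeff (A j I1) x + coeff (A j I2) x)
            ((h j I1 - int (card I1) + 1) + (h j I2 - int (card I2) + 1) - 1)"
            using IH1 IH2 n1 False A1 A2 by (intro alternates_ge_append[where g = g]) auto
          moreover have "(\<lambda>x. coeff (A j I1) x + coeff (A j I2) x) = coeff (A j I)" unfolding A by auto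
          ultimately have "alternates_ge (coeff (A j I)) (h j I - int (card I) + 1)"
            using h cI by (auto elim!: alternates_ge_mono)
          moreover have "A j I \<noteq> 0"
          proof
            assume "A j I = 0"
            obtain x where x: "coeff (A j I1) x \<noteq> 0" using n1 by (metis leading_coeff_0_iff)
            then have "coeff (A j I2) x = 0" using A1[of x] A2[of x] by force
            then show False using x \<open>A j I = 0\<close> A by (metis add.right_neutral coeff_0 coeff_add)
          qed
          ultimately show ?thesis by blast
        qed
      qed
    qed
  qed
  then show ?case unfolding A_def h_def .
qed

text \<open>
  One year before, the height of a family of \<open>r\<close> members exceeded the present one by \<open>r - 2\<close>, so a
  nonzero sum then had at least one alternation less than the present height; the last
  multiplication by \<open>1 - x\<close> adds the missing one.
\<close>

corollary interval_family_alternates: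
  fixes \<gamma> :: "'i \<Rightarrow> real poly"
  assumes "finite I" "I \<noteq> {}" "\<And>i. i \<in> I \<Longrightarrow> p i \<le> q i" "\<And>i. i \<in> I \<Longrightarrow> \<gamma> i \<noteq> 0"
    "\<And>i k. i \<in> I \<Longrightarrow> coeff (\<gamma> i) k \<noteq> 0 \<Longrightarrow> p i \<le> k \<and> k \<le> q i"
    "\<And>i. i \<in> I \<Longrightarrow> j i \<ge> 1" "shadow p q (\<lambda>i. j i - 1) I = {lo..hi}" "lo \<le> hi"
  shows "(aged_sum \<gamma> j I \<noteq> 0 \<longrightarrow> alternates_ge (coeff (aged_sum \<gamma> j I)) (height p q j I))
     \<and> (aged_sum \<gamma> j I = 0 \<longrightarrow> height p q j I \<le> 0)"
proof -
  let ?A = "aged_sum \<gamma> (\<lambda>i. j i - 1) I" and ?h = "height p q (\<lambda>i. j i - 1) I"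
  have hj: "height p q j I = ?h - int (card I) + 2"
    using height_age[of I p q j lo hi] assms by auto
  have Aj: "aged_sum \<gamma> j I = [:1, -1:] * ?A" by (rule aged_sum_age[OF assms(6)])
  have FI: "(?A \<noteq> 0 \<longrightarrow> alternates_ge (coeff ?A) (?h - int (card I) + 1)) \<and> (?A = 0 \<longrightarrow> ?h \<le> int (card I) - 2)"
    by (rule family_alternates[OF assms(1-5)])
  show ?thesis
  proof (cases "?A = 0")
    case True
    then show ?thesis using FI hj Aj by auto
  next
    case False
    then have "alternates_ge (coeff (aged_sum \<gamma> j I)) (?h - int (card I) + 1 + 1)"
      unfolding Aj using FI by (intro alternates_ge_one_minus_x_mult) auto
    moreover have "aged_sum \<gamma> j I \<noteq> 0" unfolding Aj using False
      by (metis mult_eq_0_iff one_neq_zero pCons_eq_0_iff)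
    ultimately show ?thesis using hj by (auto elim!: alternates_ge_mono)
  qed
qed

section \<open>Evaluation and expansion in one variable\<close>

abbreviation "keys \<equiv> Poly_Mapping.keys"
abbreviation "lookup \<equiv> Poly_Mapping.lookup"
abbreviation "single \<equiv> Poly_Mapping.single"

lemma rpoly_sum_single:
  fixes f :: rpoly
  shows "f = (\<Sum>m\<in>keys f. single m (lookup f m))"
proof (rule poly_mapping_eqI)
  fix k
  have "lookup (\<Sum>m\<in>keys f. single m (lookup f m)) k
      = (\<Sum>m\<in>keys f. if m = k then lookup f m else 0)"
    by (simp add: lookup_sum lookup_single when_def)
  also have "\<dots> = lookup f k" by (simp add: sum.delta in_keys_iff)
  finally show "lookup f k = lookup (\<Sum>m\<in>keys f. single m (lookup f m)) k" by simp
qed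

text \<open>
  Evaluation at a point, expansion in powers of one variable and restriction to a line
  are all ring homomorphisms determined by their values on constants and monomials; they are
  interpretations of this locale.
\<close>

locale monomial_hom =
  fixes e :: "real \<Rightarrow> 'a::comm_ring_1" and M :: "(nat \<Rightarrow>\<^sub>0 nat) \<Rightarrow> 'a"
  assumes e_zero: "e 0 = 0" and e_one: "e 1 = 1"
    and e_add: "e (x + y) = e x + e y" and e_mult: "e (x * y) = e x * e y"
    and M_zero: "M 0 = 1" and M_add: "M (m + k) = M m * M k"
begin

definition ext :: "rpoly \<Rightarrow> 'a" where
  "ext f = (\<Sum>m\<in>keys f. e (lookup f m) * M m)"

lemma ext_superset:
  assumes "finite S" "keys f \<subseteq> S"
  shows "ext f = (\<Sum>m\<in>S. e (lookup f m) * M m)"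
  unfolding ext_def using assms by (intro sum.mono_neutral_left) (auto simp: in_keys_iff e_zero)

lemma ext_zero [simp]: "ext 0 = 0"
  by (simp add: ext_def)

lemma ext_add: "ext (f + g) = ext f + ext g"
proof -
  let ?S = "keys f \<union> keys g"
  have "ext (f + g) = (\<Sum>m\<in>?S. e (lookup (f + g) m) * M m)"
    by (rule ext_superset) (use Poly_Mapping.keys_add[of f g] in auto)
  also have "\<dots> = ext f + ext g"
    by (subst (1 2) ext_superset[of ?S]) (auto simp: lookup_add e_add sum.distrib algebra_simps)
  finally show ?thesis .
qed

lemma ext_sum: "ext (sum f S) = (\<Sum>i\<in>S. ext (f i))"
  by (induction S rule: infinite_finite_induct) (auto simp: ext_add)

lemma ext_single: "ext (single m c) = e c * M m"
  by (cases "c = 0") (auto simp: ext_def e_zero)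

lemma ext_one [simp]: "ext 1 = 1"
  using ext_single[of 0 1] by (simp add: e_one M_zero)

lemma ext_mult: "ext (f * g) = ext f * ext g"
proof -
  have fg: "f * g = (\<Sum>m\<in>keys f. \<Sum>k\<in>keys g.
      single (m + k) (lookup f m * lookup g k))"
    by (subst rpoly_sum_single[of f], subst rpoly_sum_single[of g])
      (simp add: sum_product mult_single)
  have "ext (f * g) = (\<Sum>m\<in>keys f. \<Sum>k\<in>keys g. e (lookup f m * lookup g k) * M (m + k))"
    unfolding fg ext_sum ext_single ..
  also have "\<dots> = ext f * ext g"
    unfolding ext_def sum_product by (intro sum.cong refl) (simp add: e_mult M_add algebra_simps)
  finally show ?thesis .
qed

lemma ext_power: "ext (f ^ n) = ext f ^ n"
  by (induction n) (auto simp: ext_mult)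

lemma ext_diff: "ext (f - g) = ext f - ext g"
  using ext_add[of "f - g" g] by simp

end

definition monom_eval :: "(nat \<Rightarrow> real) \<Rightarrow> (nat \<Rightarrow>\<^sub>0 nat) \<Rightarrow> real" where
  "monom_eval x m = (\<Prod>i\<in>keys m. x i ^ lookup m i)"

lemma monom_eval_superset:
  assumes "finite S" "keys m \<subseteq> S"
  shows "monom_eval x m = (\<Prod>i\<in>S. x i ^ lookup m i)"
  unfolding monom_eval_def using assms by (intro prod.mono_neutral_left) (auto simp: in_keys_iff)

lemma monom_eval_zero [simp]: "monom_eval x 0 = 1"
  by (simp add: monom_eval_def)

lemma monom_eval_add: "monom_eval x (m + k) = monom_eval x m * monom_eval x k"
proof -
  let ?S = "keys m \<union> keys k"
  have "monom_eval x (m + k) = (\<Prod>i\<in>?S. x i ^ lookup (m + k) i)"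
    by (rule monom_eval_superset) (use Poly_Mapping.keys_add[of m k] in auto)
  also have "\<dots> = monom_eval x m * monom_eval x k"
    by (subst (1 2) monom_eval_superset[of ?S]) (auto simp: lookup_add power_add prod.distrib)
  finally show ?thesis .
qed

lemma monom_eval_pos: "(\<And>i. x i > 0) \<Longrightarrow> monom_eval x m > 0"
  unfolding monom_eval_def by (intro prod_pos) auto

interpretation eval: monomial_hom "\<lambda>c. c" "monom_eval x" for x
  by unfold_locales (auto simp: monom_eval_add)

lemma poly_eval_ext: "poly_eval f x = eval.ext x f"
  by (simp add: poly_eval_def eval.ext_def monom_eval_def)

lemmas poly_eval_zero [simp] = eval.ext_zero[folded poly_eval_ext]
  and poly_eval_one [simp] = eval.ext_one[folded poly_eval_ext]
  and poly_eval_add = eval.ext_add[folded poly_eval_ext]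
  and poly_eval_diff = eval.ext_diff[folded poly_eval_ext]
  and poly_eval_mult = eval.ext_mult[folded poly_eval_ext]
  and poly_eval_power = eval.ext_power[folded poly_eval_ext]
  and poly_eval_sum = eval.ext_sum[folded poly_eval_ext]
  and poly_eval_single = eval.ext_single[folded poly_eval_ext]

lemma poly_eval_pos:
  assumes "f \<noteq> 0" "\<And>m. lookup f m \<ge> 0" "\<And>i. x i > 0"
  shows "poly_eval f x > 0"
proof -
  have pos: "lookup f m * monom_eval x m > 0" if "m \<in> keys f" for m
  proof (rule mult_pos_pos)
    have "lookup f m \<noteq> 0" using that by (rule in_keys_iff[THEN iffD1])
    then show "lookup f m > 0" using assms(2)[of m] by linarith
    show "monom_eval x m > 0" by (rule monom_eval_pos) (rule assms(3))
  qed
  have "keys f \<noteq> {}" using assms(1) by simp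
  then have "(\<Sum>m\<in>keys f. lookup f m * monom_eval x m) > 0"
    by (rule sum_pos[OF finite_keys]) (rule pos)
  then show ?thesis by (simp only: poly_eval_ext eval.ext_def)
qed

definition var :: "nat \<Rightarrow> rpoly" where
  "var i = single (single i 1) 1"

definition var_sum :: "nat set \<Rightarrow> rpoly" where
  "var_sum S = (\<Sum>i\<in>S. var i)"

lemma poly_eval_var [simp]: "poly_eval (var i) x = x i"
  by (simp add: var_def poly_eval_single monom_eval_def)

lemma poly_eval_var_sum [simp]: "poly_eval (var_sum S) x = (\<Sum>i\<in>S. x i)"
  by (simp add: var_sum_def poly_eval_sum)

definition strip :: "nat \<Rightarrow> (nat \<Rightarrow>\<^sub>0 nat) \<Rightarrow> (nat \<Rightarrow>\<^sub>0 nat)" where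
  "strip i m = Poly_Mapping.update i 0 m"

lemma lookup_strip: "lookup (strip i m) k = (if k = i then 0 else lookup m k)"
  by (simp add: strip_def lookup_update)

lemma strip_add: "strip i (m + k) = strip i m + strip i k"
  by (rule poly_mapping_eqI) (simp add: lookup_strip lookup_add)

lemma strip_zero [simp]: "strip i 0 = 0"
  by (rule poly_mapping_eqI) (simp add: lookup_strip)

text \<open>
  Removing variable \<open>i\<close> from a monomial and remembering its exponent loses nothing.
\<close>

lemma strip_eq_iff: "lookup m i = e \<and> strip i m = k \<longleftrightarrow> m = k + single i e \<and> lookup k i = 0"
proof
  assume *: "lookup m i = e \<and> strip i m = k"
  then have "m = k + single i e"
    by (intro poly_mapping_eqI) (auto simp: lookup_strip lookup_add lookup_single when_def)
  moreover have "lookup k i = 0" using * lookup_strip[of i m i] by simp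
  ultimately show "m = k + single i e \<and> lookup k i = 0" ..
next
  assume *: "m = k + single i e \<and> lookup k i = 0"
  then have "strip i m = k"
    by (intro poly_mapping_eqI) (auto simp: lookup_strip lookup_add lookup_single when_def)
  with * show "lookup m i = e \<and> strip i m = k" by (auto simp: lookup_add)
qed

interpretation up: monomial_hom "\<lambda>c. [:single 0 c:]"
    "\<lambda>m. monom (single (strip i m) 1 :: rpoly) (lookup m i)" for i
  by unfold_locales
    (auto simp: single_add mult_single strip_add lookup_add mult_monom monom_0 one_pCons mult.commute)

text \<open>
  The polynomial as a univariate one in variable \<open>i\<close> whose coefficients involve only the other variables.
\<close>

definition upoly :: "nat \<Rightarrow> rpoly \<Rightarrow> rpoly poly" where
  "upoly i = up.ext i"

lemmas upoly_zero [simp] = up.ext_zero[folded upoly_def]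
  and upoly_mult = up.ext_mult[folded upoly_def]
  and upoly_power = up.ext_power[folded upoly_def]
  and upoly_sum = up.ext_sum[folded upoly_def]
  and upoly_single = up.ext_single[folded upoly_def]

lemma lookup_coeff_upoly:
  "lookup (coeff (upoly i f) k) m = (if lookup m i = 0 then lookup f (m + single i k) else 0)"
proof -
  have "lookup (coeff (upoly i f) k) m =
      (\<Sum>m'\<in>keys f. if lookup m' i = k \<and> strip i m' = m then lookup f m' else 0)"
    unfolding upoly_def up.ext_def
    by (auto simp: coeff_sum lookup_sum mult_single lookup_single when_def intro!: sum.cong)
  also have "\<dots> = (\<Sum>m'\<in>keys f. if m' = m + single i k then
      (if lookup m i = 0 then lookup f m' else 0) else 0)"
    unfolding strip_eq_iff by (intro sum.cong refl) auto
  also have "\<dots> = (if lookup m i = 0 then lookup f (m + single i k) else 0)"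
    by (auto simp: sum.delta in_keys_iff)
  finally show ?thesis .
qed

lemma bij_keys_coeff_upoly:
  "bij_betw (\<lambda>m. m + single i k) (keys (coeff (upoly i f) k))
    {m \<in> keys f. lookup m i = k}"
proof (rule bij_betwI')
  fix m assume "m \<in> {m \<in> keys f. lookup m i = k}"
  then have m: "lookup f m \<noteq> 0" "lookup m i = k" by (auto simp: in_keys_iff)
  have "m = strip i m + single i k" using strip_eq_iff[of m i k "strip i m"] m(2) by auto
  with m show "\<exists>y\<in>keys (coeff (upoly i f) k). m = y + single i k"
    by (intro bexI[of _ "strip i m"]) (auto simp: in_keys_iff lookup_coeff_upoly lookup_strip)
qed (auto simp: in_keys_iff lookup_coeff_upoly lookup_add split: if_splits)

lemma num_terms_coeff_upoly:
  "num_terms (coeff (upoly i f) k) = card {m \<in> keys f. lookup m i = k}"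
  unfolding num_terms_def by (rule bij_betw_same_card[OF bij_keys_coeff_upoly])

lemma coeff_upoly_eq_0_iff:
  "coeff (upoly i f) k = 0 \<longleftrightarrow> (\<forall>m\<in>keys f. lookup m i \<noteq> k)"
proof -
  have "coeff (upoly i f) k = 0 \<longleftrightarrow> keys (coeff (upoly i f) k) = {}"
    by simp
  also have "\<dots> \<longleftrightarrow> {m \<in> keys f. lookup m i = k} = {}"
    using bij_betw_imp_surj_on[OF bij_keys_coeff_upoly[of i k f]] by (metis image_is_empty)
  finally show ?thesis by auto
qed

lemma upoly_eq_0_iff [simp]: "upoly i f = 0 \<longleftrightarrow> f = 0"
proof
  assume "upoly i f = 0"
  then have "\<forall>m\<in>keys f. lookup m i \<noteq> k" for k
    using coeff_upoly_eq_0_iff[of i f k] by simp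
  then have "keys f = {}" by blast
  then show "f = 0" by simp
qed simp

lemma upoly_var: "upoly i (var j) = (if i = j then [:0, 1:] else [:var j:])"
proof -
  have "strip i (single j 1) = (if i = j then 0 else single j (1::nat))"
    by (auto intro!: poly_mapping_eqI simp: lookup_strip lookup_single when_def)
  then show ?thesis
    by (auto simp: var_def upoly_single lookup_single when_def monom_Suc monom_0)
qed

lemma upoly_var_sum:
  assumes "finite S" "i \<in> S"
  shows "upoly i (var_sum S) = [:var_sum (S - {i}), 1:]"
proof -
  have "upoly i (var_sum S) = upoly i (var i) + (\<Sum>j\<in>S - {i}. upoly i (var j))"
    unfolding var_sum_def upoly_sum using assms by (rule sum.remove)
  also have "(\<Sum>j\<in>S - {i}. upoly i (var j)) = (\<Sum>j\<in>S - {i}. [:var j:])"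
    by (intro sum.cong refl) (auto simp: upoly_var)
  also have "\<dots> = [:var_sum (S - {i}):]"
    unfolding var_sum_def by (induction "S - {i}" rule: infinite_finite_induct) (auto simp: sum_to_poly)
  finally show ?thesis by (simp add: upoly_var)
qed

interpretation slc: monomial_hom "\<lambda>c. [:c:]"
    "\<lambda>m. monom (monom_eval y (strip i m)) (lookup m i)" for i y
  by unfold_locales
    (auto simp: monom_eval_add strip_add lookup_add mult_monom monom_0 one_pCons)

text \<open>
  The restriction to the line through \<open>y\<close> in direction of variable \<open>i\<close>.
\<close>

definition slice :: "nat \<Rightarrow> (nat \<Rightarrow> real) \<Rightarrow> rpoly \<Rightarrow> real poly" where
  "slice i y = slc.ext y i"

lemmas slice_mult = slc.ext_mult[folded slice_def]
  and slice_power = slc.ext_power[folded slice_def]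

lemma coeff_slice: "coeff (slice i y f) k = poly_eval (coeff (upoly i f) k) y"
  unfolding slice_def slc.ext_def upoly_def up.ext_def
  by (auto simp: coeff_sum poly_eval_sum mult_single poly_eval_single intro!: sum.cong)

lemma monom_eval_upd: "monom_eval (y(i := t)) m = t ^ lookup m i * monom_eval y (strip i m)"
proof -
  let ?S = "insert i (keys m)"
  have "monom_eval (y(i := t)) m = (\<Prod>j\<in>?S. (y(i := t)) j ^ lookup m j)"
    by (rule monom_eval_superset) auto
  also have "\<dots> = t ^ lookup m i * (\<Prod>j\<in>?S - {i}. (y(i := t)) j ^ lookup m j)"
    by (subst prod.remove[of _ i]) auto
  also have "(\<Prod>j\<in>?S - {i}. (y(i := t)) j ^ lookup m j) = (\<Prod>j\<in>?S. y j ^ lookup (strip i m) j)"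
    by (subst (2) prod.remove[of _ i]) (auto simp: lookup_strip intro!: prod.cong)
  also have "\<dots> = monom_eval y (strip i m)"
    by (rule monom_eval_superset[symmetric]) (auto simp: in_keys_iff lookup_strip split: if_splits)
  finally show ?thesis .
qed

lemma poly_slice: "poly (slice i y f) t = poly_eval f (y(i := t))"
  unfolding slice_def slc.ext_def poly_eval_ext eval.ext_def
  by (auto simp: poly_sum poly_monom monom_eval_upd intro!: sum.cong)

lemma slice_var_sum:
  assumes "finite S" "i \<in> S"
  shows "slice i y (var_sum S) = [:\<Sum>j\<in>S - {i}. y j, 1:]"
  by (rule poly_eqI) (auto simp: coeff_slice upoly_var_sum[OF assms] coeff_pCons split: nat.splits)

text \<open>
  Induction on the number of variables: choose the other coordinates so that some coefficient in the
  expansion along variable \<open>i\<close> survives; the resulting univariate polynomial has only finitely many roots.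
\<close>

lemma ex_pos_poly_eval_nonzero_aux:
  assumes "finite V" "f \<noteq> 0" "\<And>m. m \<in> keys f \<Longrightarrow> keys m \<subseteq> V"
  shows "\<exists>x. (\<forall>i. x i > 0) \<and> poly_eval f x \<noteq> 0"
  using assms
proof (induction V arbitrary: f rule: finite_induct)
  case empty
  have "keys f \<subseteq> {0}" using empty by force
  moreover have "keys f \<noteq> {}" using empty by simp
  ultimately have k: "keys f = {0}" by blast
  then have "poly_eval f (\<lambda>_. 1) = lookup f 0" by (simp add: poly_eval_def)
  also have "\<dots> \<noteq> 0" using k by (metis in_keys_iff singletonI)
  finally show ?case by (intro exI[of _ "\<lambda>_. 1"]) auto
next
  case (insert i V)
  obtain m0 where m0: "m0 \<in> keys f" using insert.prems(1) by fastforce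
  define g where "g = coeff (upoly i f) (lookup m0 i)"
  have "g \<noteq> 0" unfolding g_def coeff_upoly_eq_0_iff using m0 by blast
  moreover have "keys m \<subseteq> V" if "m \<in> keys g" for m
  proof -
    have m: "lookup m i = 0" "m + single i (lookup m0 i) \<in> keys f"
      using that by (auto simp: g_def in_keys_iff lookup_coeff_upoly split: if_splits)
    have "keys m \<subseteq> keys (m + single i (lookup m0 i))"
      by (auto simp: in_keys_iff lookup_add)
    then show ?thesis using insert.prems(2)[OF m(2)] m(1) by (auto simp: in_keys_iff)
  qed
  ultimately obtain y where y: "\<And>i. y i > 0" "poly_eval g y \<noteq> 0" using insert.IH by metis
  then have "slice i y f \<noteq> 0" unfolding g_def coeff_slice[symmetric] by auto
  then have "finite {t. poly (slice i y f) t = 0}" by (rule poly_roots_finite)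
  moreover have "infinite {0::real<..}" by (rule infinite_Ioi)
  ultimately have "\<not> {0<..} \<subseteq> {t. poly (slice i y f) t = 0}" using finite_subset by blast
  then obtain t where t: "t > 0" "poly (slice i y f) t \<noteq> 0" by auto
  show ?case
  proof (intro exI[of _ "y(i := t)"] conjI allI)
    show "(y(i := t)) j > 0" for j using y(1) t(1) by simp
    show "poly_eval f (y(i := t)) \<noteq> 0" using t(2) unfolding poly_slice .
  qed
qed

lemma ex_pos_poly_eval_nonzero:
  assumes "f \<noteq> 0"
  shows "\<exists>x. (\<forall>i. x i > 0) \<and> poly_eval f x \<noteq> 0"
  using ex_pos_poly_eval_nonzero_aux[of "\<Union>(keys ` keys f)" f] assms by auto

section \<open>Terms of multiples of powers of a sum of variables\<close>

lemma finite_coeff_support: "finite {k. coeff g k \<noteq> 0}"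
  by (rule finite_subset[of _ "{..degree g}"]) (auto intro: le_degree)

text \<open>
  The operator \<open>g \<mapsto> x g' - e g\<close> kills exactly the term of exponent \<open>e\<close> and costs one factor
  \<open>x + c\<close>; it does not kill all of \<open>g\<close>, since a monomial is not divisible by \<open>x + c\<close> for \<open>c \<noteq> 0\<close>.
\<close>

lemma card_support_power_dvd:
  fixes g :: "real poly"
  assumes "c \<noteq> 0" "g \<noteq> 0" "[:c, 1:] ^ v dvd g"
  shows "v + 1 \<le> card {k. coeff g k \<noteq> 0}"
  using assms(2,3)
proof (induction v arbitrary: g)
  case 0
  then have "coeff g (degree g) \<noteq> 0" by simp
  then have "{k. coeff g k \<noteq> 0} \<noteq> {}" by blast
  then show ?case using finite_coeff_support[of g] by (simp add: Suc_le_eq card_gt_0_iff)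
next
  case (Suc v)
  obtain h where h: "g = [:c, 1:] ^ Suc v * h" using Suc.prems(2) by (rule dvdE)
  define e where "e = degree g"
  have e: "coeff g e \<noteq> 0" using Suc.prems(1) by (simp add: e_def)
  define q where "q = pCons 0 (pderiv g) - smult (real e) g"
  have cq: "coeff q k = (real k - real e) * coeff g k" for k
    unfolding q_def by (cases k) (auto simp: coeff_pderiv algebra_simps)
  have "[:c, 1:] ^ v dvd pderiv g"
  proof -
    have "[:c, 1:] ^ v dvd [:c, 1:] ^ Suc v" by (simp only: power_Suc dvd_triv_right)
    then show ?thesis unfolding h pderiv_mult pderiv_power_Suc
      by (intro dvd_add dvd_mult2 dvd_mult dvd_smult dvd_refl)
  qed
  moreover have "pCons 0 (pderiv g) = [:0, 1:] * pderiv g" by simp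
  moreover have "[:c, 1:] ^ v dvd g" by (rule power_le_dvd[OF Suc.prems(2)]) simp
  ultimately have dvd: "[:c, 1:] ^ v dvd q" unfolding q_def by (metis dvd_diff dvd_mult dvd_smult)
  have "q \<noteq> 0"
  proof
    assume "q = 0"
    then have "coeff g k = 0" if "k \<noteq> e" for k using cq[of k] that by simp
    then have "g = monom (coeff g e) e" by (intro poly_eqI) auto
    then have "poly g (- c) = coeff g e * (- c) ^ e" by (metis poly_monom)
    moreover have "poly g (- c) = 0" unfolding h by simp
    ultimately show False using e assms(1) by simp
  qed
  from Suc.IH[OF this dvd] have "v + 1 \<le> card {k. coeff q k \<noteq> 0}" .
  also have "{k. coeff q k \<noteq> 0} = {k. coeff g k \<noteq> 0} - {e}" using cq by auto
  finally have "v + 1 \<le> card ({k. coeff g k \<noteq> 0} - {e})" .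
  moreover have "card {k. coeff g k \<noteq> 0} = Suc (card ({k. coeff g k \<noteq> 0} - {e}))"
    by (rule card.remove) (use e finite_coeff_support[of g] in auto)
  ultimately show ?case by linarith
qed

text \<open>
  On a line with positive generic coordinates the sum of the variables in \<open>S\<close> becomes \<open>y\<^sub>i + c\<close> with
  \<open>c > 0\<close>, so the univariate count applies.
\<close>

lemma card_exponents_ge:
  assumes "finite S" "i \<in> S" "S \<noteq> {i}" "f \<noteq> 0" "var_sum S ^ v dvd f"
  shows "v + 1 \<le> card ((\<lambda>m. lookup m i) ` keys f)"
proof -
  obtain m0 where m0: "m0 \<in> keys f" using assms(4) by fastforce
  define g where "g = coeff (upoly i f) (lookup m0 i)"
  have "g \<noteq> 0" unfolding g_def coeff_upoly_eq_0_iff using m0 by blast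
  then obtain y where y: "\<And>i. y i > 0" "poly_eval g y \<noteq> 0"
    using ex_pos_poly_eval_nonzero by blast
  obtain h where h: "f = var_sum S ^ v * h" using assms(5) by (rule dvdE)
  define c where "c = (\<Sum>j\<in>S - {i}. y j)"
  have "c > 0" unfolding c_def using assms(1-3) y(1) by (intro sum_pos) auto
  moreover have "slice i y f \<noteq> 0" using y(2) unfolding g_def coeff_slice[symmetric] by auto
  moreover have "[:c, 1:] ^ v dvd slice i y f"
    unfolding h slice_mult slice_power slice_var_sum[OF assms(1,2)] c_def by simp
  ultimately have "v + 1 \<le> card {k. coeff (slice i y f) k \<noteq> 0}"
    by (intro card_support_power_dvd) auto
  also have "\<dots> \<le> card ((\<lambda>m. lookup m i) ` keys f)"
  proof (rule card_mono)
    show "{k. coeff (slice i y f) k \<noteq> 0} \<subseteq> (\<lambda>m. lookup m i) ` keys f"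
    proof
      fix k assume "k \<in> {k. coeff (slice i y f) k \<noteq> 0}"
      then have "coeff (upoly i f) k \<noteq> 0" by (auto simp: coeff_slice)
      then show "k \<in> (\<lambda>m. lookup m i) ` keys f" unfolding coeff_upoly_eq_0_iff by blast
    qed
  qed simp
  finally show ?thesis .
qed

lemma num_terms_ge:
  assumes "finite S" "2 \<le> card S" "f \<noteq> 0" "var_sum S ^ v dvd f"
  shows "v + 1 \<le> num_terms f"
proof -
  obtain i where "i \<in> S" using assms(2) by fastforce
  moreover have "S \<noteq> {i}" using assms(2) by auto
  ultimately have "v + 1 \<le> card ((\<lambda>m. lookup m i) ` keys f)"
    using assms by (intro card_exponents_ge) auto
  also have "\<dots> \<le> num_terms f" unfolding num_terms_def by (rule card_image_le) simp
  finally show ?thesis .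
qed

lemma var_sum_nonzero:
  assumes "finite S" "S \<noteq> {}"
  shows "var_sum S \<noteq> 0"
proof
  assume "var_sum S = 0"
  then have "(\<Sum>i\<in>S. 1 :: real) = 0" using poly_eval_var_sum[of S "\<lambda>_. 1"] by simp
  then show False using assms by simp
qed

text \<open>
  The lowest coefficient of a product is the product of the lowest coefficients, and the lowest
  coefficient of the sum over \<open>S\<close> along variable \<open>i\<close> is the sum over \<open>S - {i}\<close>.
\<close>

lemma ex_power_dvd_coeff_upoly:
  assumes "finite S" "i \<in> S" "S \<noteq> {i}" "f \<noteq> 0" "var_sum S ^ v dvd f"
  shows "\<exists>e. coeff (upoly i f) e \<noteq> 0 \<and> var_sum (S - {i}) ^ v dvd coeff (upoly i f) e"
proof -
  have nz: "var_sum (S - {i}) \<noteq> 0" using assms(1-3) by (intro var_sum_nonzero) auto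
  obtain h where h: "f = var_sum S ^ v * h" using assms(5) by (rule dvdE)
  have "h \<noteq> 0" using h assms(4) by auto
  then have "upoly i h \<noteq> 0" by simp
  then have ex: "\<exists>k. coeff (upoly i h) k \<noteq> 0" by (meson leading_coeff_0_iff)
  define e where "e = (LEAST k. coeff (upoly i h) k \<noteq> 0)"
  have e: "coeff (upoly i h) e \<noteq> 0" unfolding e_def by (rule LeastI_ex[OF ex])
  have less: "coeff (upoly i h) k = 0" if "k < e" for k
    using not_less_Least[OF that[unfolded e_def]] by simp
  let ?A = "[:var_sum (S - {i}), 1:] ^ v"
  have "coeff (upoly i f) e = coeff (?A * upoly i h) e"
    unfolding h upoly_mult upoly_power upoly_var_sum[OF assms(1,2)] ..
  also have "\<dots> = (\<Sum>k\<le>e. coeff ?A k * coeff (upoly i h) (e - k))" by (rule coeff_mult)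
  also have "\<dots> = (\<Sum>k\<in>{0}. coeff ?A k * coeff (upoly i h) (e - k))"
    by (intro sum.mono_neutral_right) (auto intro!: less)
  also have "\<dots> = var_sum (S - {i}) ^ v * coeff (upoly i h) e"
    by (simp add: coeff_0_power)
  finally have *: "coeff (upoly i f) e = var_sum (S - {i}) ^ v * coeff (upoly i h) e" .
  have "var_sum (S - {i}) \<noteq> 0 \<or> v = 0" using nz by auto
  then have "coeff (upoly i f) e \<noteq> 0" unfolding * using e by auto
  with * show ?thesis by (intro exI[of _ e]) auto
qed

text \<open>
  A coefficient of \<open>T\<close> is a partial sum of coefficients of \<open>(1 - x) T\<close>.
\<close>

lemma const_dvd_one_minus_x_mult:
  fixes T :: "'a::idom poly"
  assumes "[:c:] dvd [:1, -1:] * T"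
  shows "[:c:] dvd T"
  unfolding const_poly_dvd_iff
proof
  fix k
  have "\<forall>j. c dvd coeff ([:1, -1:] * T) j" by (rule const_poly_dvd_iff[THEN iffD1, OF assms])
  then have "c dvd (\<Sum>j<Suc k. coeff ([:1, -1:] * T) j)" by (intro dvd_sum) (rule spec)
  then show "c dvd coeff T k" unfolding sum_coeff_one_minus_x_mult by simp
qed

lemma monom_degree_superset:
  assumes "finite S" "keys m \<subseteq> S"
  shows "monom_degree m = (\<Sum>i\<in>S. lookup m i)"
  unfolding monom_degree_def using assms by (intro sum.mono_neutral_left) (auto simp: in_keys_iff)

lemma monom_degree_add: "monom_degree (m + k) = monom_degree m + monom_degree k"
proof -
  let ?S = "keys m \<union> keys k"
  have "monom_degree (m + k) = (\<Sum>i\<in>?S. lookup (m + k) i)"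
    by (rule monom_degree_superset) (use Poly_Mapping.keys_add[of m k] in auto)
  also have "\<dots> = monom_degree m + monom_degree k"
    by (subst (1 2) monom_degree_superset[of ?S]) (auto simp: lookup_add sum.distrib)
  finally show ?thesis .
qed

lemma monom_degree_single [simp]: "monom_degree (single i e) = e"
  by (auto simp: monom_degree_def)

lemma monom_eq_if_degree_eq:
  assumes "monom_degree m = monom_degree m'" "\<And>j. j \<noteq> k \<Longrightarrow> lookup m j = lookup m' j"
  shows "m = m'"
proof -
  let ?S = "insert k (keys m \<union> keys m')"
  have "monom_degree m = lookup m k + (\<Sum>j\<in>?S - {k}. lookup m j)"
    by (subst monom_degree_superset[of ?S]) (auto simp: sum.remove[of ?S k])
  moreover have "monom_degree m' = lookup m' k + (\<Sum>j\<in>?S - {k}. lookup m' j)"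
    by (subst monom_degree_superset[of ?S]) (auto simp: sum.remove[of ?S k])
  moreover have "(\<Sum>j\<in>?S - {k}. lookup m j) = (\<Sum>j\<in>?S - {k}. lookup m' j)"
    by (intro sum.cong) (auto simp: assms(2))
  ultimately have "lookup m k = lookup m' k" using assms(1) by linarith
  then show ?thesis using assms(2) by (metis poly_mapping_eqI)
qed

text \<open>
  For three variables, the terms of lowest exponent in each of them number at least \<open>v + 1\<close>, and two
  such faces of the homogeneous polynomial share at most one term, which leaves \<open>3 (v + 1) - 3\<close>. For
  more variables, a face has \<open>(card S - 1) v\<close> terms by induction, and the at least \<open>v + 1\<close> different
  exponents of the chosen variable supply \<open>v\<close> terms outside the face. The hypothesis on variables outside \<open>S\<close>
  lets the induction pass to a face.
\<close>

lemma num_terms_ge_mult: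
  assumes "finite S" "3 \<le> card S" "v \<ge> 1" "f \<noteq> 0" "var_sum S ^ v dvd f"
    and hom: "\<And>m m'. m \<in> keys f \<Longrightarrow> m' \<in> keys f \<Longrightarrow> monom_degree m = monom_degree m'"
    and const: "\<And>m m' j. m \<in> keys f \<Longrightarrow> m' \<in> keys f \<Longrightarrow> j \<notin> S \<Longrightarrow> lookup m j = lookup m' j"
  shows "card S * v \<le> num_terms f"
  using assms(1,2,4-)
proof (induction "card S" arbitrary: S f rule: less_induct)
  case less
  define L where "L i e = {m \<in> keys f. lookup m i = e}" for i e
  have fL: "finite (L i e)" for i e by (simp add: L_def)
  have low: "\<exists>e. coeff (upoly i f) e \<noteq> 0 \<and> var_sum (S - {i}) ^ v dvd coeff (upoly i f) e"
    if "i \<in> S" for i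
    using less.prems(1-4) that by (intro ex_power_dvd_coeff_upoly) auto
  show ?case
  proof (cases "card S = 3")
    case True
    then obtain i j k where S: "S = {i, j, k}" "i \<noteq> j" "j \<noteq> k" "i \<noteq> k" by (auto simp: card_3_iff)
    have L2: "\<exists>e. v + 1 \<le> card (L i e)" if "i \<in> S" for i
    proof -
      obtain e where e: "coeff (upoly i f) e \<noteq> 0" "var_sum (S - {i}) ^ v dvd coeff (upoly i f) e"
        using low[OF \<open>i \<in> S\<close>] by blast
      have "card (S - {i}) = 2" using True \<open>i \<in> S\<close> less.prems(1) by simp
      then have "v + 1 \<le> num_terms (coeff (upoly i f) e)"
        using less.prems(1) e by (intro num_terms_ge[of "S - {i}"]) auto
      then show ?thesis unfolding num_terms_coeff_upoly L_def by blast
    qed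
    obtain a b c where abc: "v + 1 \<le> card (L i a)" "v + 1 \<le> card (L j b)" "v + 1 \<le> card (L k c)"
      using L2 S(1) by (metis insertI1 insert_commute)
    have int: "card (L i a \<inter> L j b) \<le> 1" if "S = {i, j, k}" for i j k a b
    proof -
      have "m = m'" if "m \<in> L i a \<inter> L j b" "m' \<in> L i a \<inter> L j b" for m m'
      proof (rule monom_eq_if_degree_eq[where k = k])
        show "monom_degree m = monom_degree m'" using that less.prems(5) by (auto simp: L_def)
        fix l assume "l \<noteq> k"
        then have "l = i \<or> l = j \<or> l \<notin> S" using \<open>S = {i, j, k}\<close> by blast
        then show "lookup m l = lookup m' l"
          using that less.prems(6)[of m m' l] by (auto simp: L_def)
      qed
      then show ?thesis using fL by (metis One_nat_def card_le_Suc0_iff_eq finite_Int)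
    qed
    have i1: "card (L i a \<inter> L j b) \<le> 1" by (rule int[of i j k]) (use S in auto)
    have i2: "card (L i a \<inter> L k c) \<le> 1" by (rule int[of i k j]) (use S in auto)
    have i3: "card (L j b \<inter> L k c) \<le> 1" by (rule int[of j k i]) (use S in auto)
    have "card ((L i a \<union> L j b) \<inter> L k c) \<le> card (L i a \<inter> L k c) + card (L j b \<inter> L k c)"
      unfolding Int_Un_distrib2 by (rule card_Un_le)
    moreover have "card (L i a) + card (L j b) = card (L i a \<union> L j b) + card (L i a \<inter> L j b)"
      by (rule card_Un_Int) (simp_all add: fL)
    moreover have "card (L i a \<union> L j b) + card (L k c)
        = card (L i a \<union> L j b \<union> L k c) + card ((L i a \<union> L j b) \<inter> L k c)"
      by (rule card_Un_Int) (simp_all add: fL)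
    moreover have "card (L i a \<union> L j b \<union> L k c) \<le> num_terms f"
      unfolding num_terms_def by (rule card_mono) (auto simp: L_def)
    ultimately have "3 * v \<le> num_terms f" using i1 i2 i3 abc by linarith
    then show ?thesis using True by simp
  next
    case False
    then have c4: "card S \<ge> 4" using less.prems(2) by simp
    obtain i where i: "i \<in> S" using c4 by fastforce
    obtain e where e: "coeff (upoly i f) e \<noteq> 0" "var_sum (S - {i}) ^ v dvd coeff (upoly i f) e"
      using low[OF i] by blast
    define g where "g = coeff (upoly i f) e"
    have kg: "lookup m i = 0 \<and> m + single i e \<in> keys f" if "m \<in> keys g" for m
      using that by (auto simp: g_def in_keys_iff lookup_coeff_upoly split: if_splits)
    have cS: "card (S - {i}) = card S - 1" using i less.prems(1) by simp
    have "card (S - {i}) * v \<le> num_terms g"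
    proof (rule less.hyps)
      show "card (S - {i}) < card S" "3 \<le> card (S - {i})" "finite (S - {i})"
        using cS c4 less.prems(1) by auto
      show "g \<noteq> 0" "var_sum (S - {i}) ^ v dvd g" using e by (auto simp: g_def)
      fix m m' assume m: "m \<in> keys g" "m' \<in> keys g"
      show "monom_degree m = monom_degree m'"
        using less.prems(5)[of "m + single i e" "m' + single i e"] kg m
        by (simp add: monom_degree_add)
      fix j assume "j \<notin> S - {i}"
      then show "lookup m j = lookup m' j"
        using less.prems(6)[of "m + single i e" "m' + single i e" j] kg m
        by (cases "j = i") (auto simp: lookup_add)
    qed
    then have 1: "card (S - {i}) * v \<le> card (L i e)" unfolding g_def num_terms_coeff_upoly L_def .
    let ?E = "(\<lambda>m. lookup m i) ` keys f"
    have "S \<noteq> {i}" using c4 by auto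
    then have "v + 1 \<le> card ?E" using less.prems i by (intro card_exponents_ge) auto
    then have "v \<le> card ?E - card {e}" by simp
    also have "\<dots> \<le> card (?E - {e})" by (rule diff_card_le_card_Diff) simp
    also have "?E - {e} = (\<lambda>m. lookup m i) ` (keys f - L i e)" by (auto simp: L_def)
    also have "card \<dots> \<le> card (keys f - L i e)" by (rule card_image_le) simp
    finally have 2: "v \<le> card (keys f - L i e)" .
    have "num_terms f = card (L i e) + card (keys f - L i e)"
      unfolding num_terms_def using card_Un_disjoint[of "L i e" "keys f - L i e"] fL
      by (simp add: L_def Un_absorb1 Collect_restrict)
    moreover have "card S * v = card (S - {i}) * v + v"
      using cS c4 by (cases "card S") auto
    ultimately show ?thesis using 1 2 by linarith
  qed
qed

section \<open>Expansions of the identity on the hyperplane\<close>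

lemma map_poly_additive_coeff:
  fixes l :: "'a::ab_group_add \<Rightarrow> 'b::ab_group_add"
  assumes "\<And>x y. l (x + y) = l x + l y"
  shows "coeff (map_poly l P) k = l (coeff P k)"
proof -
  have "l 0 = 0" using assms[of 0 0] by simp
  then show ?thesis by (rule coeff_map_poly)
qed

lemma map_poly_additive_sum:
  fixes l :: "'a::ab_group_add \<Rightarrow> 'b::ab_group_add"
  assumes "\<And>x y. l (x + y) = l x + l y"
  shows "map_poly l (\<Sum>i\<in>I. P i) = (\<Sum>i\<in>I. map_poly l (P i))"
proof -
  have add: "map_poly l (P + Q) = map_poly l P + map_poly l Q" for P Q
    by (rule poly_eqI) (simp add: map_poly_additive_coeff[of l, OF assms] assms)
  show ?thesis by (induction I rule: infinite_finite_induct) (auto simp: add)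
qed

lemma map_poly_additive_one_minus_x_power_mult:
  fixes l :: "'a::comm_ring_1 \<Rightarrow> 'b::comm_ring_1"
  assumes "\<And>x y. l (x + y) = l x + l y"
  shows "map_poly l ([:1, -1:] ^ j * P) = [:1, -1:] ^ j * map_poly l P"
proof (induction j)
  case (Suc j)
  have z: "l 0 = 0" using assms[of 0 0] by simp
  have diff: "l (x - y) = l x - l y" for x y using assms[of "x - y" y] by (simp add: algebra_simps)
  have step: "map_poly l ([:1, -1:] * Q) = [:1, -1:] * map_poly l Q" for Q
  proof (rule poly_eqI)
    fix n
    show "coeff (map_poly l ([:1, -1:] * Q)) n = coeff ([:1, -1:] * map_poly l Q) n"
      unfolding map_poly_additive_coeff[of l, OF assms] coeff_one_minus_x_mult by (simp add: diff z)
  qed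
  show ?case unfolding power_Suc mult.assoc step Suc.IH ..
qed simp

text \<open>
  A node \<open>(k, u)\<close> stands for the nonzero part \<open>x\<^sup>k a\<^sub>k\<^sub>u\<close> of the polynomial, homogeneous of degree \<open>u\<close> in the
  variables in \<open>V\<close>.
\<close>

locale node_system =
  fixes N :: "(nat \<times> nat) set" and a :: "nat \<times> nat \<Rightarrow> rpoly" and V :: "nat set" and D :: nat
  assumes finite_N: "finite N" and finite_V: "finite V" and V_nonempty: "V \<noteq> {}"
    and a_nonzero: "t \<in> N \<Longrightarrow> a t \<noteq> 0"
    and a_nonneg: "lookup (a t) m \<ge> 0"
    and a_degree: "m \<in> keys (a t) \<Longrightarrow> monom_degree m = snd t"
    and a_vars: "m \<in> keys (a t) \<Longrightarrow> keys m \<subseteq> V"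
    and N_le: "t \<in> N \<Longrightarrow> fst t + snd t \<le> D"
    and N_top: "\<exists>t\<in>N. fst t + snd t = D"
    and identity: "(\<Sum>t\<in>N. [:1, -1:] ^ snd t * monom (var_sum V ^ (D - snd t) * a t) (fst t)) = [:var_sum V ^ D:]"
begin

text \<open>
  The contribution of a set of nodes to the identity, with \<open>r\<close> factors \<open>1 - x\<close> removed from every
  term. This is only meaningful if all nodes lie in row \<open>r\<close> or higher, that is if their second
  components are at least \<open>r\<close>.
\<close>

definition hpoly :: "nat \<Rightarrow> (nat \<times> nat) set \<Rightarrow> rpoly poly" where
  "hpoly r F = (\<Sum>t\<in>F. [:1, -1:] ^ (snd t - r) * monom (var_sum V ^ (D - snd t) * a t) (fst t))"

definition shade :: "nat \<Rightarrow> (nat \<times> nat) set \<Rightarrow> nat set" where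
  "shade r F = shadow fst fst (\<lambda>t. snd t - r) F"

lemma hpoly_Un: "finite F \<Longrightarrow> finite G \<Longrightarrow> F \<inter> G = {} \<Longrightarrow> hpoly r (F \<union> G) = hpoly r F + hpoly r G"
  unfolding hpoly_def by (rule sum.union_disjoint)

lemma shade_Un: "shade r (F \<union> G) = shade r F \<union> shade r G"
  unfolding shade_def by (rule shadow_Un)

lemma finite_shade [simp]: "finite F \<Longrightarrow> finite (shade r F)"
  by (simp add: shade_def)

lemma shade_empty_iff [simp]: "shade r F = {} \<longleftrightarrow> F = {}"
  by (auto simp: shade_def shadow_def)

lemma hpoly_age_diff:
  assumes "s \<le> r" "\<forall>t\<in>F. snd t \<ge> r"
  shows "hpoly s F = [:1, -1:] ^ (r - s) * hpoly r F"
  unfolding hpoly_def sum_distrib_left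
proof (intro sum.cong refl)
  fix t assume "t \<in> F"
  then have "snd t - s = (r - s) + (snd t - r)" using assms by (simp add: le_diff_conv2)
  then show "[:1, -1:] ^ (snd t - s) * monom (var_sum V ^ (D - snd t) * a t) (fst t) =
      [:1, -1:] ^ (r - s) * ([:1, -1:] ^ (snd t - r) * monom (var_sum V ^ (D - snd t) * a t) (fst t))"
    by (simp only: power_add mult.assoc)
qed

text \<open>
  Divisibility by an element free of \<open>x\<close> is insensitive to factors \<open>1 - x\<close>.
\<close>

lemma dvd_hpoly_age:
  assumes "s \<le> r" "\<forall>t\<in>F. snd t \<ge> r"
  shows "[:c:] dvd hpoly s F \<longleftrightarrow> [:c:] dvd hpoly r F"
proof -
  have *: "[:c:] dvd [:1, -1:] ^ j * T \<Longrightarrow> [:c:] dvd T" for j and T :: "rpoly poly"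
  proof (induction j)
    case (Suc j)
    then show ?case using const_dvd_one_minus_x_mult[of c "[:1, -1:] ^ j * T"]
      by (simp only: power_Suc mult.assoc)
  qed simp
  show ?thesis unfolding hpoly_age_diff[OF assms] by (rule iffI[OF * dvd_mult])
qed

lemma coeff_hpoly:
  assumes "coeff (hpoly r F) k \<noteq> 0"
  shows "k \<in> shade r F"
proof -
  have "(\<Sum>t\<in>F. coeff ([:1, -1:] ^ (snd t - r) * monom (var_sum V ^ (D - snd t) * a t) (fst t)) k) \<noteq> 0"
    using assms by (simp add: hpoly_def coeff_sum)
  then obtain t where t: "t \<in> F" "coeff ([:1, -1:] ^ (snd t - r) * monom (var_sum V ^ (D - snd t) * a t) (fst t)) k \<noteq> 0"
    by (meson sum.neutral)
  have "fst t \<le> k \<and> k \<le> fst t + (snd t - r)"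
    by (rule coeff_aged[OF _ t(2)]) (auto split: if_splits)
  then show ?thesis using t(1) by (auto simp: shade_def shadow_def)
qed

lemma map_poly_eval_hpoly:
  "map_poly (\<lambda>f. poly_eval f y) (hpoly r F)
    = aged_sum (\<lambda>t. monom ((\<Sum>i\<in>V. y i) ^ (D - snd t) * poly_eval (a t) y) (fst t)) (\<lambda>t. snd t - r) F"
  unfolding hpoly_def aged_sum_def
  by (simp only: map_poly_additive_sum poly_eval_add map_poly_additive_one_minus_x_power_mult
      map_poly_monom poly_eval_zero poly_eval_mult poly_eval_power poly_eval_var_sum)

lemma poly_eval_a_pos: "t \<in> N \<Longrightarrow> (\<And>i. y i > 0) \<Longrightarrow> poly_eval (a t) y > 0"
  by (intro poly_eval_pos a_nonzero a_nonneg) auto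

lemma sum_V_pos: "(\<And>i. y i > 0) \<Longrightarrow> (\<Sum>i\<in>V. y i :: real) > 0"
  using finite_V V_nonempty by (intro sum_pos) auto

lemma eval_hpoly_nonzero:
  assumes "F \<subseteq> N" "F \<noteq> {}" "\<And>i. y i > 0"
  shows "map_poly (\<lambda>f. poly_eval f y) (hpoly r F) \<noteq> 0"
proof -
  have "poly (map_poly (\<lambda>f. poly_eval f y) (hpoly r F)) (1/2) =
      (\<Sum>t\<in>F. (1/2) ^ (snd t - r) * ((\<Sum>i\<in>V. y i) ^ (D - snd t) * poly_eval (a t) y * (1/2) ^ fst t))"
    unfolding map_poly_eval_hpoly aged_sum_def by (simp add: poly_sum poly_monom)
  also have "\<dots> > 0"
  proof (rule sum_pos)
    show "finite F" using assms(1) finite_N by (rule finite_subset)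
    fix t assume "t \<in> F"
    then have "poly_eval (a t) y > 0" using assms by (intro poly_eval_a_pos) auto
    moreover have "(\<Sum>i\<in>V. y i) > 0" by (rule sum_V_pos[of y]) (rule assms(3))
    ultimately show "(1/2) ^ (snd t - r) * ((\<Sum>i\<in>V. y i) ^ (D - snd t) * poly_eval (a t) y * (1/2) ^ fst t) > 0"
      by simp
  qed (rule assms(2))
  finally show ?thesis by auto
qed

lemma hpoly_nonzero:
  assumes "F \<subseteq> N" "F \<noteq> {}"
  shows "hpoly r F \<noteq> 0"
  using eval_hpoly_nonzero[OF assms, of "\<lambda>_. 1" r] by auto

lemma hpoly_total: "hpoly 0 N = [:var_sum V ^ D:]"
  unfolding hpoly_def using identity by simp

text \<open>
  The nodes below row \<open>r\<close> carry the factor \<open>\<Pi>\<^bsup>D+1-r\<^esup>\<close> explicitly, and so does the total.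
\<close>

lemma dvd_hpoly_upper:
  assumes "r \<ge> 1"
  shows "[:var_sum V ^ (D + 1 - r):] dvd hpoly r {t\<in>N. snd t \<ge> r}"
proof -
  let ?c = "var_sum V ^ (D + 1 - r)"
  have "N = {t\<in>N. snd t < r} \<union> {t\<in>N. snd t \<ge> r}" "{t\<in>N. snd t < r} \<inter> {t\<in>N. snd t \<ge> r} = {}" by auto
  then have "hpoly 0 N = hpoly 0 {t\<in>N. snd t < r} + hpoly 0 {t\<in>N. snd t \<ge> r}"
    using hpoly_Un[of "{t\<in>N. snd t < r}" "{t\<in>N. snd t \<ge> r}" 0] finite_N by auto
  then have "hpoly 0 {t\<in>N. snd t \<ge> r} = [:var_sum V ^ D:] - hpoly 0 {t\<in>N. snd t < r}"
    unfolding hpoly_total by (simp add: algebra_simps)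
  moreover have "[:?c:] dvd [:var_sum V ^ D:]"
    using assms by (auto intro!: le_imp_power_dvd)
  moreover have "[:?c:] dvd hpoly 0 {t\<in>N. snd t < r}"
    unfolding hpoly_def
  proof (intro dvd_sum dvd_mult)
    fix t assume "t \<in> {t\<in>N. snd t < r}"
    then have "?c dvd var_sum V ^ (D - snd t)" by (intro le_imp_power_dvd) auto
    then show "[:?c:] dvd monom (var_sum V ^ (D - snd t) * a t) (fst t)"
      unfolding const_poly_dvd_iff by auto
  qed
  ultimately have "[:?c:] dvd hpoly 0 {t\<in>N. snd t \<ge> r}" by (simp only: dvd_diff)
  moreover have all: "\<forall>t\<in>{t\<in>N. snd t \<ge> r}. snd t \<ge> r" by simp
  ultimately show ?thesis by (simp only: dvd_hpoly_age[OF le0 all])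
qed

definition upper :: "(nat \<times> nat) set" where
  "upper = {t\<in>N. snd t \<ge> 1}"

lemma upper_subset: "upper \<subseteq> N" and finite_upper: "finite upper"
  using finite_N by (auto simp: upper_def)

text \<open>
  At an uncovered column \<open>g\<close>, the nodes beginning right of \<open>g\<close> and the others occupy disjoint sets of
  columns. The right part then vanishes, since the total has no column but \<open>0\<close>; by positivity
  there are no such nodes, and no node reaches degree \<open>D\<close>.
\<close>

lemma shade_upper:
  assumes "D \<ge> 1"
  shows "shade 1 upper = {0..D - 1}"
proof
  show "shade 1 upper \<subseteq> {0..D - 1}"
    using N_le by (fastforce simp: shade_def shadow_def upper_def)
  show "{0..D - 1} \<subseteq> shade 1 upper"
  proof (rule ccontr)
    assume "\<not> ?thesis"
    then obtain g where "g \<in> {0..D - 1}" and "g \<notin> shade 1 upper" by blast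
    then have g: "g \<le> D - 1" "g \<notin> shade 1 upper" by simp_all
    define R where "R = {t\<in>N. fst t > g}"
    define L where "L = {t\<in>N. fst t \<le> g}"
    have NRL: "N = L \<union> R" "L \<inter> R = {}" "finite L" "finite R" using finite_N by (auto simp: R_def L_def)
    have L: "fst t + snd t \<le> g" if t: "t \<in> L" for t
    proof (cases "snd t = 0")
      case True then show ?thesis using t by (simp add: L_def)
    next
      case False
      then have "t \<in> upper" using t by (auto simp: L_def upper_def)
      then have "\<not> (fst t \<le> g \<and> g \<le> fst t + (snd t - 1))" using g(2) by (auto simp: shade_def shadow_def)
      then show ?thesis using t False by (auto simp: L_def)
    qed
    have sum: "hpoly 0 L + hpoly 0 R = [:var_sum V ^ D:]"
      using hpoly_Un[OF NRL(3,4,2), of 0] hpoly_total unfolding NRL(1)[symmetric] by simp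
    have "hpoly 0 R = 0"
    proof (rule poly_eqI)
      fix k
      show "coeff (hpoly 0 R) k = coeff 0 k"
      proof (cases "k \<le> g")
        case True
        then have "k \<notin> shade 0 R" by (auto simp: shade_def shadow_def R_def)
        then show ?thesis using coeff_hpoly by auto
      next
        case False
        then have "k \<notin> shade 0 L" using L by (fastforce simp: shade_def shadow_def)
        then have "coeff (hpoly 0 L) k = 0" using coeff_hpoly by blast
        moreover have "coeff (hpoly 0 L) k + coeff (hpoly 0 R) k = 0"
          using arg_cong[OF sum, of "\<lambda>P. coeff P k"] False by (cases k) auto
        ultimately show ?thesis by simp
      qed
    qed
    then have "R = {}" using hpoly_nonzero[of R 0] NRL(1) by blast
    moreover obtain t where "t \<in> N" "fst t + snd t = D" using N_top by blast
    ultimately show False using L[of t] g(1) assms NRL(1) by auto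
  qed
qed

text \<open>
  At \<open>x = 1\<close> all other rows vanish.
\<close>

lemma ex_row_zero:
  assumes "D \<ge> 1"
  shows "\<exists>t\<in>N. snd t = 0"
proof (rule ccontr)
  assume "\<not> ?thesis"
  then have "poly (hpoly 0 N) 1 = 0"
    unfolding hpoly_def by (auto simp: poly_sum power_0_left intro!: sum.neutral)
  then have "var_sum V ^ D = 0" unfolding hpoly_total by simp
  moreover have "var_sum V \<noteq> 0" using finite_V V_nonempty by (rule var_sum_nonzero)
  ultimately show False by simp
qed

lemma num_terms_a_pos: "t \<in> N \<Longrightarrow> num_terms (a t) \<ge> 1"
  using a_nonzero unfolding num_terms_def by (simp add: Suc_le_eq card_gt_0_iff)

lemma sum_num_terms_upper:
  assumes "D \<ge> 1"
  shows "(\<Sum>t\<in>upper. num_terms (a t)) + 1 \<le> (\<Sum>t\<in>N. num_terms (a t))"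
proof -
  obtain t where t: "t \<in> N" "snd t = 0" using ex_row_zero[OF assms] by blast
  have "(\<Sum>t\<in>N. num_terms (a t)) = (\<Sum>t\<in>upper. num_terms (a t)) + (\<Sum>t\<in>N - upper. num_terms (a t))"
    using sum.subset_diff[OF upper_subset finite_N] by (simp add: add.commute)
  moreover have "num_terms (a t) \<le> (\<Sum>t\<in>N - upper. num_terms (a t))"
    using t finite_N by (intro member_le_sum) (auto simp: upper_def)
  ultimately show ?thesis using num_terms_a_pos[OF t(1)] by linarith
qed

end

section \<open>One variable besides the distinguished one\<close>

context node_system
begin

definition weight :: "nat \<times> nat \<Rightarrow> real" where
  "weight t = real (card V) ^ (D - snd t) * poly_eval (a t) (\<lambda>_. 1)"

lemma weight_pos: "t \<in> N \<Longrightarrow> weight t > 0"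
  unfolding weight_def using poly_eval_a_pos[of t "\<lambda>_. 1"] sum_V_pos[of "\<lambda>_. 1"] by simp

lemma map_poly_eval_one_hpoly:
  "map_poly (\<lambda>f. poly_eval f (\<lambda>_. 1)) (hpoly r F) = aged_sum (\<lambda>t. monom (weight t) (fst t)) (\<lambda>t. snd t - r) F"
  unfolding map_poly_eval_hpoly weight_def by simp

text \<open>
  Up to the constant total, these nodes give the negative of what the row \<open>u = 0\<close> gives.
\<close>

lemma alternates_upper:
  assumes "alternates (coeff (map_poly (\<lambda>f. poly_eval f (\<lambda>_. 1)) (hpoly 0 upper))) L"
  shows "L \<le> 2"
proof (rule alternates_le_2[OF assms])
  fix k :: nat assume k: "k \<ge> 1"
  let ?ev = "map_poly (\<lambda>f. poly_eval f (\<lambda>_. 1))"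
  have "hpoly 0 upper + hpoly 0 (N - upper) = [:var_sum V ^ D:]"
    using hpoly_Un[of upper "N - upper" 0] finite_N finite_upper upper_subset hpoly_total
    by (simp add: Un_absorb1)
  then have "coeff (hpoly 0 upper) k + coeff (hpoly 0 (N - upper)) k = 0"
    using k by (subst coeff_add[symmetric]) (cases k, auto)
  then have "poly_eval (coeff (hpoly 0 upper) k) (\<lambda>_. 1) = - poly_eval (coeff (hpoly 0 (N - upper)) k) (\<lambda>_. 1)"
    by (metis add_eq_0_iff2 poly_eval_add poly_eval_zero)
  then have "coeff (?ev (hpoly 0 upper)) k = - coeff (?ev (hpoly 0 (N - upper))) k"
    by (simp only: map_poly_additive_coeff poly_eval_add)
  also have "coeff (?ev (hpoly 0 (N - upper))) k = (\<Sum>t\<in>N - upper. if fst t = k then weight t else 0)"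
    unfolding map_poly_eval_one_hpoly aged_sum_def coeff_sum
    by (intro sum.cong refl) (auto simp: upper_def not_less_eq_eq)
  finally have eq: "coeff (?ev (hpoly 0 upper)) k = - (\<Sum>t\<in>N - upper. if fst t = k then weight t else 0)" .
  have "(\<Sum>t\<in>N - upper. if fst t = k then weight t else 0) \<ge> 0"
  proof (rule sum_nonneg)
    fix t assume "t \<in> N - upper"
    then have "weight t > 0" by (intro weight_pos) simp
    then show "(if fst t = k then weight t else 0) \<ge> 0" by simp
  qed
  with eq show "coeff (?ev (hpoly 0 upper)) k \<le> 0" by linarith
qed

theorem two_variable_bound:
  "D \<ge> 1 \<Longrightarrow> D + 3 \<le> 2 * (\<Sum>t\<in>N. num_terms (a t))"
proof -
  assume D: "D \<ge> 1"
  let ?U = "shadow fst fst snd upper"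
  have sh: "shadow fst fst (\<lambda>t. snd t - 1) upper = {0..D - 1}"
    using shade_upper[OF D] unfolding shade_def .
  have "upper \<noteq> {}" using sh by (auto simp: shadow_def)
  have cU: "card ?U = D + 1"
  proof -
    have "card ?U = card (shadow fst fst (\<lambda>t. snd t - 1) upper) + 1"
      by (rule card_shadow_age[OF _ _ sh]) (auto simp: upper_def)
    then show ?thesis unfolding sh using D by simp
  qed
  have "alternates_ge (coeff (aged_sum (\<lambda>t. monom (weight t) (fst t)) snd upper))
           (int (card ?U) - 2 * int (card upper) + 2)"
  proof (rule positive_family_alternates[OF finite_upper \<open>upper \<noteq> {}\<close>])
    fix t assume "t \<in> upper"
    then show "weight t > 0" using upper_subset by (intro weight_pos) auto
  qed
  then obtain L where "int L \<ge> int (card ?U) - 2 * int (card upper) + 2"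
      "alternates (coeff (aged_sum (\<lambda>t. monom (weight t) (fst t)) snd upper)) L"
    unfolding alternates_ge_def by blast
  moreover from this(2) have "L \<le> 2"
    using alternates_upper[of L] unfolding map_poly_eval_one_hpoly by simp
  ultimately have "D + 1 \<le> 2 * card upper" using cU by linarith
  moreover have "card upper \<le> (\<Sum>t\<in>upper. num_terms (a t))"
    using sum_mono[of upper "\<lambda>_. 1" "\<lambda>t. num_terms (a t)"] num_terms_a_pos upper_subset by auto
  ultimately show ?thesis using sum_num_terms_upper[OF D] by linarith
qed

end

section \<open>Three or more variables besides the distinguished one\<close>

lemma num_terms_sum_le: "finite F \<Longrightarrow> num_terms (\<Sum>t\<in>F. f t) \<le> (\<Sum>t\<in>F. num_terms (f t))"
  unfolding num_terms_def
  by (rule order.trans[OF card_mono[OF _ Poly_Mapping.keys_sum] card_UN_le]) auto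

context node_system
begin

text \<open>
  Node sets with disjoint shades occupy different columns, so nothing can cancel between them.
\<close>

lemma dvd_hpoly_split:
  assumes "finite F" "finite G" "F \<inter> G = {}" "shade r F \<inter> shade r G = {}"
    and "[:c:] dvd hpoly r (F \<union> G)"
  shows "[:c:] dvd hpoly r F" "[:c:] dvd hpoly r G"
proof -
  have sum: "coeff (hpoly r (F \<union> G)) k = coeff (hpoly r F) k + coeff (hpoly r G) k" for k
    unfolding hpoly_Un[OF assms(1-3)] by simp
  have all: "c dvd coeff (hpoly r (F \<union> G)) k" for k
    using assms(5) unfolding const_poly_dvd_iff by blast
  have "c dvd coeff (hpoly r F) k \<and> c dvd coeff (hpoly r G) k" for k
  proof (cases "coeff (hpoly r F) k = 0")
    case True
    then show ?thesis using sum[of k] all[of k] by simp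
  next
    case False
    then have "k \<notin> shade r G" using coeff_hpoly assms(4) by blast
    then have "coeff (hpoly r G) k = 0" using coeff_hpoly by blast
    then show ?thesis using sum[of k] all[of k] by simp
  qed
  then show "[:c:] dvd hpoly r F" "[:c:] dvd hpoly r G"
    unfolding const_poly_dvd_iff by blast+
qed

lemma var_sum_V_nonzero: "var_sum V \<noteq> 0"
  using finite_V V_nonempty by (rule var_sum_nonzero)

lemma sum_a_nonzero:
  assumes "F \<subseteq> N" "F \<noteq> {}"
  shows "(\<Sum>t\<in>F. a t) \<noteq> 0"
proof
  assume 0: "(\<Sum>t\<in>F. a t) = 0"
  have "(\<Sum>t\<in>F. poly_eval (a t) (\<lambda>_. 1)) > 0"
  proof (rule sum_pos)
    fix t assume "t \<in> F"
    then show "poly_eval (a t) (\<lambda>_. 1) > 0" using assms(1) by (intro poly_eval_a_pos) auto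
  qed (use assms finite_N finite_subset in auto)
  then show False using 0 by (simp add: poly_eval_sum[symmetric])
qed

text \<open>
  The parts in one row have the same degree and nonnegative coefficients, so their sum is homogeneous and
  nonzero.
\<close>

lemma num_terms_row_ge_mult:
  assumes "F \<subseteq> N" "F \<noteq> {}" "\<forall>t\<in>F. snd t = r" "3 \<le> card V" "v \<ge> 1" "var_sum V ^ v dvd (\<Sum>t\<in>F. a t)"
  shows "card V * v \<le> (\<Sum>t\<in>F. num_terms (a t))"
proof -
  have fin: "finite F" using assms(1) finite_N by (rule finite_subset)
  have k: "monom_degree m = r \<and> keys m \<subseteq> V" if m: "m \<in> keys (\<Sum>t\<in>F. a t)" for m
  proof -
    obtain t where t: "t \<in> F" "m \<in> keys (a t)" using m Poly_Mapping.keys_sum[of a F] by blast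
    then show ?thesis using a_degree a_vars assms(3) by metis
  qed
  have "card V * v \<le> num_terms (\<Sum>t\<in>F. a t)"
  proof (rule num_terms_ge_mult[OF finite_V assms(4,5) sum_a_nonzero[OF assms(1,2)] assms(6)])
    fix m m' assume m: "m \<in> keys (\<Sum>t\<in>F. a t)" "m' \<in> keys (\<Sum>t\<in>F. a t)"
    show "monom_degree m = monom_degree m'" using k m by simp
    fix j assume "j \<notin> V"
    then show "lookup m j = lookup m' j" using k[OF m(1)] k[OF m(2)] by (metis in_keys_iff subsetD)
  qed
  also have "\<dots> \<le> (\<Sum>t\<in>F. num_terms (a t))" by (rule num_terms_sum_le[OF fin])
  finally show ?thesis .
qed

lemma poly_hpoly_one:
  assumes "finite F"
  shows "poly (hpoly r F) 1 = (\<Sum>t\<in>{t\<in>F. snd t \<le> r}. var_sum V ^ (D - snd t) * a t)"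
proof -
  have "poly (hpoly r F) 1 = (\<Sum>t\<in>F. if snd t \<le> r then var_sum V ^ (D - snd t) * a t else 0)"
    unfolding hpoly_def poly_sum by (intro sum.cong refl) (auto simp: poly_monom power_0_left)
  also have "\<dots> = (\<Sum>t\<in>{t\<in>F. snd t \<le> r}. var_sum V ^ (D - snd t) * a t)"
    using assms by (simp add: sum.inter_filter)
  finally show ?thesis .
qed

lemma dvd_poly_one: "[:c:] dvd P \<Longrightarrow> c dvd poly P (1::rpoly)"
  by (elim dvdE) simp

lemma dvd_power_cancel:
  assumes "var_sum V ^ (e + v) dvd var_sum V ^ e * b"
  shows "var_sum V ^ v dvd b"
  using assms var_sum_V_nonzero by (simp add: power_add dvd_times_left_cancel_iff)

lemma dvd_row_part:
  assumes "finite F" "\<forall>t\<in>F. snd t \<le> r"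
  shows "[:var_sum V ^ (D - r):] dvd hpoly r F"
  unfolding hpoly_def
proof (intro dvd_sum dvd_mult)
  fix t assume "t \<in> F"
  then have "var_sum V ^ (D - r) dvd var_sum V ^ (D - snd t)"
    using assms(2) by (intro le_imp_power_dvd) auto
  then show "[:var_sum V ^ (D - r):] dvd monom (var_sum V ^ (D - snd t) * a t) (fst t)"
    unfolding const_poly_dvd_iff by auto
qed

text \<open>
  Induction on the total number of rows that the nodes rise above row \<open>r\<close>. A set that falls apart into two with disjoint
  shades is treated part by part. Otherwise the nodes above row \<open>r\<close> have a shade that grew by
  one column in this row and covers the row nodes. If there are no row nodes, a
  factor \<open>1 - x\<close> can be removed and the excess power \<open>v\<close> rises by one, which pays for the column.
  If there are, then at \<open>x = 1\<close> only they remain, and their sum, being divisible by \<open>\<Pi>\<^sup>v\<close>, pays \<open>v\<close>-fold;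
  the nodes above are then still divisible with excess one.
\<close>

lemma sum_num_terms_ge_shade:
  assumes "3 \<le> card V"
    and "F \<subseteq> N" "F \<noteq> {}" "\<forall>t\<in>F. snd t \<ge> r" "v \<ge> 1"
    and "[:var_sum V ^ (D - r + v):] dvd hpoly r F"
  shows "card V * (card (shade r F) + v) \<le> (\<Sum>t\<in>F. num_terms (a t)) + card V"
  using assms(2-)
proof (induction "\<Sum>t\<in>F. snd t - r + 1" arbitrary: F r v rule: less_induct)
  case less
  note FN = less.prems(1) and ne = less.prems(2) and Fr = less.prems(3) and v = less.prems(4) and dvd = less.prems(5)
  have fin: "finite F" using FN finite_N by (rule finite_subset)
  let ?m = "card V"
  define Z where "Z F = (\<Sum>t\<in>F. num_terms (a t))" for F
  have Z_Un: "Z (A \<union> B) = Z A + Z B" if "finite A" "finite B" "A \<inter> B = {}" for A B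
    unfolding Z_def using that by (rule sum.union_disjoint)
  define F0 where "F0 = {t\<in>F. snd t = r}"
  define F1 where "F1 = {t\<in>F. snd t > r}"
  have F01: "F = F0 \<union> F1" "F0 \<inter> F1 = {}" "finite F0" "finite F1"
    using fin Fr by (auto simp: F0_def F1_def)
  have split: ?case if AB: "F = A \<union> B" "A \<inter> B = {}" "A \<noteq> {}" "B \<noteq> {}" "shade r A \<inter> shade r B = {}" for A B
  proof -
    have finAB: "finite A" "finite B" using fin AB(1) by auto
    have dvdAB: "[:var_sum V ^ (D - r + v):] dvd hpoly r A" "[:var_sum V ^ (D - r + v):] dvd hpoly r B"
      using dvd_hpoly_split[OF finAB AB(2,5)] dvd AB(1) by auto
    have sum: "(\<Sum>t\<in>F. snd t - r + 1) = (\<Sum>t\<in>A. snd t - r + 1) + (\<Sum>t\<in>B. snd t - r + 1)"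
      unfolding AB(1) by (rule sum.union_disjoint[OF finAB AB(2)])
    have pos: "(\<Sum>t\<in>A. snd t - r + 1) > 0" "(\<Sum>t\<in>B. snd t - r + 1) > 0"
      using finAB AB(3,4) by (auto intro!: sum_pos)
    have "?m * (card (shade r A) + v) \<le> Z A + ?m"
      unfolding Z_def using FN Fr AB(1,3) v dvdAB sum pos by (intro less.hyps) auto
    moreover have "?m * (card (shade r B) + v) \<le> Z B + ?m"
      unfolding Z_def using FN Fr AB(1,4) v dvdAB sum pos by (intro less.hyps) auto
    moreover have cF: "card (shade r F) = card (shade r A) + card (shade r B)"
      unfolding AB(1) shade_Un using finAB AB(5) by (intro card_Un_disjoint) auto
    moreover have "Z F = Z A + Z B" unfolding AB(1) by (rule Z_Un[OF finAB AB(2)])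
    moreover have "?m * (card (shade r A) + card (shade r B) + v) + ?m * v
        = ?m * (card (shade r A) + v) + ?m * (card (shade r B) + v)" by (simp add: algebra_simps)
    moreover have "?m \<le> ?m * v" using v by simp
    ultimately have "?m * (card (shade r F) + v) \<le> Z F + ?m" unfolding cF by linarith
    then show ?thesis unfolding Z_def .
  qed
  show ?case
  proof (cases "F1 = {}")
    case True
    then have F: "\<forall>t\<in>F. snd t = r" using F01 by (auto simp: F0_def)
    have inj: "inj_on fst F" using F by (auto simp: inj_on_def prod_eq_iff)
    have "?m * v \<le> num_terms (a t)" if t: "t \<in> F" for t
    proof -
      have "coeff (hpoly r F) (fst t) = (\<Sum>s\<in>F. if s = t then var_sum V ^ (D - r) * a t else 0)"
        unfolding hpoly_def coeff_sum
      proof (intro sum.cong refl)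
        fix s assume s: "s \<in> F"
        have "fst s = fst t \<longleftrightarrow> s = t" by (rule inj_on_eq_iff[OF inj s t])
        moreover have "snd s = r" using F s by blast
        ultimately show "coeff ([:1, -1:] ^ (snd s - r) * monom (var_sum V ^ (D - snd s) * a s) (fst s)) (fst t)
            = (if s = t then var_sum V ^ (D - r) * a t else 0)" by simp
      qed
      also have "\<dots> = var_sum V ^ (D - r) * a t" using fin t by simp
      finally have "var_sum V ^ (D - r + v) dvd var_sum V ^ (D - r) * a t"
        using dvd unfolding const_poly_dvd_iff by metis
      then have "var_sum V ^ v dvd a t" by (rule dvd_power_cancel)
      then have "var_sum V ^ v dvd (\<Sum>t\<in>{t}. a t)" by simp
      then have "?m * v \<le> (\<Sum>t\<in>{t}. num_terms (a t))"
        using t FN F v assms(1) by (intro num_terms_row_ge_mult[of "{t}" r]) auto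
      then show ?thesis by simp
    qed
    then have "card F * (?m * v) \<le> Z F" unfolding Z_def by (intro sum_bounded_below[of F "?m * v", simplified]) auto
    moreover have "card (shade r F) = card F"
    proof -
      have "shade r F = fst ` F" using F by (auto simp: shade_def shadow_def)
      then show ?thesis by (simp add: card_image[OF inj])
    qed
    moreover have "card F + v \<le> card F * v + 1"
    proof -
      obtain x y where "card F = Suc x" "v = Suc y"
        using v ne fin by (metis Suc_le_D One_nat_def card_eq_0_iff not0_implies_Suc)
      then show ?thesis by simp
    qed
    then have "?m * (card F + v) \<le> ?m * (card F * v + 1)" by (rule mult_le_mono2)
    ultimately show ?thesis unfolding Z_def[symmetric] by (simp add: algebra_simps)
  next
    case F1: False
    have j1: "\<forall>t\<in>F1. snd t - r \<ge> 1" by (auto simp: F1_def)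
    have kk: "\<forall>t\<in>F1. fst t \<le> fst t" by simp
    from shadow_interval_or_gap[OF F01(4) F1 kk j1] show ?thesis
    proof (elim disjE exE conjE, goal_cases)
      case gap: (2 g I1 I2)
      show ?case
      proof (rule split[of "{t\<in>F. fst t \<le> g}" "{t\<in>F. fst t > g}"])
        have I: "I1 \<subseteq> F" "I2 \<subseteq> F" using gap(1) F01(1) by auto
        have "fst t \<le> g" if "t \<in> I1" for t using bspec[OF gap(5) that] by simp
        then show "{t\<in>F. fst t \<le> g} \<noteq> {}" using gap(3) I by blast
        show "{t\<in>F. fst t > g} \<noteq> {}" using gap(4,6) I by blast
        have "fst t + (snd t - r) \<le> g" if t: "t \<in> F" "fst t \<le> g" for t
        proof (cases "t \<in> F1")
          case True
          then have "t \<in> I1" using gap(1,6) t(2) by force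
          then show ?thesis using gap(5) by blast
        next
          case False
          then have "snd t = r" using F01(1) t(1) by (auto simp: F0_def)
          then show ?thesis using t(2) by simp
        qed
        then show "shade r {t\<in>F. fst t \<le> g} \<inter> shade r {t\<in>F. fst t > g} = {}"
          by (fastforce simp: shade_def shadow_def)
      qed auto
    next
      case interval: (1 lo hi)
      have sh: "shade (Suc r) F1 = {lo..hi}" using interval(2) by (simp add: shade_def)
      have c1: "card (shade r F1) = card (shade (Suc r) F1) + 1"
        using card_shadow_age[of F1 fst fst "\<lambda>t. snd t - r" lo hi] interval j1 by (simp add: shade_def)
      show ?case
      proof (cases "\<exists>t\<in>F0. fst t \<notin> shade r F1")
        case True
        show ?thesis
        proof (rule split[of "{t\<in>F0. fst t \<notin> shade r F1}" "F1 \<union> {t\<in>F0. fst t \<in> shade r F1}"])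
          have s0: "shade r {t\<in>F0. Q t} = fst ` {t\<in>F0. Q t}" for Q
            by (auto simp: shade_def shadow_def F0_def)
          show "shade r {t\<in>F0. fst t \<notin> shade r F1} \<inter> shade r (F1 \<union> {t\<in>F0. fst t \<in> shade r F1}) = {}"
            unfolding shade_Un s0 by auto
        qed (use F01 F1 True in auto)
      next
        case False
        have sF: "shade r F = shade r F1"
        proof -
          have "shade r F0 = fst ` F0" by (auto simp: shade_def shadow_def F0_def)
          then show ?thesis unfolding F01(1) shade_Un using False by auto
        qed
        have rD: "Suc r \<le> D"
        proof -
          obtain t where "t \<in> F1" using F1 by blast
          then have "t \<in> N" "snd t > r" using FN by (auto simp: F1_def)
          then show ?thesis using N_le[of t] by linarith
        qed
        have F1r: "\<forall>t\<in>F1. snd t \<ge> Suc r" by (auto simp: F1_def)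
        have less1: "(\<Sum>t\<in>F1. snd t - Suc r + 1) < (\<Sum>t\<in>F. snd t - r + 1)"
        proof -
          have "(\<Sum>t\<in>F1. snd t - Suc r + 1) < (\<Sum>t\<in>F1. snd t - r + 1)"
            using F1 F01(4) by (intro sum_strict_mono) (auto simp: F1_def)
          also have "\<dots> \<le> (\<Sum>t\<in>F. snd t - r + 1)"
            using fin by (intro sum_mono2) (auto simp: F1_def)
          finally show ?thesis .
        qed
        have F1N: "F1 \<subseteq> N" using FN by (auto simp: F1_def)
        show ?thesis
        proof (cases "F0 = {}")
          case True
          then have FF: "F = F1" using F01(1) by simp
          have "[:var_sum V ^ (D - Suc r + (v + 1)):] dvd hpoly (Suc r) F1"
          proof -
            have e: "D - Suc r + (v + 1) = D - r + v" using rD by simp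
            have "r \<le> Suc r" by simp
            from dvd_hpoly_age[OF this F1r] dvd show ?thesis unfolding e FF by blast
          qed
          then have "?m * (card (shade (Suc r) F1) + (v + 1)) \<le> Z F1 + ?m"
            unfolding Z_def by (intro less.hyps[OF less1 F1N F1 F1r]) auto
          then show ?thesis unfolding Z_def[symmetric] sF c1 FF by (simp add: algebra_simps)
        next
          case ne0: False
          have "var_sum V ^ (D - r + v) dvd poly (hpoly r F) 1" by (rule dvd_poly_one[OF dvd])
          also have "poly (hpoly r F) 1 = (\<Sum>t\<in>F0. var_sum V ^ (D - r) * a t)"
            unfolding poly_hpoly_one[OF fin] using Fr by (intro sum.cong) (auto simp: F0_def)
          also have "\<dots> = var_sum V ^ (D - r) * (\<Sum>t\<in>F0. a t)" by (simp add: sum_distrib_left)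
          finally have "var_sum V ^ v dvd (\<Sum>t\<in>F0. a t)" by (rule dvd_power_cancel)
          then have Z0: "?m * v \<le> Z F0"
            unfolding Z_def using FN ne0 v assms(1)
            by (intro num_terms_row_ge_mult[of F0 r]) (auto simp: F0_def)
          have "[:var_sum V ^ (D - r):] dvd hpoly r F"
            using dvd by (rule dvd_trans[rotated]) (auto intro: le_imp_power_dvd)
          moreover have "[:var_sum V ^ (D - r):] dvd hpoly r F0"
            by (rule dvd_row_part[OF F01(3)]) (auto simp: F0_def)
          moreover have "hpoly r F = hpoly r F0 + hpoly r F1"
            unfolding F01(1) by (rule hpoly_Un[OF F01(3,4,2)])
          ultimately have "[:var_sum V ^ (D - r):] dvd hpoly r F1"
            by (simp only: dvd_add_right_iff)
          moreover have e: "D - Suc r + 1 = D - r" using rD by simp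
          moreover have "r \<le> Suc r" by simp
          ultimately have "[:var_sum V ^ (D - Suc r + 1):] dvd hpoly (Suc r) F1"
            unfolding e using dvd_hpoly_age[OF _ F1r] by blast
          then have "?m * (card (shade (Suc r) F1) + 1) \<le> Z F1 + ?m"
            unfolding Z_def by (intro less.hyps[OF less1 F1N F1 F1r]) auto
          moreover have "Z F = Z F0 + Z F1" unfolding F01(1) by (rule Z_Un[OF F01(3,4,2)])
          ultimately show ?thesis using Z0 unfolding Z_def[symmetric] sF c1 by (simp add: algebra_simps)
        qed
      qed
    qed
  qed
qed

theorem many_variables_bound:
  assumes "3 \<le> card V"
  shows "card V * D + 1 \<le> (\<Sum>t\<in>N. num_terms (a t))"
proof (cases "D = 0")
  case True
  obtain t where "t \<in> N" using N_top by blast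
  then have "num_terms (a t) \<le> (\<Sum>t\<in>N. num_terms (a t))" using finite_N by (intro member_le_sum) auto
  then show ?thesis using num_terms_a_pos[OF \<open>t \<in> N\<close>] True by simp
next
  case False
  then have D: "D \<ge> 1" by simp
  have "shade 1 upper \<noteq> {}" unfolding shade_upper[OF D] by simp
  then have "upper \<noteq> {}" by simp
  moreover have "[:var_sum V ^ (D - 1 + 1):] dvd hpoly 1 upper"
    using dvd_hpoly_upper[of 1] D by (simp add: upper_def)
  ultimately have "card V * (card (shade 1 upper) + 1) \<le> (\<Sum>t\<in>upper. num_terms (a t)) + card V"
    using upper_subset by (intro sum_num_terms_ge_shade[OF assms]) (auto simp: upper_def)
  then have "card V * D \<le> (\<Sum>t\<in>upper. num_terms (a t))"
    unfolding shade_upper[OF D] using D by simp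
  then show ?thesis using sum_num_terms_upper[OF D] by linarith
qed

end

section \<open>Functionals with few sign changes\<close>

definition scale :: "real \<Rightarrow> rpoly \<Rightarrow> rpoly" where
  "scale c f = single 0 c * f"

lemma rpoly_vector_space: "vector_space scale"
  by unfold_locales (auto simp: scale_def algebra_simps single_add mult_single simp flip: mult.assoc)

interpretation rv: vector_space scale
  by (rule rpoly_vector_space)

definition functional :: "(rpoly \<Rightarrow> real) \<Rightarrow> bool" where
  "functional l \<longleftrightarrow> (\<forall>x y. l (x + y) = l x + l y) \<and> (\<forall>c x. l (scale c x) = c * l x)"

lemma ex_functional:
  assumes W: "rv.subspace W" and x: "x \<notin> W"
  shows "\<exists>\<mu>. functional \<mu> \<and> (\<forall>w\<in>W. \<mu> w = 0) \<and> \<mu> x = 1"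
proof -
  interpret rvp: vector_space_pair scale "(*) :: real \<Rightarrow> real \<Rightarrow> real"
    by unfold_locales (auto simp: algebra_simps)
  obtain B where B: "B \<subseteq> W" "rv.independent B" "W \<subseteq> rv.span B" by (rule rv.maximal_independent_subset)
  have "rv.span B \<subseteq> W" using B(1) W by (rule rv.span_minimal)
  then have "x \<notin> rv.span B" using x by blast
  then have "rv.independent (insert x B)" using B(2) by (rule rv.independent_insertI)
  then obtain g where g: "Vector_Spaces.linear scale (*) g" "\<forall>y\<in>insert x B. g y = (if y = x then 1 else 0)"
    using rvp.linear_independent_extend[of "insert x B" "\<lambda>y. if y = x then 1 else 0"] by blast
  interpret g: Vector_Spaces.linear scale "(*)" g by (rule g(1))
  have "g y = 0" if "y \<in> B" for y using g(2) that B(1) x by auto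
  then have "g w = 0" if "w \<in> W" for w using g.eq_0_on_span[of B w] B(3) that by blast
  moreover have "functional g" unfolding functional_def by (simp add: g.add g.scale)
  ultimately show ?thesis using g(2) by auto
qed

lemma functional_add_scaled:
  "functional l \<Longrightarrow> functional \<mu> \<Longrightarrow> functional (\<lambda>x. l x + t * \<mu> x)"
  unfolding functional_def by (simp add: distrib_left mult.left_commute)

lemma ex_real_avoiding:
  fixes l \<mu> :: "'a \<Rightarrow> real"
  assumes "finite G" "infinite T" "\<And>g. g \<in> G \<Longrightarrow> l g \<noteq> 0 \<or> \<mu> g \<noteq> 0"
  shows "\<exists>t\<in>T. \<forall>g\<in>G. l g + t * \<mu> g \<noteq> 0"
proof (rule ccontr)
  assume no: "\<not> ?thesis"
  have "T \<subseteq> (\<lambda>g. - l g / \<mu> g) ` G"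
  proof
    fix t assume "t \<in> T"
    then obtain g where g: "g \<in> G" "l g + t * \<mu> g = 0" using no by blast
    then have "\<mu> g \<noteq> 0" using assms(3)[of g] by auto
    then have "t = - l g / \<mu> g" using g(2) by (simp add: field_simps)
    then show "t \<in> (\<lambda>g. - l g / \<mu> g) ` G" using g(1) by blast
  qed
  then show False using assms(1,2) finite_subset by blast
qed

text \<open>
  Between two consecutive entries of an alternation there is a first column whose sign is that of
  the second entry. It must be one of the exceptional columns \<open>R\<close>, and different pairs yield different columns.
\<close>

lemma alternates_le_sign_changes:
  assumes "finite R"
    and same: "\<And>k j. k \<notin> R \<Longrightarrow> j < k \<Longrightarrow> a j * a k < 0 \<Longrightarrow> \<exists>i. j < i \<and> i < k \<and> a i * a k > 0"
    and "alternates a L"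
  shows "L \<le> card R + 1"
proof -
  from assms(3) obtain f e where f: "\<And>i j. i < j \<Longrightarrow> j < L \<Longrightarrow> f i < f j"
    and e: "\<And>i. i < L \<Longrightarrow> e * (-1) ^ i * a (f i) > 0"
    unfolding alternates_def by blast
  define h where "h i = (LEAST k. f i < k \<and> a k * a (f (Suc i)) > 0)" for i
  have h: "f i < h i \<and> h i \<le> f (Suc i) \<and> h i \<in> R" if i: "Suc i < L" for i
  proof -
    have "a (f i) * a (f (Suc i)) < 0"
      using e[of i] e[of "Suc i"] i by (cases "even i") (auto simp: zero_less_mult_iff mult_less_0_iff)
    then have opp: "a (f i) * a (f (Suc i)) < 0" .
    have ex: "f i < f (Suc i) \<and> a (f (Suc i)) * a (f (Suc i)) > 0"
      using f[of i "Suc i"] i opp by (auto simp: mult_less_0_iff zero_less_mult_iff)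
    have hi: "f i < h i \<and> a (h i) * a (f (Suc i)) > 0"
      unfolding h_def by (rule LeastI[of "\<lambda>k. f i < k \<and> a k * a (f (Suc i)) > 0", OF ex])
    have le: "h i \<le> f (Suc i)"
      unfolding h_def by (rule Least_le[of "\<lambda>k. f i < k \<and> a k * a (f (Suc i)) > 0", OF ex])
    have "h i \<in> R"
    proof (rule ccontr)
      assume "h i \<notin> R"
      moreover have "a (f i) * a (h i) < 0" using opp hi by (auto simp: mult_less_0_iff zero_less_mult_iff)
      ultimately obtain j where j: "f i < j" "j < h i" "a j * a (h i) > 0" using same hi by blast
      then have "f i < j \<and> a j * a (f (Suc i)) > 0" using hi by (auto simp: zero_less_mult_iff)
      then show False using not_less_Least[of j "\<lambda>k. f i < k \<and> a k * a (f (Suc i)) > 0"] j(2)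
        unfolding h_def by blast
    qed
    then show ?thesis using hi le by blast
  qed
  have less: "h i < h j" if "i < j" "j < L - 1" for i j
  proof -
    have "f (Suc i) \<le> f j" using f[of "Suc i" j] that by (cases "Suc i = j") (auto intro: less_imp_le)
    moreover have "h i \<le> f (Suc i)" "f j < h j" using h[of i] h[of j] that by simp_all
    ultimately show ?thesis by linarith
  qed
  have "inj_on h {..<L - 1}"
    by (rule inj_onI) (metis less lessThan_iff less_irrefl linorder_neqE_nat)
  moreover have "h ` {..<L - 1} \<subseteq> R" using h by auto
  ultimately have "card {..<L - 1} \<le> card R" using assms(1) by (rule card_inj_on_le)
  then show ?thesis by simp
qed

text \<open>
  The columns before \<open>k\<close> together with all multiples of \<open>c\<close>. A column outside this space is free
  to be given any value by a functional that respects the earlier columns and kills the multiples of \<open>c\<close>.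
\<close>

definition col_space :: "rpoly \<Rightarrow> (nat \<Rightarrow> rpoly) \<Rightarrow> nat \<Rightarrow> rpoly set" where
  "col_space c P k = rv.span (P ` {..<k} \<union> range ((*) c))"

lemma subspace_multiples: "rv.subspace (range ((*) c))"
  unfolding rv.subspace_def
proof (intro conjI ballI allI)
  show "0 \<in> range ((*) c)" by (rule range_eqI[of _ _ 0]) simp
next
  fix x y assume "x \<in> range ((*) c)" "y \<in> range ((*) c)"
  then show "x + y \<in> range ((*) c)" by (auto simp: distrib_left[symmetric])
next
  fix x s assume "x \<in> range ((*) c)"
  then obtain b where "x = c * b" by auto
  then have "scale s x = c * scale s b" by (simp add: scale_def mult.left_commute)
  then show "scale s x \<in> range ((*) c)" by (rule range_eqI)
qed

text \<open>
  Start with a functional that is nonzero on \<open>G\<close> and process the columns from left to right. A free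
  column is given the sign of the last nonzero earlier value, so it causes no sign change. This leaves
  infinitely many possible values, of which the finite set \<open>G\<close> excludes only finitely many.
\<close>

lemma ex_functional_few_sign_changes:
  fixes P :: "nat \<Rightarrow> rpoly"
  assumes G: "finite G" "\<And>g. g \<in> G \<Longrightarrow> \<not> c dvd g"
  shows "\<exists>l. functional l \<and> (\<forall>b. l (c * b) = 0) \<and> (\<forall>g\<in>G. l g \<noteq> 0) \<and>
    (\<forall>k<K. P k \<notin> col_space c P k \<longrightarrow>
      (\<forall>j<k. l (P j) * l (P k) < 0 \<longrightarrow> (\<exists>i. j < i \<and> i < k \<and> l (P i) * l (P k) > 0)))"
proof (induction K)
  case 0
  have "\<exists>l. functional l \<and> (\<forall>b. l (c * b) = 0) \<and> (\<forall>g\<in>G. l g \<noteq> 0)"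
    using G
  proof (induction G rule: finite_induct)
    case empty
    show ?case by (rule exI[of _ "\<lambda>_. 0"]) (simp add: functional_def)
  next
    case (insert g G)
    then obtain l where l: "functional l" "\<forall>b. l (c * b) = 0" "\<forall>g\<in>G. l g \<noteq> 0" by auto
    have "g \<notin> range ((*) c)" using insert.prems by (auto simp: dvd_def)
    then obtain \<mu> where \<mu>: "functional \<mu>" "\<forall>w\<in>range ((*) c). \<mu> w = 0" "\<mu> g = 1"
      using ex_functional[OF subspace_multiples] by blast
    have "\<exists>t\<in>UNIV. \<forall>x\<in>insert g G. l x + t * \<mu> x \<noteq> 0"
      using insert.hyps l(3) \<mu>(3) by (intro ex_real_avoiding infinite_UNIV_char_0) auto
    then obtain t where t: "\<forall>x\<in>insert g G. l x + t * \<mu> x \<noteq> 0" by blast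
    show ?case
      by (rule exI[of _ "\<lambda>x. l x + t * \<mu> x"])
        (use t l \<mu> functional_add_scaled[OF l(1) \<mu>(1)] in auto)
  qed
  then show ?case by simp
next
  case (Suc K)
  then obtain l where l: "functional l" "\<forall>b. l (c * b) = 0" "\<forall>g\<in>G. l g \<noteq> 0"
    and sc: "\<forall>k<K. P k \<notin> col_space c P k \<longrightarrow>
      (\<forall>j<k. l (P j) * l (P k) < 0 \<longrightarrow> (\<exists>i. j < i \<and> i < k \<and> l (P i) * l (P k) > 0))"
    by blast
  show ?case
  proof (cases "P K \<in> col_space c P K")
    case True
    show ?thesis
    proof (intro exI[of _ l] conjI allI impI)
      fix k j assume "k < Suc K" "P k \<notin> col_space c P k" "j < k" "l (P j) * l (P k) < 0"
      then show "\<exists>i. j < i \<and> i < k \<and> l (P i) * l (P k) > 0" using sc True by (metis less_Suc_eq)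
    qed (use l in auto)
  next
    case False
    have "rv.subspace (col_space c P K)" unfolding col_space_def by (rule rv.subspace_span)
    then obtain \<mu> where \<mu>: "functional \<mu>" "\<forall>w\<in>col_space c P K. \<mu> w = 0" "\<mu> (P K) = 1"
      using ex_functional[OF _ False] by blast
    have \<mu>P: "\<mu> (P j) = 0" if "j < K" for j
      using \<mu>(2) that rv.span_base[of "P j"] unfolding col_space_def by auto
    have \<mu>c: "\<mu> (c * b) = 0" for b
    proof -
      have "c * b \<in> col_space c P K" unfolding col_space_def by (intro rv.span_base UnI2 rangeI)
      then show ?thesis using \<mu>(2) by blast
    qed
    define s where "s = (if \<exists>j<K. l (P j) \<noteq> 0 then l (P (Max {j. j < K \<and> l (P j) \<noteq> 0})) else 1)"
    have s0: "s \<noteq> 0"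
    proof (cases "\<exists>j<K. l (P j) \<noteq> 0")
      case True
      then have "Max {j. j < K \<and> l (P j) \<noteq> 0} \<in> {j. j < K \<and> l (P j) \<noteq> 0}"
        by (intro Max_in) auto
      then show ?thesis using True by (simp add: s_def)
    qed (auto simp: s_def)
    have inf: "infinite {t. s * (l (P K) + t) > 0}"
    proof (cases "s > 0")
      case True
      then have "{t. s * (l (P K) + t) > 0} = {- l (P K)<..}" by (auto simp: zero_less_mult_iff)
      then show ?thesis by (simp only: infinite_Ioi not_False_eq_True)
    next
      case False
      then have "{t. s * (l (P K) + t) > 0} = {..<- l (P K)}" using s0 by (auto simp: zero_less_mult_iff)
      then show ?thesis by (simp only: infinite_Iio not_False_eq_True)
    qed
    obtain t where t: "s * (l (P K) + t) > 0" "\<forall>g\<in>G. l g + t * \<mu> g \<noteq> 0"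
      using ex_real_avoiding[OF G(1) inf, of l \<mu>] l(3) by auto
    define l' where "l' x = l x + t * \<mu> x" for x
    have l'P: "l' (P j) = l (P j)" if "j < K" for j using \<mu>P[OF that] by (simp add: l'_def)
    have l'K: "s * l' (P K) > 0" using t(1) \<mu>(3) by (simp add: l'_def)
    show ?thesis
    proof (intro exI[of _ l'] conjI allI impI)
      show "functional l'" unfolding l'_def by (rule functional_add_scaled[OF l(1) \<mu>(1)])
      show "l' (c * b) = 0" for b using l(2) \<mu>c by (simp add: l'_def)
      show "\<forall>g\<in>G. l' g \<noteq> 0" using t(2) by (simp add: l'_def)
      fix k j assume k: "k < Suc K" "P k \<notin> col_space c P k" and j: "j < k" and neg: "l' (P j) * l' (P k) < 0"
      show "\<exists>i. j < i \<and> i < k \<and> l' (P i) * l' (P k) > 0"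
      proof (cases "k = K")
        case False
        then have "k < K" using k(1) by simp
        then have eq: "l' (P i) = l (P i)" if "i \<le> k" for i using l'P that by auto
        have "l (P j) * l (P k) < 0" using neg eq j by simp
        then obtain i where "j < i" "i < k" "l (P i) * l (P k) > 0" using sc \<open>k < K\<close> k(2) j by blast
        then show ?thesis using eq by (intro exI[of _ i]) auto
      next
        case True
        define M where "M = Max {j. j < K \<and> l (P j) \<noteq> 0}"
        have jK: "j < K" using j True by simp
        have nz: "l (P j) \<noteq> 0" using neg l'P[OF jK] by auto
        have M: "M < K \<and> l (P M) \<noteq> 0" "j \<le> M"
        proof -
          have "M \<in> {j. j < K \<and> l (P j) \<noteq> 0}" unfolding M_def using jK nz by (intro Max_in) auto
          then show "M < K \<and> l (P M) \<noteq> 0" by simp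
          show "j \<le> M" unfolding M_def using jK nz by (intro Max_ge) auto
        qed
        have "s = l (P M)" using jK nz unfolding s_def M_def by auto
        then have pos: "l' (P M) * l' (P k) > 0" using l'K l'P[of M] M(1) True by simp
        then have "j \<noteq> M" using neg by auto
        then show ?thesis using M pos True by (intro exI[of _ M]) auto
      qed
    qed
  qed
qed

text \<open>
  The free columns are linearly independent modulo the multiples of \<open>c\<close>. Hence not all other columns
  are combinations of them, or else their sum, a multiple of \<open>c\<close>, would vanish. One dependent column thus
  differs from a combination of free columns by a nonzero multiple of \<open>c\<close>, which has at least
  \<open>v + 1\<close> terms, all taken from this column and the free ones. Every further dependent column
  has at least one term.
\<close>

lemma sum_num_terms_ge_dependent:
  fixes P :: "nat \<Rightarrow> rpoly"
  assumes S: "(\<Sum>k<K. P k) \<noteq> 0" "c dvd (\<Sum>k<K. P k)"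
    and v: "\<And>f. f \<noteq> 0 \<Longrightarrow> c dvd f \<Longrightarrow> v + 1 \<le> num_terms f"
  defines "R \<equiv> {k. k < K \<and> P k \<noteq> 0 \<and> P k \<in> col_space c P k}"
  shows "v + card R \<le> (\<Sum>k<K. num_terms (P k))"
proof -
  define Z where "Z = range ((*) c)"
  define NN where "NN = {k. k < K \<and> P k \<notin> col_space c P k}"
  have Zsub: "rv.subspace Z" unfolding Z_def by (rule subspace_multiples)
  have fin: "finite NN" "finite R" by (auto simp: NN_def R_def)
  have cs: "col_space c P k = rv.span (P ` {..<k} \<union> Z)" for k by (simp add: col_space_def Z_def)
  have P_span: "P k \<in> rv.span (P ` NN \<union> Z)" if "k < K" for k
    using that
  proof (induction k rule: less_induct)
    case (less k)
    show ?case
    proof (cases "k \<in> NN")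
      case True
      then show ?thesis by (intro rv.span_base) auto
    next
      case False
      then have "P k \<in> rv.span (P ` {..<k} \<union> Z)" using less.prems by (simp add: NN_def cs)
      also have "\<dots> \<subseteq> rv.span (P ` NN \<union> Z)"
      proof (rule rv.span_minimal[OF _ rv.subspace_span])
        show "P ` {..<k} \<union> Z \<subseteq> rv.span (P ` NN \<union> Z)"
          using less.IH less.prems rv.span_superset[of "P ` NN \<union> Z"] by auto
      qed
      finally show ?thesis .
    qed
  qed
  have indep: "x = 0" if "x \<in> rv.span (P ` (NN \<inter> {..<j}))" "x \<in> Z" for j x
    using that
  proof (induction j)
    case 0
    then show ?case by simp
  next
    case (Suc j)
    show ?case
    proof (cases "j \<in> NN")
      case False
      then have "NN \<inter> {..<Suc j} = NN \<inter> {..<j}" by (auto simp: less_Suc_eq)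
      then show ?thesis using Suc by simp
    next
      case True
      then have "P ` (NN \<inter> {..<Suc j}) = insert (P j) (P ` (NN \<inter> {..<j}))" by (auto simp: less_Suc_eq)
      then obtain q where q: "x - scale q (P j) \<in> rv.span (P ` (NN \<inter> {..<j}))"
        using Suc.prems(1) rv.span_breakdown_eq by auto
      show ?thesis
      proof (cases "q = 0")
        case True
        then show ?thesis using Suc q by simp
      next
        case False
        have 1: "x - scale q (P j) \<in> rv.span (P ` {..<j} \<union> Z)"
          using q rv.span_mono[of "P ` (NN \<inter> {..<j})" "P ` {..<j} \<union> Z"] by auto
        have 2: "x \<in> rv.span (P ` {..<j} \<union> Z)" using Suc.prems(2) by (intro rv.span_base) simp
        have "scale (1 / q) (x - (x - scale q (P j))) \<in> rv.span (P ` {..<j} \<union> Z)"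
          by (intro rv.span_scale rv.span_diff 1 2)
        moreover have "scale (1 / q) (x - (x - scale q (P j))) = P j" using False by simp
        ultimately have "P j \<in> col_space c P j" unfolding cs by simp
        then show ?thesis using True by (simp add: NN_def)
      qed
    qed
  qed
  have indep': "x = 0" if "x \<in> rv.span (P ` NN)" "x \<in> Z" for x
  proof -
    have "NN \<inter> {..<K} = NN" by (auto simp: NN_def)
    then show ?thesis using indep[of x K] that by simp
  qed
  have "\<exists>k\<in>R. P k \<notin> rv.span (P ` NN)"
  proof (rule ccontr)
    assume no: "\<not> ?thesis"
    have "P k \<in> rv.span (P ` NN)" if kK: "k < K" for k
    proof -
      consider "k \<in> NN" | "k \<in> R" | "P k = 0" using kK unfolding NN_def R_def by blast
      then show ?thesis
      proof cases
        case 1 then show ?thesis by (intro rv.span_base) auto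
      next
        case 2 then show ?thesis using no by blast
      next
        case 3 then show ?thesis by (simp add: rv.span_zero)
      qed
    qed
    then have "(\<Sum>k<K. P k) \<in> rv.span (P ` NN)" by (intro rv.span_sum) auto
    moreover have "(\<Sum>k<K. P k) \<in> Z" using S(2) by (auto simp: Z_def elim!: dvdE)
    ultimately show False using indep' S(1) by blast
  qed
  then obtain k where k: "k \<in> R" "P k \<notin> rv.span (P ` NN)" by blast
  have "P k \<in> rv.span (P ` NN \<union> Z)" using k(1) by (intro P_span) (simp add: R_def)
  then obtain s z where sz: "P k = s + z" "s \<in> rv.span (P ` NN)" "z \<in> Z"
    using rv.span_eq_iff[THEN iffD2, OF Zsub] unfolding rv.span_Un by auto
  have "z \<noteq> 0" using sz k(2) by auto
  moreover have "c dvd z" using sz(3) by (auto simp: Z_def)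
  ultimately have "v + 1 \<le> num_terms z" by (rule v)
  also have "\<dots> \<le> card (keys (P k) \<union> (\<Union>j\<in>NN. keys (P j)))"
    unfolding num_terms_def
  proof (rule card_mono)
    let ?U = "\<Union>j\<in>NN. keys (P j)"
    define W where "W = {f :: rpoly. keys f \<subseteq> ?U}"
    have "rv.subspace W"
      unfolding rv.subspace_def
    proof (intro conjI ballI allI)
      show "0 \<in> W" by (simp add: W_def)
    next
      fix x y assume "x \<in> W" "y \<in> W"
      then show "x + y \<in> W" using Poly_Mapping.keys_add[of x y] by (auto simp: W_def)
    next
      fix x q assume "x \<in> W"
      moreover have "keys (scale q x) \<subseteq> keys x"
        unfolding scale_def using keys_mult[of "single 0 q" x] by (auto split: if_splits)
      ultimately show "scale q x \<in> W" by (auto simp: W_def)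
    qed
    then have "rv.span (P ` NN) \<subseteq> W" by (intro rv.span_minimal) (auto simp: W_def)
    then have "s \<in> W" using sz(2) by blast
    then have "keys s \<subseteq> ?U" by (simp add: W_def)
    moreover have "z = P k - s" using sz(1) by simp
    then have "keys z \<subseteq> keys (P k) \<union> keys s" by (simp add: Poly_Mapping.keys_diff)
    ultimately show "keys z \<subseteq> keys (P k) \<union> ?U" by blast
  qed (simp add: fin)
  also have "\<dots> \<le> num_terms (P k) + (\<Sum>j\<in>NN. num_terms (P j))"
    unfolding num_terms_def by (rule order.trans[OF card_Un_le]) (simp add: card_UN_le fin)
  finally have 1: "v + 1 \<le> num_terms (P k) + (\<Sum>j\<in>NN. num_terms (P j))" .
  have "card R = card (R - {k}) + 1" using card.remove[OF fin(2) k(1)] by simp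
  moreover have "card (R - {k}) \<le> (\<Sum>j\<in>R - {k}. num_terms (P j))"
  proof -
    have "1 \<le> num_terms (P j)" if "j \<in> R" for j
      using that unfolding num_terms_def R_def by (simp add: Suc_le_eq card_gt_0_iff)
    then show ?thesis using sum_mono[of "R - {k}" "\<lambda>_. 1" "\<lambda>j. num_terms (P j)"] by auto
  qed
  moreover have "(\<Sum>j\<in>R. num_terms (P j)) = num_terms (P k) + (\<Sum>j\<in>R - {k}. num_terms (P j))"
    by (rule sum.remove[OF fin(2) k(1)])
  moreover have "(\<Sum>j\<in>NN \<union> R. num_terms (P j)) = (\<Sum>j\<in>NN. num_terms (P j)) + (\<Sum>j\<in>R. num_terms (P j))"
    using fin by (intro sum.union_disjoint) (auto simp: NN_def R_def)
  moreover have "(\<Sum>j\<in>NN \<union> R. num_terms (P j)) \<le> (\<Sum>k<K. num_terms (P k))"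
    by (intro sum_mono2) (auto simp: NN_def R_def)
  ultimately show ?thesis using 1 by linarith
qed

text \<open>
  The number \<open>q\<close> counts the nonzero columns that depend on earlier ones modulo \<open>c\<close>: it bounds the
  sign changes from above and, at the same time, the number of terms from below.
\<close>

theorem ex_separating_functional:
  fixes P :: "nat \<Rightarrow> rpoly"
  assumes G: "finite G" "\<And>g. g \<in> G \<Longrightarrow> \<not> c dvd g"
    and P: "\<And>k. k \<ge> K \<Longrightarrow> P k = 0" and S: "(\<Sum>k<K. P k) \<noteq> 0" "c dvd (\<Sum>k<K. P k)"
    and v: "\<And>f. f \<noteq> 0 \<Longrightarrow> c dvd f \<Longrightarrow> v + 1 \<le> num_terms f"
  shows "\<exists>l q. functional l \<and> (\<forall>b. l (c * b) = 0) \<and> (\<forall>g\<in>G. l g \<noteq> 0) \<and>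
    (\<forall>L. alternates (\<lambda>k. l (P k)) L \<longrightarrow> L \<le> q + 1) \<and> v + q \<le> (\<Sum>k<K. num_terms (P k))"
proof -
  define R where "R = {k. k < K \<and> P k \<noteq> 0 \<and> P k \<in> col_space c P k}"
  obtain l where l: "functional l" "\<forall>b. l (c * b) = 0" "\<forall>g\<in>G. l g \<noteq> 0"
    and sc: "\<forall>k<K. P k \<notin> col_space c P k \<longrightarrow>
      (\<forall>j<k. l (P j) * l (P k) < 0 \<longrightarrow> (\<exists>i. j < i \<and> i < k \<and> l (P i) * l (P k) > 0))"
    using ex_functional_few_sign_changes[OF G, where P = P and K = K] by blast
  have l0: "l 0 = 0" using l(2)[rule_format, of 0] by simp
  have "L \<le> card R + 1" if "alternates (\<lambda>k. l (P k)) L" for L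
  proof (rule alternates_le_sign_changes[OF _ _ that])
    show "finite R" by (simp add: R_def)
    fix k j assume k: "k \<notin> R" "j < k" "l (P j) * l (P k) < 0"
    then have "P k \<noteq> 0" using l0 by auto
    then have "k < K" using P by (meson not_le)
    then show "\<exists>i. j < i \<and> i < k \<and> l (P i) * l (P k) > 0"
      using sc k \<open>P k \<noteq> 0\<close> unfolding R_def by blast
  qed
  moreover have "v + card R \<le> (\<Sum>k<K. num_terms (P k))"
    unfolding R_def by (rule sum_num_terms_ge_dependent[OF S v])
  ultimately show ?thesis using l by blast
qed

section \<open>Two variables besides the distinguished one\<close>

lemma alternates_uminus: "alternates a L \<Longrightarrow> alternates (\<lambda>k. - a k) L"
  unfolding alternates_def
proof (elim exE conjE)
  fix f e assume f: "\<forall>i j. i < j \<longrightarrow> j < L \<longrightarrow> f i < f j" "\<forall>i<L. e * (-1) ^ i * a (f i) > 0"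
  show "\<exists>f e. (\<forall>i j. i < j \<longrightarrow> j < L \<longrightarrow> f i < f j) \<and> (\<forall>i<L. e * (-1) ^ i * - a (f i) > 0)"
    by (rule exI[of _ f], rule exI[of _ "- e"]) (use f in simp)
qed

context node_system
begin

text \<open>
  Stated for \<open>hpoly 0\<close> because factors \<open>1 - x\<close> do not affect divisibility by powers of \<open>\<Pi>\<close>, so the same
  notion serves in all rows (\<open>block_dvd_iff\<close>).
\<close>

definition block_dvd :: "nat \<Rightarrow> (nat \<times> nat) set \<Rightarrow> bool" where
  "block_dvd e B \<longleftrightarrow> [:var_sum V ^ e:] dvd hpoly 0 B"

definition block_val :: "(nat \<times> nat) set \<Rightarrow> nat" where
  "block_val B = (GREATEST e. block_dvd e B)"

definition interval_set :: "nat set \<Rightarrow> bool" where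
  "interval_set X \<longleftrightarrow> (\<exists>lo hi. lo \<le> hi \<and> X = {lo..hi})"

lemma block_dvd_mono: "block_dvd e B \<Longrightarrow> e' \<le> e \<Longrightarrow> block_dvd e' B"
  unfolding block_dvd_def by (rule dvd_trans[rotated]) (auto intro: le_imp_power_dvd)

lemma block_dvd_iff:
  assumes "\<forall>t\<in>B. snd t \<ge> r"
  shows "block_dvd e B \<longleftrightarrow> [:var_sum V ^ e:] dvd hpoly r B"
  unfolding block_dvd_def by (rule dvd_hpoly_age[OF le0 assms])

text \<open>
  A nonzero coefficient divisible by \<open>\<Pi>\<^sup>e\<close> has more than \<open>e\<close> terms.
\<close>

lemma block_dvd_bounded:
  assumes "card V = 2" "B \<subseteq> N" "B \<noteq> {}"
  shows "\<exists>b. \<forall>e. block_dvd e B \<longrightarrow> e \<le> b"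
proof -
  have "hpoly 0 B \<noteq> 0" by (rule hpoly_nonzero[OF assms(2,3)])
  then obtain k where k: "coeff (hpoly 0 B) k \<noteq> 0" by (meson leading_coeff_0_iff)
  have "e \<le> num_terms (coeff (hpoly 0 B) k)" if "block_dvd e B" for e
  proof -
    have "var_sum V ^ e dvd coeff (hpoly 0 B) k"
      using that unfolding block_dvd_def const_poly_dvd_iff by blast
    then have "e + 1 \<le> num_terms (coeff (hpoly 0 B) k)"
      using assms(1) k finite_V by (intro num_terms_ge) auto
    then show ?thesis by simp
  qed
  then show ?thesis by blast
qed

lemma block_dvd_block_val:
  assumes "card V = 2" "B \<subseteq> N" "B \<noteq> {}"
  shows "block_dvd (block_val B) B"
proof -
  obtain b where b: "\<forall>e. block_dvd e B \<longrightarrow> e \<le> b" using block_dvd_bounded[OF assms] by blast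
  have "block_dvd 0 B" by (simp add: block_dvd_def one_pCons[symmetric])
  then show ?thesis unfolding block_val_def by (rule GreatestI_nat[of "\<lambda>e. block_dvd e B" 0 b]) (use b in blast)
qed

lemma block_val_ge:
  assumes "card V = 2" "B \<subseteq> N" "B \<noteq> {}" "block_dvd e B"
  shows "e \<le> block_val B"
proof -
  obtain b where b: "\<forall>e. block_dvd e B \<longrightarrow> e \<le> b" using block_dvd_bounded[OF assms(1-3)] by blast
  show ?thesis unfolding block_val_def
    by (rule Greatest_le_nat[of "\<lambda>e. block_dvd e B" e b]) (use assms(4) b in auto)
qed

lemma shade_Union: "shade r (\<Union>I) = (\<Union>B\<in>I. shade r B)"
  by (auto simp: shade_def shadow_def)

lemma shade_row:
  assumes "\<forall>t\<in>K. snd t = r"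
  shows "shade r K = fst ` K"
proof -
  have "shade r K = (\<Union>t\<in>K. {fst t})"
    unfolding shade_def shadow_def using assms by (intro SUP_cong refl) simp
  then show ?thesis by auto
qed

lemma shade_age:
  assumes "\<forall>t\<in>B. snd t \<ge> \<rho>" "shade \<rho> B = {lo..hi}" "lo \<le> hi" "d \<le> \<rho>"
  shows "shade (\<rho> - d) B = {lo..hi + d}"
  using assms(4)
proof (induction d)
  case 0
  then show ?case using assms by simp
next
  case (Suc d)
  have "(\<Union>t\<in>B. {fst t..fst t + (snd t - (\<rho> - d))}) = {lo..hi + d}"
    using Suc by (simp add: shade_def shadow_def)
  then have "(\<Union>t\<in>B. {fst t..Suc (fst t + (snd t - (\<rho> - d)))}) = {lo..Suc (hi + d)}"
    by (rule interval_grow) (use assms(3) in auto)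
  moreover have "Suc (fst t + (snd t - (\<rho> - d))) = fst t + (snd t - (\<rho> - Suc d))" if "t \<in> B" for t
    using assms(1) that Suc.prems by fastforce
  then have "(\<Union>t\<in>B. {fst t..Suc (fst t + (snd t - (\<rho> - d)))}) = shade (\<rho> - Suc d) B"
    unfolding shade_def shadow_def by (intro SUP_cong refl) auto
  ultimately show ?case by simp
qed

text \<open>
  Block \<open>B\<close> lies in rows \<open>\<ge> \<rho>\<close>, where \<open>\<rho>\<close> is the row in which it was formed, and there it has
  a connected shade. It has paid two terms for each column of this shade, up to a correction by its excess
  divisibility.
\<close>

definition block_data :: "(nat \<times> nat) set \<Rightarrow> nat \<Rightarrow> nat \<Rightarrow> nat \<Rightarrow> bool" where
  "block_data B \<rho> p q \<longleftrightarrow> (\<forall>t\<in>B. snd t \<ge> \<rho>) \<and> p \<le> q \<and> shade \<rho> B = {p..q} \<and>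
    2 * int (q - p + 1) + int (block_val B) + int \<rho> - int D - 1 \<le> int (\<Sum>t\<in>B. num_terms (a t))"

definition good :: "nat \<Rightarrow> (nat \<times> nat) set \<Rightarrow> bool" where
  "good r B \<longleftrightarrow> B \<subseteq> N \<and> B \<noteq> {} \<and> (\<exists>\<rho> p q. r \<le> \<rho> \<and> block_data B \<rho> p q)"

lemma good_mono: "good r B \<Longrightarrow> s \<le> r \<Longrightarrow> good s B"
  unfolding good_def by (meson le_trans)

lemma good_interval:
  assumes "good r B"
  shows "interval_set (shade r B)" "\<forall>t\<in>B. snd t \<ge> r"
proof -
  obtain \<rho> p q where d: "r \<le> \<rho>" "\<forall>t\<in>B. snd t \<ge> \<rho>" "p \<le> q" "shade \<rho> B = {p..q}"
    using assms unfolding good_def block_data_def by blast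
  have "shade (\<rho> - (\<rho> - r)) B = {p..q + (\<rho> - r)}" by (rule shade_age) (use d in auto)
  then have "shade r B = {p..q + (\<rho> - r)}" using d(1) by simp
  then show "interval_set (shade r B)" unfolding interval_set_def using d(3) by (meson trans_le_add1)
  show "\<forall>t\<in>B. snd t \<ge> r" using d by auto
qed

text \<open>
  The bound on terms in a good block is made to match its contribution to the height of the family of blocks, so
  summing over the blocks compares terms with alternations.
\<close>

lemma blocks_height:
  assumes "finite I" "\<forall>B\<in>I. Suc r \<le> \<rho> B \<and> block_data B (\<rho> B) (p B) (q B)" "\<forall>B\<in>I. int D - int r \<le> int (block_val B)"
  shows "shadow p q (\<lambda>B. \<rho> B - r) I = shade r (\<Union>I)"
    "shadow p q (\<lambda>B. \<rho> B - r - 1) I = shade (Suc r) (\<Union>I)"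
    "2 * int (card (shade r (\<Union>I))) - height p q (\<lambda>B. \<rho> B - r) I \<le> (\<Sum>B\<in>I. int (\<Sum>t\<in>B. num_terms (a t)))"
proof -
  have sh: "shade (\<rho> B - d) B = {p B..q B + d}" if "B \<in> I" "d \<le> \<rho> B" for B d
    using assms(2) that unfolding block_data_def by (intro shade_age) auto
  have "shade r B = {p B..q B + (\<rho> B - r)}" if "B \<in> I" for B
    using sh[OF that, of "\<rho> B - r"] assms(2) that by force
  then show 1: "shadow p q (\<lambda>B. \<rho> B - r) I = shade r (\<Union>I)"
    unfolding shade_Union shadow_def by simp
  have "shade (Suc r) B = {p B..q B + (\<rho> B - r - 1)}" if "B \<in> I" for B
  proof -
    have "\<rho> B - (\<rho> B - r - 1) = Suc r" using assms(2) that by force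
    then show ?thesis using sh[OF that, of "\<rho> B - r - 1"] by simp
  qed
  then show "shadow p q (\<lambda>B. \<rho> B - r - 1) I = shade (Suc r) (\<Union>I)"
    unfolding shade_Union shadow_def by simp
  have "2 * int (card (shade r (\<Union>I))) - height p q (\<lambda>B. \<rho> B - r) I
      = - (\<Sum>B\<in>I. 1 - int (\<rho> B - r) - 2 * int (q B - p B + 1))"
    unfolding height_def 1 by simp
  also have "\<dots> = (\<Sum>B\<in>I. - (1 - int (\<rho> B - r) - 2 * int (q B - p B + 1)))"
    by (simp only: sum_negf)
  also have "\<dots> \<le> (\<Sum>B\<in>I. int (\<Sum>t\<in>B. num_terms (a t)))"
  proof (rule sum_mono)
    fix B assume B: "B \<in> I"
    then have "Suc r \<le> \<rho> B" "int D - int r \<le> int (block_val B)"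
      "2 * int (q B - p B + 1) + int (block_val B) + int (\<rho> B) - int D - 1 \<le> int (\<Sum>t\<in>B. num_terms (a t))"
      using assms(2,3) unfolding block_data_def by blast+
    then show "- (1 - int (\<rho> B - r) - 2 * int (q B - p B + 1)) \<le> int (\<Sum>t\<in>B. num_terms (a t))"
      by linarith
  qed
  finally show "2 * int (card (shade r (\<Union>I))) - height p q (\<lambda>B. \<rho> B - r) I \<le> (\<Sum>B\<in>I. int (\<Sum>t\<in>B. num_terms (a t)))" .
qed

lemma hpoly_Union:
  assumes "\<forall>B\<in>I. finite B" "\<forall>A\<in>I. \<forall>B\<in>I. A \<noteq> B \<longrightarrow> A \<inter> B = {}"
  shows "hpoly r (\<Union>I) = (\<Sum>B\<in>I. hpoly r B)"
  unfolding hpoly_def using sum.Union_disjoint[OF assms] by (simp only: o_def)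

lemma good_singleton:
  assumes "card V = 2" "t \<in> N"
  shows "good (snd t) {t}"
proof -
  have sub: "{t} \<subseteq> N" "{t} \<noteq> {}" using assms by auto
  define r where "r = snd t"
  have rD: "r \<le> D" using N_le[OF assms(2)] by (simp add: r_def)
  have iff: "block_dvd e {t} \<longleftrightarrow> [:var_sum V ^ e:] dvd hpoly r {t}" for e by (rule block_dvd_iff) (simp add: r_def)
  have "block_dvd (D - r) {t}" unfolding iff by (rule dvd_row_part) (auto simp: r_def)
  then have v: "D - r \<le> block_val {t}" by (rule block_val_ge[OF assms(1) sub])
  have "[:var_sum V ^ block_val {t}:] dvd hpoly r {t}" using block_dvd_block_val[OF assms(1) sub] iff by blast
  then have "var_sum V ^ block_val {t} dvd coeff (hpoly r {t}) (fst t)" unfolding const_poly_dvd_iff by blast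
  then have "var_sum V ^ (D - r + (block_val {t} - (D - r))) dvd var_sum V ^ (D - r) * a t"
    using v by (simp add: hpoly_def r_def)
  then have "var_sum V ^ (block_val {t} - (D - r)) dvd a t" by (rule dvd_power_cancel)
  then have "block_val {t} - (D - r) + 1 \<le> num_terms (a t)"
    using assms finite_V a_nonzero by (intro num_terms_ge) auto
  moreover have "shade r {t} = {fst t..fst t}" by (simp add: shade_def shadow_def r_def)
  ultimately have "block_data {t} r (fst t) (fst t)"
    unfolding block_data_def using rD v by (auto simp: r_def)
  then show ?thesis unfolding good_def r_def[symmetric] using sub by blast
qed

text \<open>
  Apply to the merged sum a functional that kills the multiples of \<open>\<Pi>\<^sup>v\<close>, where \<open>v\<close> is the excess divisibility
  of the new block, but none of the old blocks, which are less divisible. What remains says that the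
  row elements \<open>X\<close> map to the negative of a sum of aged old blocks. The latter has at least as many
  alternations as its height, the former at most \<open>s + 1\<close>, and the row elements have
  at least \<open>v + s\<close> terms. Adding up, the number \<open>s\<close> cancels.
\<close>

lemma good_merged:
  assumes cV: "card V = 2" and I: "finite I" "I \<noteq> {}" "\<forall>B\<in>I. good (Suc r) B"
    "\<forall>A\<in>I. \<forall>B\<in>I. A \<noteq> B \<longrightarrow> A \<inter> B = {}"
    and K: "K \<subseteq> {t\<in>N. snd t = r}" "K \<noteq> {}"
    and block_val: "\<forall>B\<in>I. D - r \<le> block_val B" "\<forall>B\<in>I. block_val B < block_val (\<Union>I \<union> K)"
    and iv: "interval_set (shade (Suc r) (\<Union>I))" and cov: "fst ` K \<subseteq> shade r (\<Union>I)"
  shows "good r (\<Union>I \<union> K)"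
proof -
  define C where "C = \<Union>I \<union> K"
  define e where "e = D - r"
  define v where "v = block_val C - e"
  define \<Pi> where "\<Pi> = var_sum V"
  have nz: "\<Pi> \<noteq> 0" unfolding \<Pi>_def by (rule var_sum_V_nonzero)
  have IN: "B \<subseteq> N" "B \<noteq> {}" "finite B" if "B \<in> I" for B
    using I(3) that finite_N finite_subset unfolding good_def by auto
  have CN: "C \<subseteq> N" "C \<noteq> {}" using IN K unfolding C_def by auto
  have finK: "finite K" using K(1) finite_N by (auto intro: finite_subset)
  have v: "block_val C = e + v" "v \<ge> 1"
  proof -
    obtain B where "B \<in> I" using I(2) by blast
    then have "e < block_val C" using block_val unfolding e_def C_def by (meson le_less_trans)
    then show "block_val C = e + v" "v \<ge> 1" unfolding v_def by auto
  qed
  have rD: "r \<le> D"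
  proof -
    obtain t where "t \<in> K" using K(2) by blast
    then show ?thesis using K(1) N_le[of t] by auto
  qed
  have "\<forall>B\<in>I. \<exists>\<rho> p q. Suc r \<le> \<rho> \<and> block_data B \<rho> p q" using I(3) unfolding good_def by blast
  then obtain \<rho> p q where data: "\<forall>B\<in>I. Suc r \<le> \<rho> B \<and> block_data B (\<rho> B) (p B) (q B)" by metis
  have IB: "Suc r \<le> \<rho> B" "\<forall>t\<in>B. snd t \<ge> \<rho> B" "p B \<le> q B" "shade (\<rho> B) B = {p B..q B}" if "B \<in> I" for B
    using data that unfolding block_data_def by auto
  have Ir: "\<forall>t\<in>B. snd t \<ge> r" if "B \<in> I" for B using IB(1,2)[OF that] by force
  have "\<exists>G. hpoly (\<rho> B) B = [:\<Pi> ^ e:] * G" if "B \<in> I" for B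
  proof -
    have "block_dvd e B" using block_dvd_block_val[OF cV IN(1,2)[OF that]] block_val(1) that unfolding e_def by (blast intro: block_dvd_mono)
    then show ?thesis unfolding block_dvd_iff[OF IB(2)[OF that]] \<Pi>_def by (elim dvdE) blast
  qed
  then obtain G where G: "\<And>B. B \<in> I \<Longrightarrow> hpoly (\<rho> B) B = [:\<Pi> ^ e:] * G B" by metis
  have "\<exists>k. \<not> \<Pi> ^ v dvd coeff (G B) k" if "B \<in> I" for B
  proof (rule ccontr)
    assume "\<not> ?thesis"
    then have "[:\<Pi> ^ v:] dvd G B" unfolding const_poly_dvd_iff by blast
    then have "[:\<Pi> ^ e:] * [:\<Pi> ^ v:] dvd hpoly (\<rho> B) B" unfolding G[OF that] by (rule mult_dvd_mono[OF dvd_refl])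
    then have "[:\<Pi> ^ block_val C:] dvd hpoly (\<rho> B) B" unfolding v(1) by (simp add: power_add mult.commute)
    then have "block_dvd (block_val C) B" unfolding block_dvd_iff[OF IB(2)[OF that]] \<Pi>_def .
    then have "block_val C \<le> block_val B" by (rule block_val_ge[OF cV IN(1,2)[OF that]])
    then show False using block_val(2) that unfolding C_def by (meson leD)
  qed
  then obtain kk where kk: "\<And>B. B \<in> I \<Longrightarrow> \<not> \<Pi> ^ v dvd coeff (G B) (kk B)" by metis
  define X where "X = (\<Sum>t\<in>K. monom (a t) (fst t))"
  define Y where "Y = X + (\<Sum>B\<in>I. [:1, -1:] ^ (\<rho> B - r) * G B)"
  have hK: "hpoly r K = [:\<Pi> ^ e:] * X"
    unfolding hpoly_def X_def sum_distrib_left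
    by (intro sum.cong refl) (use K(1) in \<open>auto simp: smult_monom \<Pi>_def e_def\<close>)
  have hI: "hpoly r (\<Union>I) = [:\<Pi> ^ e:] * (\<Sum>B\<in>I. [:1, -1:] ^ (\<rho> B - r) * G B)"
  proof -
    have "hpoly r (\<Union>I) = (\<Sum>B\<in>I. hpoly r B)" by (rule hpoly_Union) (use IN I(4) in auto)
    also have "\<dots> = (\<Sum>B\<in>I. [:\<Pi> ^ e:] * ([:1, -1:] ^ (\<rho> B - r) * G B))"
    proof (intro sum.cong refl)
      fix B assume B: "B \<in> I"
      have "r \<le> \<rho> B" using IB(1)[OF B] by simp
      from hpoly_age_diff[OF this IB(2)[OF B]]
      have "hpoly r B = [:1, -1:] ^ (\<rho> B - r) * ([:\<Pi> ^ e:] * G B)" unfolding G[OF B] .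
      then show "hpoly r B = [:\<Pi> ^ e:] * ([:1, -1:] ^ (\<rho> B - r) * G B)" by (simp only: mult.left_commute)
    qed
    finally show ?thesis by (simp only: sum_distrib_left)
  qed
  have disj: "\<Union>I \<inter> K = {}" using IB(1,2) K(1) by force
  have hC: "hpoly r C = [:\<Pi> ^ e:] * Y"
    unfolding C_def Y_def distrib_left hK[symmetric] hI[symmetric]
    using hpoly_Un[of "\<Union>I" K r] I(1) IN(3) finK disj by (simp add: add.commute)
  have Cr: "\<forall>t\<in>C. snd t \<ge> r" using Ir K(1) unfolding C_def by auto
  have "[:\<Pi> ^ v:] dvd Y"
  proof -
    have "[:\<Pi> ^ block_val C:] dvd hpoly r C" using block_dvd_block_val[OF cV CN] unfolding block_dvd_iff[OF Cr] \<Pi>_def .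
    then have "[:\<Pi> ^ e:] * [:\<Pi> ^ v:] dvd [:\<Pi> ^ e:] * Y" unfolding v(1) hC by (simp add: power_add mult.commute)
    moreover have "[:\<Pi> ^ e:] \<noteq> 0" using nz by simp
    ultimately show ?thesis by (simp only: dvd_mult_cancel_left simp_thms)
  qed
  then obtain Q where Q: "Y = [:\<Pi> ^ v:] * Q" by (rule dvdE)
  define b where "b = Suc (Max (fst ` K))"
  have b: "fst t < b" if "t \<in> K" for t unfolding b_def using finK that by (simp add: le_imp_less_Suc)
  have cX: "coeff X k = (\<Sum>t\<in>K. if fst t = k then a t else 0)" for k
    unfolding X_def coeff_sum by (intro sum.cong refl) auto
  have sumX: "(\<Sum>k<b. coeff X k) = (\<Sum>t\<in>K. a t)"
  proof -
    have "(\<Sum>k<b. coeff X k) = (\<Sum>t\<in>K. \<Sum>k<b. if fst t = k then a t else 0)"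
      unfolding cX by (rule sum.swap)
    also have "\<dots> = (\<Sum>t\<in>K. a t)" using b by (intro sum.cong refl) (simp add: sum.delta')
    finally show ?thesis .
  qed
  have "\<exists>l q. functional l \<and> (\<forall>b. l (\<Pi> ^ v * b) = 0) \<and> (\<forall>g\<in>(\<lambda>B. coeff (G B) (kk B)) ` I. l g \<noteq> 0) \<and>
    (\<forall>L. alternates (\<lambda>k. l (coeff X k)) L \<longrightarrow> L \<le> q + 1) \<and> v + q \<le> (\<Sum>k<b. num_terms (coeff X k))"
  proof (rule ex_separating_functional)
    show "finite ((\<lambda>B. coeff (G B) (kk B)) ` I)" using I(1) by simp
    show "\<not> \<Pi> ^ v dvd g" if "g \<in> (\<lambda>B. coeff (G B) (kk B)) ` I" for g using that kk by auto
    show "coeff X k = 0" if "k \<ge> b" for k unfolding cX using b that by (intro sum.neutral) force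
    show "(\<Sum>k<b. coeff X k) \<noteq> 0" unfolding sumX by (rule sum_a_nonzero) (use K in auto)
    show "v + 1 \<le> num_terms f" if "f \<noteq> 0" "\<Pi> ^ v dvd f" for f
      using that finite_V cV unfolding \<Pi>_def by (intro num_terms_ge) auto
    have "poly Y 1 = (\<Sum>t\<in>K. a t)"
    proof -
      have "poly ([:1, -1:] ^ (\<rho> B - r) * G B) 1 = 0" if "B \<in> I" for B
        using IB(1)[OF that] by (simp add: power_0_left)
      then show ?thesis unfolding Y_def X_def by (simp add: poly_sum poly_monom del: poly_mult)
    qed
    then show "\<Pi> ^ v dvd (\<Sum>k<b. coeff X k)" unfolding sumX using Q by (metis dvd_poly_one dvd_triv_left)
  qed
  then obtain l s where l: "functional l" "\<And>b. l (\<Pi> ^ v * b) = 0" "\<And>B. B \<in> I \<Longrightarrow> l (coeff (G B) (kk B)) \<noteq> 0"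
    and alt: "\<And>L. alternates (\<lambda>k. l (coeff X k)) L \<Longrightarrow> L \<le> s + 1" and Ns: "v + s \<le> (\<Sum>k<b. num_terms (coeff X k))"
    by blast
  have ladd: "l (x + y) = l x + l y" for x y using l(1) unfolding functional_def by blast
  have l0: "l 0 = 0" using ladd[of 0 0] by simp
  \<comment> \<open>the images of the old blocks under the functional, and their aged sum\<close>
  define \<gamma> where "\<gamma> B = map_poly l (G B)" for B
  define A where "A = aged_sum \<gamma> (\<lambda>B. \<rho> B - r) I"
  have cA: "coeff A k = - l (coeff X k)" for k
  proof -
    have "A = map_poly l (\<Sum>B\<in>I. [:1, -1:] ^ (\<rho> B - r) * G B)"
      unfolding A_def aged_sum_def \<gamma>_def map_poly_additive_sum[of l, OF ladd]
        map_poly_additive_one_minus_x_power_mult[of l, OF ladd] ..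
    then have "coeff A k + l (coeff X k) = l (coeff Y k)"
      unfolding Y_def coeff_add ladd by (simp add: map_poly_additive_coeff[of l, OF ladd])
    also have "\<dots> = 0" unfolding Q by (simp add: l(2))
    finally show ?thesis by linarith
  qed
  have g0: "\<gamma> B \<noteq> 0" if "B \<in> I" for B
  proof
    assume "\<gamma> B = 0"
    then have "coeff (\<gamma> B) (kk B) = 0" by simp
    then show False using l(3)[OF that] unfolding \<gamma>_def map_poly_additive_coeff[of l, OF ladd] by blast
  qed
  have gs: "p B \<le> k \<and> k \<le> q B" if B: "B \<in> I" and k: "coeff (\<gamma> B) k \<noteq> 0" for B k
  proof -
    have "coeff (G B) k \<noteq> 0" using k l0 unfolding \<gamma>_def map_poly_additive_coeff[of l, OF ladd] by auto
    then have "coeff (hpoly (\<rho> B) B) k \<noteq> 0" unfolding G[OF B] using nz by simp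
    then have "k \<in> shade (\<rho> B) B" by (rule coeff_hpoly)
    then show ?thesis unfolding IB(4)[OF B] by simp
  qed
  have "\<forall>B\<in>I. int D - int r \<le> int (block_val B)" using block_val(1) rD by force
  note bh = blocks_height[OF I(1) data this]
  obtain lo hi where lh: "lo \<le> hi" "shade (Suc r) (\<Union>I) = {lo..hi}" using iv unfolding interval_set_def by blast
  have FI: "(A \<noteq> 0 \<longrightarrow> alternates_ge (coeff A) (height p q (\<lambda>B. \<rho> B - r) I)) \<and> (A = 0 \<longrightarrow> height p q (\<lambda>B. \<rho> B - r) I \<le> 0)"
    unfolding A_def
  proof (rule interval_family_alternates[OF I(1,2)])
    show "shadow p q (\<lambda>B. \<rho> B - r - 1) I = {lo..hi}" unfolding bh(2) by (rule lh(2))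
    show "1 \<le> \<rho> B - r" if "B \<in> I" for B using IB(1)[OF that] by simp
  qed (use IB(3) g0 gs lh(1) in auto)
  have h: "height p q (\<lambda>B. \<rho> B - r) I \<le> int s + 1"
  proof (cases "A = 0")
    case True
    then show ?thesis using FI by simp
  next
    case False
    then obtain L where L: "int L \<ge> height p q (\<lambda>B. \<rho> B - r) I" "alternates (coeff A) L"
      using FI unfolding alternates_ge_def by blast
    have "(\<lambda>k. - coeff A k) = (\<lambda>k. l (coeff X k))" using cA by auto
    then have "alternates (\<lambda>k. l (coeff X k)) L" using alternates_uminus[OF L(2)] by simp
    then show ?thesis using alt[of L] L(1) by linarith
  qed
  have NX: "(\<Sum>k<b. num_terms (coeff X k)) \<le> (\<Sum>t\<in>K. num_terms (a t))"
  proof -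
    have "num_terms (coeff X k) \<le> (\<Sum>t\<in>K. if fst t = k then num_terms (a t) else 0)" for k
    proof -
      have "num_terms (coeff X k) \<le> (\<Sum>t\<in>K. num_terms (if fst t = k then a t else 0))"
        unfolding cX by (rule num_terms_sum_le[OF finK])
      also have "\<dots> = (\<Sum>t\<in>K. if fst t = k then num_terms (a t) else 0)"
        by (intro sum.cong refl) (auto simp: num_terms_def)
      finally show ?thesis .
    qed
    then have "(\<Sum>k<b. num_terms (coeff X k)) \<le> (\<Sum>k<b. \<Sum>t\<in>K. if fst t = k then num_terms (a t) else 0)"
      by (rule sum_mono)
    also have "\<dots> = (\<Sum>t\<in>K. \<Sum>k<b. if fst t = k then num_terms (a t) else 0)" by (rule sum.swap)
    also have "\<dots> = (\<Sum>t\<in>K. num_terms (a t))" using b by (intro sum.cong refl) (simp add: sum.delta')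
    finally show ?thesis .
  qed
  have ZI: "(\<Sum>B\<in>I. int (\<Sum>t\<in>B. num_terms (a t))) = int (\<Sum>t\<in>\<Union>I. num_terms (a t))"
  proof -
    have "(\<Sum>t\<in>\<Union>I. num_terms (a t)) = (\<Sum>B\<in>I. \<Sum>t\<in>B. num_terms (a t))"
      using sum.Union_disjoint[of I "\<lambda>t. num_terms (a t)"] IN(3) I(4) by (simp add: o_def)
    then show ?thesis by simp
  qed
  have ZC: "(\<Sum>t\<in>C. num_terms (a t)) = (\<Sum>t\<in>\<Union>I. num_terms (a t)) + (\<Sum>t\<in>K. num_terms (a t))"
    unfolding C_def using I(1) IN(3) finK disj by (intro sum.union_disjoint) auto
  have "shade r (\<Union>I) = {lo..Suc hi}"
  proof -
    have "\<forall>t\<in>\<Union>I. snd t \<ge> Suc r" using IB(1,2) by force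
    from shade_age[OF this lh(2,1), of 1] show ?thesis by simp
  qed
  moreover have "shade r K = fst ` K" using K(1) by (intro shade_row) auto
  ultimately have sC: "shade r C = {lo..Suc hi}" unfolding C_def shade_Un using cov by auto
  have sCI: "shade r (\<Union>I) = shade r C" unfolding sC by fact
  have "block_data C r lo (Suc hi)"
    unfolding block_data_def
  proof (intro conjI)
    have c: "card (shade r (\<Union>I)) = Suc hi - lo + 1" unfolding sCI sC using lh(1) by simp
    show "2 * int (Suc hi - lo + 1) + int (block_val C) + int r - int D - 1 \<le> int (\<Sum>t\<in>C. num_terms (a t))"
      using bh(3) h Ns NX unfolding c ZI ZC v(1) e_def using rD by linarith
  qed (use Cr lh(1) sC in auto)
  then show ?thesis unfolding good_def C_def[symmetric] using CN by blast
qed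

definition blocks :: "nat \<Rightarrow> (nat \<times> nat) set set \<Rightarrow> bool" where
  "blocks r \<B> \<longleftrightarrow> \<Union>\<B> = {t\<in>N. snd t \<ge> r} \<and> {} \<notin> \<B> \<and> (\<forall>A\<in>\<B>. \<forall>B\<in>\<B>. A \<noteq> B \<longrightarrow> A \<inter> B = {})"

definition dependent :: "(nat \<times> nat) set set \<Rightarrow> bool" where
  "dependent J \<longleftrightarrow> J \<noteq> {} \<and> (\<exists>e. (\<forall>B\<in>J. block_val B = e) \<and> block_dvd (Suc e) (\<Union>J))"

definition independent :: "(nat \<times> nat) set set \<Rightarrow> bool" where
  "independent \<B> \<longleftrightarrow> (\<forall>J\<subseteq>\<B>. \<not> dependent J)"

lemma finite_blocks:
  assumes "blocks r \<B>"
  shows "finite \<B>" "B \<in> \<B> \<Longrightarrow> B \<subseteq> N" "B \<in> \<B> \<Longrightarrow> B \<noteq> {}" "B \<in> \<B> \<Longrightarrow> finite B"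
    "B \<in> \<B> \<Longrightarrow> \<forall>t\<in>B. snd t \<ge> r"
proof -
  have sub: "\<Union>\<B> \<subseteq> N" using assms unfolding blocks_def by blast
  then have "\<B> \<subseteq> Pow N" by blast
  then show "finite \<B>" using finite_N by (meson finite_Pow_iff finite_subset)
  show "B \<subseteq> N" if "B \<in> \<B>" using sub that by blast
  then show "B \<in> \<B> \<Longrightarrow> finite B" using finite_N finite_subset by blast
  show "B \<in> \<B> \<Longrightarrow> B \<noteq> {}" using assms unfolding blocks_def by blast
  show "\<forall>t\<in>B. snd t \<ge> r" if "B \<in> \<B>" using assms that unfolding blocks_def by blast
qed

text \<open>
  The union of the blocks of least divisibility is the total minus more divisible blocks. If the
  total were more divisible as well, these blocks would be dependent.
\<close>

lemma block_val_ge_if_independent: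
  assumes cV: "card V = 2" and r: "r \<ge> 1" and bl: "blocks r \<B>" and ind: "independent \<B>" and B: "B \<in> \<B>"
  shows "D + 1 - r \<le> block_val B"
proof (rule ccontr)
  assume less: "\<not> ?thesis"
  note fb = finite_blocks[OF bl]
  define e where "e = Min (block_val ` \<B>)"
  have e_le: "e \<le> block_val A" if "A \<in> \<B>" for A unfolding e_def using fb(1) that by simp
  have "e \<in> block_val ` \<B>" unfolding e_def using fb(1) B by (intro Min_in) auto
  then have Jne: "{A\<in>\<B>. block_val A = e} \<noteq> {}" by auto
  have eD: "Suc e \<le> D + 1 - r" using e_le[OF B] less by simp
  define J where "J = {A\<in>\<B>. block_val A = e}"
  define J' where "J' = {A\<in>\<B>. block_val A \<noteq> e}"
  have JJ: "\<B> = J \<union> J'" "J \<inter> J' = {}" by (auto simp: J_def J'_def)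
  have disj: "\<forall>A\<in>\<B>. \<forall>B\<in>\<B>. A \<noteq> B \<longrightarrow> A \<inter> B = {}" using bl unfolding blocks_def by blast
  have U: "\<Union>\<B> = {t\<in>N. snd t \<ge> r}" using bl unfolding blocks_def by blast
  have all: "\<forall>t\<in>\<Union>\<B>. snd t \<ge> r" unfolding U by simp
  have "block_dvd (D + 1 - r) (\<Union>\<B>)"
    unfolding block_dvd_iff[OF all] unfolding U by (rule dvd_hpoly_upper[OF r])
  then have tot: "block_dvd (Suc e) (\<Union>\<B>)" using eD by (rule block_dvd_mono)
  have HU: "hpoly 0 (\<Union>I) = (\<Sum>B\<in>I. hpoly 0 B)" if "I \<subseteq> \<B>" for I
  proof (rule hpoly_Union)
    show "\<forall>B\<in>I. finite B" using that fb(4) by blast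
    show "\<forall>A\<in>I. \<forall>B\<in>I. A \<noteq> B \<longrightarrow> A \<inter> B = {}" using that disj by (meson subsetD)
  qed
  have "hpoly 0 (\<Union>\<B>) = (\<Sum>B\<in>J. hpoly 0 B) + (\<Sum>B\<in>J'. hpoly 0 B)"
    unfolding HU[OF order_refl] using fb(1) JJ by (metis finite_Un sum.union_disjoint)
  then have eq: "hpoly 0 (\<Union>J) = hpoly 0 (\<Union>\<B>) - (\<Sum>B\<in>J'. hpoly 0 B)"
    using HU[of J] JJ(1) by simp
  have "[:var_sum V ^ Suc e:] dvd (\<Sum>B\<in>J'. hpoly 0 B)"
  proof (rule dvd_sum)
    fix A assume "A \<in> J'"
    then have A: "A \<in> \<B>" "block_val A \<noteq> e" by (auto simp: J'_def)
    then have "Suc e \<le> block_val A" using e_le[OF A(1)] by simp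
    then have "block_dvd (Suc e) A" using block_dvd_block_val[OF cV fb(2,3)[OF A(1)]] by (blast intro: block_dvd_mono)
    then show "[:var_sum V ^ Suc e:] dvd hpoly 0 A" unfolding block_dvd_def .
  qed
  then have "block_dvd (Suc e) (\<Union>J)" using tot unfolding block_dvd_def eq by (simp only: dvd_diff)
  then have "dependent J" unfolding dependent_def using Jne by (auto simp: J_def)
  then show False using ind JJ(1) unfolding independent_def by blast
qed

text \<open>
  Start with the old blocks and all elements of row \<open>r\<close> as singletons, and admit mergers of old blocks with
  row elements that satisfy the hypotheses under which a merged block is good. A partition with the
  fewest members is independent: a minimal dependent subset cannot be split into parts with disjoint
  shades, so its union is connected and is again an admissible merger, with fewer members in the partition.
\<close>

lemma ex_blocks_step:
  assumes cV: "card V = 2" and bl: "blocks (Suc r) \<B>" and ind: "independent \<B>" and gd: "\<forall>B\<in>\<B>. good (Suc r) B"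
  shows "\<exists>\<C>. blocks r \<C> \<and> independent \<C> \<and> (\<forall>C\<in>\<C>. good r C)"
proof -
  note fb = finite_blocks[OF bl]
  have Bdisj: "A \<inter> B = {}" if "A \<in> \<B>" "B \<in> \<B>" "A \<noteq> B" for A B using bl that unfolding blocks_def by blast
  have BU: "\<Union>\<B> = {t\<in>N. snd t \<ge> Suc r}" using bl unfolding blocks_def by blast
  define row where "row = {t\<in>N. snd t = r}"
  have Brow: "B \<inter> row = {}" if "B \<in> \<B>" for B using fb(5)[OF that] unfolding row_def by force
  define merged where "merged C \<longleftrightarrow> (\<exists>I K. I \<subseteq> \<B> \<and> I \<noteq> {} \<and> K \<subseteq> row \<and> K \<noteq> {} \<and> C = \<Union>I \<union> K \<and>
      (\<forall>B\<in>I. block_val B < block_val C) \<and> interval_set (shade (Suc r) (\<Union>I)) \<and> fst ` K \<subseteq> shade r (\<Union>I))" for C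
  define adm where "adm \<C> \<longleftrightarrow> blocks r \<C> \<and> (\<forall>C\<in>\<C>. C \<in> \<B> \<or> (\<exists>t\<in>row. C = {t}) \<or> merged C)" for \<C>
  have "adm (\<B> \<union> (\<lambda>t. {t}) ` row)"
    unfolding adm_def
  proof (intro conjI ballI)
    show "blocks r (\<B> \<union> (\<lambda>t. {t}) ` row)"
      unfolding blocks_def
    proof (intro conjI ballI impI)
      have "\<Union>(\<B> \<union> (\<lambda>t. {t}) ` row) = \<Union>\<B> \<union> row" by auto
      then show "\<Union>(\<B> \<union> (\<lambda>t. {t}) ` row) = {t\<in>N. snd t \<ge> r}" unfolding BU row_def by auto
      show "{} \<notin> \<B> \<union> (\<lambda>t. {t}) ` row" using fb(3) by auto
      fix A B assume "A \<in> \<B> \<union> (\<lambda>t. {t}) ` row" "B \<in> \<B> \<union> (\<lambda>t. {t}) ` row" "A \<noteq> B"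
      then show "A \<inter> B = {}" using Bdisj Brow by blast
    qed
  qed auto
  then obtain \<C> where adm: "adm \<C>" and least: "\<forall>\<C>'. adm \<C>' \<longrightarrow> card \<C> \<le> card \<C>'"
    using ex_has_least_nat[of adm _ card] by blast
  have bC: "blocks r \<C>" using adm unfolding adm_def by blast
  note fc = finite_blocks[OF bC]
  have Cdisj: "A \<inter> B = {}" if "A \<in> \<C>" "B \<in> \<C>" "A \<noteq> B" for A B using bC that unfolding blocks_def by blast
  have CU: "\<Union>\<C> = {t\<in>N. snd t \<ge> r}" using bC unfolding blocks_def by blast
  have struct: "\<exists>I\<subseteq>\<B>. C - row = \<Union>I \<and> (\<forall>B\<in>I. block_val B \<le> block_val C) \<and> (C \<inter> row = {} \<longrightarrow> C \<in> \<B>) \<and>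
      ((\<exists>t\<in>row. C = {t}) \<or> (interval_set (shade (Suc r) (C - row)) \<and> fst ` (C \<inter> row) \<subseteq> shade r (C - row)))"
    if "C \<in> \<C>" for C
  proof -
    consider "C \<in> \<B>" | t where "t \<in> row" "C = {t}" | "merged C" using adm \<open>C \<in> \<C>\<close> unfolding adm_def by blast
    then show ?thesis
    proof cases
      case 1
      then have "C - row = C" "C \<inter> row = {}" using Brow by blast+
      moreover have "interval_set (shade (Suc r) C)" using gd 1 good_interval(1) by blast
      ultimately show ?thesis using 1 by (intro exI[of _ "{C}"]) auto
    next
      case 2
      then show ?thesis by (intro exI[of _ "{}"]) auto
    next
      case 3
      then obtain I K where IK: "I \<subseteq> \<B>" "I \<noteq> {}" "K \<subseteq> row" "K \<noteq> {}" "C = \<Union>I \<union> K"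
        "\<forall>B\<in>I. block_val B < block_val C" "interval_set (shade (Suc r) (\<Union>I))" "fst ` K \<subseteq> shade r (\<Union>I)"
        unfolding merged_def by blast
      have "C - row = \<Union>I" "C \<inter> row = K" using IK(1,3,5) Brow by blast+
      then show ?thesis using IK by (intro exI[of _ I]) (auto intro: less_imp_le)
    qed
  qed
  have parts: "\<exists>I. I \<subseteq> \<B> \<and> C - row = \<Union>I \<and> (\<forall>B\<in>I. block_val B \<le> block_val C)" if "C \<in> \<C>" for C
    using struct[OF that] by (elim exE conjE) (intro exI conjI; assumption)
  have old: "C \<in> \<B>" if "C \<in> \<C>" "C \<inter> row = {}" for C
    using struct[OF that(1)] by (elim exE conjE) (erule mp, rule that(2))
  have connected: "(\<exists>t\<in>row. C = {t}) \<or> (interval_set (shade (Suc r) (C - row)) \<and> fst ` (C \<inter> row) \<subseteq> shade r (C - row))"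
    if "C \<in> \<C>" for C
    using struct[OF that] by (elim exE conjE) assumption
  have "independent \<C>"
  proof (rule ccontr)
    assume "\<not> independent \<C>"
    then obtain J0 where J0: "J0 \<subseteq> \<C> \<and> dependent J0" unfolding independent_def by blast
    have "\<exists>J. (J \<subseteq> \<C> \<and> dependent J) \<and> (\<forall>J'. J' \<subseteq> \<C> \<and> dependent J' \<longrightarrow> card J \<le> card J')"
      by (rule ex_has_least_nat[of "\<lambda>J. J \<subseteq> \<C> \<and> dependent J" J0 card]) (rule J0)
    then obtain J where J: "J \<subseteq> \<C>" "dependent J"
      and "\<forall>J'. J' \<subseteq> \<C> \<and> dependent J' \<longrightarrow> card J \<le> card J'" by (elim exE conjE)
    then have Jleast: "card J \<le> card J'" if "J' \<subseteq> \<C>" "dependent J'" for J' using that by simp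
    obtain e where e: "\<forall>B\<in>J. block_val B = e" "block_dvd (Suc e) (\<Union>J)" and Jne: "J \<noteq> {}"
      using J(2) unfolding dependent_def by blast
    have finJ: "finite J" using J(1) fc(1) by (rule finite_subset)
    have Jr: "\<forall>t\<in>\<Union>J. snd t \<ge> r" using J(1) fc(5) by blast
    have JN: "\<Union>J \<subseteq> N" "\<Union>J \<noteq> {}" using J(1) Jne fc(2,3) by blast+
    have nosplit: "shade r (\<Union>J1) \<inter> shade r (\<Union>J2) \<noteq> {}"
      if J12: "J = J1 \<union> J2" "J1 \<inter> J2 = {}" "J1 \<noteq> {}" "J2 \<noteq> {}" for J1 J2
    proof
      \<comment> \<open>otherwise one of the parts alone would be a smaller dependent set\<close>
      assume dis: "shade r (\<Union>J1) \<inter> shade r (\<Union>J2) = {}"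
      have fin: "finite (\<Union>J1)" "finite (\<Union>J2)" using JN(1) finite_N J12(1) by (auto intro: finite_subset)
      have "\<Union>J1 \<inter> \<Union>J2 = {}" using Cdisj J(1) J12(1,2) by blast
      moreover have "[:var_sum V ^ Suc e:] dvd hpoly r (\<Union>J1 \<union> \<Union>J2)"
        using e(2) unfolding block_dvd_iff[OF Jr] unfolding J12(1) Union_Un_distrib .
      ultimately have "[:var_sum V ^ Suc e:] dvd hpoly r (\<Union>J1)"
        using dvd_hpoly_split(1)[OF fin _ dis] by blast
      moreover have "\<forall>t\<in>\<Union>J1. snd t \<ge> r" using Jr J12(1) by blast
      ultimately have "block_dvd (Suc e) (\<Union>J1)" by (simp only: block_dvd_iff)
      then have "dependent J1" unfolding dependent_def using J12(1,3) e(1) by blast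
      then have "card J \<le> card J1" using Jleast J(1) J12(1) by blast
      moreover have "card J = card J1 + card J2" unfolding J12(1) using J12 finJ by (intro card_Un_disjoint) auto
      moreover have "card J2 > 0" using J12 finJ by (simp add: card_gt_0_iff)
      ultimately show False by simp
    qed
    have notsingle: "J \<noteq> {C}" for C
    proof
      assume JC: "J = {C}"
      then have "block_dvd (Suc e) C" "block_val C = e" "C \<in> \<C>" using e J(1) by auto
      then show False using block_val_ge[OF cV fc(2,3)[of C], of "Suc e"] by simp
    qed
    have "\<forall>C\<in>\<C>. \<exists>I. I \<subseteq> \<B> \<and> C - row = \<Union>I \<and> (\<forall>B\<in>I. block_val B \<le> block_val C)" by (intro ballI parts)
    from bchoice[OF this] obtain IC
      where IC: "\<forall>C\<in>\<C>. IC C \<subseteq> \<B> \<and> C - row = \<Union>(IC C) \<and> (\<forall>B\<in>IC C. block_val B \<le> block_val C)" ..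
    define I where "I = (\<Union>C\<in>J. IC C)"
    define K where "K = \<Union>J \<inter> row"
    have IB: "I \<subseteq> \<B>" unfolding I_def using IC J(1) by blast
    have UI: "\<Union>I = \<Union>J - row"
    proof -
      have "\<Union>I = (\<Union>C\<in>J. \<Union>(IC C))" unfolding I_def by blast
      also have "\<dots> = (\<Union>C\<in>J. C - row)" using IC J(1) by (intro SUP_cong refl) blast
      finally show ?thesis by blast
    qed
    have JU: "\<Union>J = \<Union>I \<union> K" unfolding UI K_def by blast
    have vJ: "e < block_val (\<Union>J)" using block_val_ge[OF cV JN e(2)] by simp
    have vI: "\<forall>B\<in>I. block_val B < block_val (\<Union>J)"
    proof
      fix B assume "B \<in> I"
      then obtain C where "C \<in> J" "B \<in> IC C" unfolding I_def by blast
      then have "block_val B \<le> e" using IC J(1) e(1) by force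
      then show "block_val B < block_val (\<Union>J)" using vJ by simp
    qed
    have Kne: "K \<noteq> {}"
    proof
      assume "K = {}"
      then have free: "C \<inter> row = {}" if "C \<in> J" for C using that unfolding K_def by blast
      have "J \<subseteq> \<B>"
      proof
        fix C assume "C \<in> J"
        with J(1) free show "C \<in> \<B>" by (intro old) auto
      qed
      then show False using ind J(2) unfolding independent_def by blast
    qed
    have cov: "fst ` K \<subseteq> shade r (\<Union>I)"
    proof (rule ccontr)
      assume "\<not> ?thesis"
      then obtain t0 where t0: "t0 \<in> K" "fst t0 \<notin> shade r (\<Union>I)" by blast
      then obtain C0 where C0: "C0 \<in> J" "t0 \<in> C0" "t0 \<in> row" unfolding K_def by blast
      \<comment> \<open>row elements inside a merger are covered by its old blocks, so an uncovered one is a singleton and splits off\<close>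
      have C0s: "C0 = {t0}"
      proof (rule ccontr)
        assume "C0 \<noteq> {t0}"
        then have "fst ` (C0 \<inter> row) \<subseteq> shade r (C0 - row)" using connected[of C0] J(1) C0 by blast
        then have "fst t0 \<in> shade r (C0 - row)" using C0 by blast
        moreover have "C0 - row \<subseteq> \<Union>I" unfolding UI using C0(1) by blast
        ultimately have "fst t0 \<in> shade r (\<Union>I)" unfolding shade_def shadow_def by blast
        then show False using t0(2) by blast
      qed
      have "J - {C0} \<noteq> {}" using notsingle[of C0] Jne by blast
      moreover have "J = {C0} \<union> (J - {C0})" using C0(1) by blast
      ultimately have "shade r (\<Union>{C0}) \<inter> shade r (\<Union>(J - {C0})) \<noteq> {}" by (intro nosplit) auto
      moreover have "shade r (\<Union>{C0}) = {fst t0}"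
        using shade_row[of "{t0}" r] C0(3) unfolding C0s row_def by simp
      ultimately have "fst t0 \<in> shade r (\<Union>(J - {C0}))" by auto
      then obtain t where t: "t \<in> \<Union>(J - {C0})" "fst t \<le> fst t0" "fst t0 \<le> fst t + (snd t - r)"
        unfolding shade_def shadow_def by auto
      show False
      proof (cases "t \<in> row")
        case True
        then have "t = t0" using t(2,3) C0(3) unfolding row_def by (auto simp: prod_eq_iff)
        then show False using t(1) C0(1,2) Cdisj J(1) by blast
      next
        case False
        then have "t \<in> \<Union>I" unfolding UI using t(1) by blast
        then have "fst t0 \<in> shade r (\<Union>I)" using t(2,3) unfolding shade_def shadow_def by auto
        then show False using t0(2) by blast
      qed
    qed
    have Fne: "\<Union>I \<noteq> {}"
    proof
      assume "\<Union>I = {}"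
      then show False using cov Kne by (auto simp: shade_def shadow_def)
    qed
    have finF: "finite (\<Union>I)" using JN(1) finite_N UI by (metis Diff_subset finite_subset)
    have Fr: "snd t > r" if "t \<in> \<Union>I" for t
    proof -
      have "t \<in> N" "snd t \<ge> r" "t \<notin> row" using that Jr JN(1) unfolding UI by auto
      then show ?thesis unfolding row_def by auto
    qed
    have iv: "interval_set (shade (Suc r) (\<Union>I))"
    proof -
      have j1: "\<forall>t\<in>\<Union>I. snd t - r \<ge> 1" using Fr by (simp add: Suc_le_eq)
      have kk: "\<forall>t\<in>\<Union>I. fst t \<le> fst t" by simp
      from shadow_interval_or_gap[OF finF Fne kk j1] show ?thesis
      proof (elim disjE exE conjE, goal_cases)
        case (1 lo hi)
        then have "shade (Suc r) (\<Union>I) = {lo..hi}" by (simp add: shade_def)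
        then show ?case unfolding interval_set_def using 1(1) by blast
      next
        case gap: (2 g I1 I2)
        \<comment> \<open>a gap \<open>g\<close> in the shade of the old nodes leaves every member of \<open>J\<close> on one side\<close>
        define left where "left t \<longleftrightarrow> fst t + (snd t - r) \<le> g" for t :: "nat \<times> nat"
        define right where "right t \<longleftrightarrow> g < fst t" for t :: "nat \<times> nat"
        have lr: "left t \<or> right t" if "t \<in> \<Union>J" for t
        proof (cases "t \<in> row")
          case True
          then show ?thesis unfolding row_def left_def right_def by auto
        next
          case False
          then have "t \<in> I1 \<union> I2" using that UI gap(1) by blast
          then show ?thesis using gap(5,6) unfolding left_def right_def by blast
        qed
        have nlr: "\<not> (left t \<and> right t)" for t unfolding left_def right_def by auto
        have side: "(\<forall>t\<in>C. left t) \<or> (\<forall>t\<in>C. right t)" if C: "C \<in> J" for C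
        proof (cases "\<exists>t. C = {t}")
          case True
          then show ?thesis using lr C by blast
        next
          case False
          then have c: "interval_set (shade (Suc r) (C - row))" "fst ` (C \<inter> row) \<subseteq> shade r (C - row)"
            using connected[of C] J(1) C False by blast+
          obtain lo hi where lh: "lo \<le> hi" "shade (Suc r) (C - row) = {lo..hi}" using c(1) unfolding interval_set_def by blast
          have CF: "t \<in> \<Union>I" if "t \<in> C - row" for t unfolding UI using that C by blast
          have "g \<notin> shade (Suc r) (C - row)"
          proof
            assume "g \<in> shade (Suc r) (C - row)"
            then obtain t where t: "t \<in> C - row" "fst t \<le> g" "g \<le> fst t + (snd t - Suc r)"
              unfolding shade_def shadow_def by auto
            moreover have "snd t > r" using Fr CF t(1) by blast
            ultimately have "\<not> left t" "\<not> right t" unfolding left_def right_def by auto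
            then show False using lr C t(1) by blast
          qed
          then have "g < lo \<or> hi < g" unfolding lh(2) by auto
          then show ?thesis
          proof
            assume g: "g < lo"
            have R: "right t" if t: "t \<in> C - row" for t
            proof -
              have "fst t \<in> shade (Suc r) (C - row)" using t unfolding shade_def shadow_def by auto
              then show ?thesis unfolding lh(2) right_def using g by auto
            qed
            have "right t" if t: "t \<in> C" for t
            proof (cases "t \<in> row")
              case True
              then have "fst t \<in> shade r (C - row)" using c(2) t by blast
              then obtain s where "s \<in> C - row" "fst s \<le> fst t" unfolding shade_def shadow_def by auto
              then show ?thesis using R[of s] unfolding right_def by auto
            next
              case False then show ?thesis using R t by blast
            qed
            then show ?thesis by blast
          next
            assume g: "hi < g"
            have Lf: "left t" if t: "t \<in> C - row" for t
            proof -
              have "fst t \<in> shade (Suc r) (C - row)" using t unfolding shade_def shadow_def by auto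
              then have "\<not> right t" unfolding lh(2) right_def using g by auto
              then show ?thesis using lr t C by blast
            qed
            have "left t" if t: "t \<in> C" for t
            proof (cases "t \<in> row")
              case True
              then have "fst t \<in> shade r (C - row)" using c(2) t by blast
              then obtain s where "s \<in> C - row" "fst t \<le> fst s + (snd s - r)" unfolding shade_def shadow_def by auto
              then show ?thesis using Lf[of s] True unfolding left_def row_def by auto
            next
              case False then show ?thesis using Lf t by blast
            qed
            then show ?thesis by blast
          qed
        qed
        define J1 where "J1 = {C\<in>J. \<forall>t\<in>C. left t}"
        define J2 where "J2 = {C\<in>J. \<not> (\<forall>t\<in>C. left t)}"
        have I12: "I1 \<subseteq> \<Union>J" "I2 \<subseteq> \<Union>J" using gap(1) UI by blast+
        have "J1 \<noteq> {}"
        proof -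
          obtain t where t: "t \<in> I1" using gap(3) by blast
          then have "left t" using gap(5) unfolding left_def by blast
          moreover obtain C where "C \<in> J" "t \<in> C" using t I12(1) by blast
          ultimately have "C \<in> J1" using side[of C] nlr[of t] unfolding J1_def by blast
          then show ?thesis by blast
        qed
        moreover have "J2 \<noteq> {}"
        proof -
          obtain t where t: "t \<in> I2" using gap(4) by blast
          then have "right t" using gap(6) unfolding right_def by blast
          moreover obtain C where "C \<in> J" "t \<in> C" using t I12(2) by blast
          ultimately have "C \<in> J2" using nlr[of t] unfolding J2_def by blast
          then show ?thesis by blast
        qed
        moreover have "J = J1 \<union> J2" "J1 \<inter> J2 = {}" unfolding J1_def J2_def by blast+
        ultimately have "shade r (\<Union>J1) \<inter> shade r (\<Union>J2) \<noteq> {}" by (intro nosplit)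
        then obtain x where x: "x \<in> shade r (\<Union>J1)" "x \<in> shade r (\<Union>J2)" by blast
        obtain t where "t \<in> \<Union>J1" "x \<le> fst t + (snd t - r)" using x(1) unfolding shade_def shadow_def by auto
        moreover have "left t" using \<open>t \<in> \<Union>J1\<close> unfolding J1_def by blast
        ultimately have "x \<le> g" unfolding left_def by simp
        obtain s where "s \<in> \<Union>J2" "fst s \<le> x" using x(2) unfolding shade_def shadow_def by auto
        moreover have "right s" using \<open>s \<in> \<Union>J2\<close> side unfolding J2_def by blast
        ultimately have "g < x" unfolding right_def by simp
        then show ?case using \<open>x \<le> g\<close> by simp
      qed
    qed
    have "merged (\<Union>J)"
      unfolding merged_def
    proof (intro exI[of _ I] exI[of _ K] conjI)
      show "I \<noteq> {}" using Fne by blast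
      show "K \<subseteq> row" unfolding K_def by blast
    qed (fact IB Kne JU vI iv cov)+
    define \<C>' where "\<C>' = insert (\<Union>J) (\<C> - J)"
    have "adm \<C>'"
      unfolding adm_def
    proof (intro conjI ballI)
      show "blocks r \<C>'"
        unfolding blocks_def
      proof (intro conjI ballI impI)
        have "\<Union>\<C>' = \<Union>\<C>" unfolding \<C>'_def using J(1) by blast
        then show "\<Union>\<C>' = {t\<in>N. snd t \<ge> r}" using CU by simp
        show "{} \<notin> \<C>'" unfolding \<C>'_def using fc(3) JN(2) by blast
        fix A B assume "A \<in> \<C>'" "B \<in> \<C>'" "A \<noteq> B"
        then show "A \<inter> B = {}" unfolding \<C>'_def using Cdisj J(1) by blast
      qed
      fix C assume "C \<in> \<C>'"
      then show "C \<in> \<B> \<or> (\<exists>t\<in>row. C = {t}) \<or> merged C"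
        unfolding \<C>'_def using \<open>merged (\<Union>J)\<close> adm unfolding adm_def by blast
    qed
    then have "card \<C> \<le> card \<C>'" using least by blast
    moreover have "card \<C>' \<le> Suc (card (\<C> - J))" unfolding \<C>'_def by (rule card_insert_le_m1) auto
    moreover have "card (\<C> - J) = card \<C> - card J" using J(1) finJ by (rule card_Diff_subset[rotated])
    moreover have "card J \<le> card \<C>" using J(1) fc(1) by (rule card_mono[rotated])
    moreover have "card J \<ge> 2"
    proof -
      have "card J \<noteq> 0" using Jne finJ by simp
      moreover have "card J \<noteq> 1" using notsingle by (metis card_1_singletonE)
      ultimately show ?thesis by linarith
    qed
    ultimately show False by linarith
  qed
  moreover have "good r C" if C: "C \<in> \<C>" for C
  proof -
    consider "C \<in> \<B>" | t where "t \<in> row" "C = {t}" | "merged C" using adm C unfolding adm_def by blast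
    then show ?thesis
    proof cases
      case 1
      then show ?thesis using gd good_mono[of "Suc r" C r] by simp
    next
      case 2
      then show ?thesis using good_singleton[OF cV, of t] unfolding row_def by auto
    next
      case 3
      then obtain I K where IK: "I \<subseteq> \<B>" "I \<noteq> {}" "K \<subseteq> row" "K \<noteq> {}" "C = \<Union>I \<union> K"
        "\<forall>B\<in>I. block_val B < block_val C" "interval_set (shade (Suc r) (\<Union>I))" "fst ` K \<subseteq> shade r (\<Union>I)"
        unfolding merged_def by blast
      have "D - r \<le> block_val B" if "B \<in> I" for B
        using block_val_ge_if_independent[OF cV _ bl ind, of B] IK(1) that by auto
      then have Dv: "\<forall>B\<in>I. D - r \<le> block_val B" by blast
      have "good r (\<Union>I \<union> K)"
      proof (rule good_merged[OF cV])
        show "finite I" by (rule finite_subset[OF IK(1) fb(1)])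
        show "\<forall>B\<in>I. good (Suc r) B" using gd IK(1) by blast
        show "\<forall>A\<in>I. \<forall>B\<in>I. A \<noteq> B \<longrightarrow> A \<inter> B = {}" using Bdisj IK(1) by (meson subsetD)
        show "K \<subseteq> {t \<in> N. snd t = r}" using IK(3) unfolding row_def .
        show "\<forall>B\<in>I. block_val B < block_val (\<Union>I \<union> K)" using IK(6) unfolding IK(5) .
      qed (fact IK(2) IK(4) Dv IK(7) IK(8))+
      then show ?thesis unfolding IK(5) .
    qed
  qed
  ultimately show ?thesis using bC by blast
qed

lemma ex_blocks:
  assumes "card V = 2" "r \<le> Suc D"
  shows "\<exists>\<B>. blocks r \<B> \<and> independent \<B> \<and> (\<forall>B\<in>\<B>. good r B)"
  using assms(2)
proof (induction r rule: inc_induct)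
  case base
  have "{t\<in>N. snd t \<ge> Suc D} = {}" using N_le by fastforce
  then have "blocks (Suc D) {}" unfolding blocks_def by simp
  then show ?case by (intro exI[of _ "{}"]) (simp add: independent_def dependent_def)
next
  case (step r)
  then show ?case using ex_blocks_step[OF assms(1)] by blast
qed

text \<open>
  Once all rows \<open>\<ge> 1\<close> are partitioned, evaluate at \<open>y = 1\<close>, where at most two alternations are left.
\<close>

theorem three_variable_bound:
  assumes cV: "card V = 2"
  shows "2 * D + 1 \<le> (\<Sum>t\<in>N. num_terms (a t))"
proof (cases "D = 0")
  case True
  obtain t where "t \<in> N" using N_top by blast
  then have "num_terms (a t) \<le> (\<Sum>t\<in>N. num_terms (a t))" using finite_N by (intro member_le_sum) auto
  then show ?thesis using num_terms_a_pos[OF \<open>t \<in> N\<close>] True by simp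
next
  case False
  then have D: "D \<ge> 1" by simp
  obtain \<B> where bl: "blocks 1 \<B>" and ind: "independent \<B>" and gd: "\<forall>B\<in>\<B>. good 1 B"
    using ex_blocks[OF cV, of 1] by auto
  note fb = finite_blocks[OF bl]
  have U: "\<Union>\<B> = upper" using bl unfolding blocks_def upper_def by blast
  have disj: "\<forall>A\<in>\<B>. \<forall>B\<in>\<B>. A \<noteq> B \<longrightarrow> A \<inter> B = {}" using bl unfolding blocks_def by blast
  have une: "upper \<noteq> {}"
  proof -
    have "shade 1 upper \<noteq> {}" unfolding shade_upper[OF D] by simp
    then show ?thesis by simp
  qed
  then have Bne: "\<B> \<noteq> {}" using U by blast
  have "\<forall>B\<in>\<B>. \<exists>\<rho> p q. Suc 0 \<le> \<rho> \<and> block_data B \<rho> p q" using gd unfolding good_def by auto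
  then obtain \<rho> p q where data: "\<forall>B\<in>\<B>. Suc 0 \<le> \<rho> B \<and> block_data B (\<rho> B) (p B) (q B)" by metis
  have "\<forall>B\<in>\<B>. int D - int 0 \<le> int (block_val B)"
    using block_val_ge_if_independent[OF cV _ bl ind] by fastforce
  note bh = blocks_height[OF fb(1) data this]
  let ?ev = "map_poly (\<lambda>f. poly_eval f (\<lambda>_. 1))"
  define \<gamma> where "\<gamma> B = ?ev (hpoly (\<rho> B) B)" for B
  have A: "aged_sum \<gamma> (\<lambda>B. \<rho> B - 0) \<B> = ?ev (hpoly 0 upper)"
  proof -
    have "hpoly 0 upper = (\<Sum>B\<in>\<B>. hpoly 0 B)" unfolding U[symmetric] by (rule hpoly_Union[OF _ disj]) (use fb(4) in blast)
    also have "\<dots> = (\<Sum>B\<in>\<B>. [:1, -1:] ^ (\<rho> B - 0) * hpoly (\<rho> B) B)"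
    proof (intro sum.cong refl)
      fix B assume "B \<in> \<B>"
      then have "\<forall>t\<in>B. snd t \<ge> \<rho> B" using data unfolding block_data_def by blast
      then show "hpoly 0 B = [:1, -1:] ^ (\<rho> B - 0) * hpoly (\<rho> B) B" by (rule hpoly_age_diff[OF le0])
    qed
    finally show ?thesis unfolding aged_sum_def \<gamma>_def
      by (simp only: map_poly_additive_sum poly_eval_add map_poly_additive_one_minus_x_power_mult)
  qed
  have nz: "?ev (hpoly 0 upper) \<noteq> 0" by (rule eval_hpoly_nonzero[OF upper_subset une]) simp
  have "alternates_ge (coeff (aged_sum \<gamma> (\<lambda>B. \<rho> B - 0) \<B>)) (height p q (\<lambda>B. \<rho> B - 0) \<B>)"
  proof (rule interval_family_alternates[THEN conjunct1, rule_format, OF fb(1) Bne])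
    show "shadow p q (\<lambda>B. \<rho> B - 0 - 1) \<B> = {0..D - 1}"
      unfolding bh(2) U using shade_upper[OF D] by simp
    show "aged_sum \<gamma> (\<lambda>B. \<rho> B - 0) \<B> \<noteq> 0" unfolding A by (rule nz)
    fix B assume B: "B \<in> \<B>"
    show "p B \<le> q B" using data B unfolding block_data_def by blast
    show "1 \<le> \<rho> B - 0" using data B by simp
    show "\<gamma> B \<noteq> 0" unfolding \<gamma>_def by (rule eval_hpoly_nonzero[OF fb(2,3)[OF B]]) simp
    fix k assume "coeff (\<gamma> B) k \<noteq> 0"
    then have "coeff (hpoly (\<rho> B) B) k \<noteq> 0"
      unfolding \<gamma>_def by (auto simp: map_poly_additive_coeff poly_eval_add)
    then have "k \<in> shade (\<rho> B) B" by (rule coeff_hpoly)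
    then show "p B \<le> k \<and> k \<le> q B" using data B unfolding block_data_def by auto
  qed simp
  then have h2: "height p q (\<lambda>B. \<rho> B - 0) \<B> \<le> 2"
    unfolding alternates_ge_def A using alternates_upper by fastforce
  have cU: "card (shade 0 upper) = D + 1"
  proof -
    have "card (shade 0 upper) = card (shade 1 upper) + 1"
      unfolding shade_def using card_shadow_age[of upper fst fst "\<lambda>t. snd t - 0" 0 "D - 1"]
        shade_upper[OF D] by (simp add: shade_def upper_def)
    then show ?thesis unfolding shade_upper[OF D] using D by simp
  qed
  have Z: "(\<Sum>B\<in>\<B>. int (\<Sum>t\<in>B. num_terms (a t))) = int (\<Sum>t\<in>upper. num_terms (a t))"
  proof -
    have "(\<Sum>t\<in>\<Union>\<B>. num_terms (a t)) = (\<Sum>B\<in>\<B>. \<Sum>t\<in>B. num_terms (a t))"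
      using sum.Union_disjoint[of \<B> "\<lambda>t. num_terms (a t)"] fb(4) disj by (simp add: o_def)
    then show ?thesis unfolding U by simp
  qed
  have "int (2 * D) = 2 * int (D + 1) - 2" by simp
  also have "\<dots> \<le> 2 * int (card (shade 0 upper)) - height p q (\<lambda>B. \<rho> B - 0) \<B>"
    unfolding cU using h2 by linarith
  also have "\<dots> \<le> int (\<Sum>t\<in>upper. num_terms (a t))" using bh(3) unfolding U Z .
  finally have "int (2 * D) \<le> int (\<Sum>t\<in>upper. num_terms (a t))" .
  then have "2 * D \<le> (\<Sum>t\<in>upper. num_terms (a t))" by (simp only: of_nat_le_iff)
  then show ?thesis using sum_num_terms_upper[OF D] by linarith
qed

end

section \<open>The expansion of a polynomial with value one on the hyperplane\<close>

lemma monom_eval_scale: "monom_eval (\<lambda>i. s * y i) m = s ^ monom_degree m * monom_eval y m"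
  unfolding monom_eval_def monom_degree_def by (simp add: power_mult_distrib prod.distrib power_sum)

lemma strip_plus_single: "strip i m + single i (lookup m i) = m"
  using strip_eq_iff[of m i "lookup m i" "strip i m"] by simp

lemma monom_degree_strip: "monom_degree (strip i m) + lookup m i = monom_degree m"
  using monom_degree_add[of "strip i m" "single i (lookup m i)"] strip_plus_single[of i m] by simp

definition node :: "(nat \<Rightarrow>\<^sub>0 nat) \<Rightarrow> nat \<times> nat" where
  "node m = (lookup m 0, monom_degree (strip 0 m))"

definition node_part :: "rpoly \<Rightarrow> nat \<times> nat \<Rightarrow> rpoly" where
  "node_part p t = (\<Sum>m\<in>{m\<in>keys p. node m = t}. single (strip 0 m) (lookup p m))"

lemma inj_strip_node: "node m = node m' \<Longrightarrow> strip 0 m = strip 0 m' \<Longrightarrow> m = m'"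
  unfolding node_def by (metis strip_plus_single prod.inject)

lemma lookup_node_part_strip:
  assumes "m \<in> keys p" "node m = t"
  shows "lookup (node_part p t) (strip 0 m) = lookup p m"
proof -
  have "lookup (node_part p t) (strip 0 m)
      = (\<Sum>m'\<in>{m\<in>keys p. node m = t}. if m' = m then lookup p m else 0)"
    unfolding node_part_def lookup_sum
  proof (intro sum.cong refl)
    fix m' assume m': "m' \<in> {m\<in>keys p. node m = t}"
    then have "strip 0 m' = strip 0 m \<longleftrightarrow> m' = m" using inj_strip_node[of m' m] assms(2) by auto
    then show "lookup (single (strip 0 m') (lookup p m')) (strip 0 m) = (if m' = m then lookup p m else 0)"
      by (auto simp: lookup_single when_def)
  qed
  then show ?thesis using assms by simp
qed

lemma keys_node_part: "keys (node_part p t) = strip 0 ` {m\<in>keys p. node m = t}"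
proof
  show "keys (node_part p t) \<subseteq> strip 0 ` {m\<in>keys p. node m = t}"
    unfolding node_part_def
    by (rule order.trans[OF Poly_Mapping.keys_sum]) (auto split: if_splits)
  show "strip 0 ` {m\<in>keys p. node m = t} \<subseteq> keys (node_part p t)"
    by (auto simp: in_keys_iff lookup_node_part_strip)
qed

lemma num_terms_node_part: "num_terms (node_part p t) = card {m\<in>keys p. node m = t}"
  unfolding num_terms_def keys_node_part
  by (rule card_image) (auto intro!: inj_onI dest: inj_strip_node)

lemma sum_num_terms_node_part:
  "(\<Sum>t\<in>node ` keys p. num_terms (node_part p t)) = num_terms p"
proof -
  have "num_terms p = (\<Sum>m\<in>keys p. 1)" by (simp add: num_terms_def)
  also have "\<dots> = (\<Sum>t\<in>node ` keys p. \<Sum>m\<in>{m\<in>keys p. node m = t}. 1)"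
    by (rule sum.image_gen) simp
  finally show ?thesis by (simp add: num_terms_node_part)
qed

lemma poly_eval_node_part:
  "poly_eval (node_part p t) y = (\<Sum>m\<in>{m\<in>keys p. node m = t}. lookup p m * monom_eval y (strip 0 m))"
  unfolding node_part_def by (simp add: poly_eval_sum poly_eval_single)

lemma rpoly_zero_if_vanishes:
  assumes "\<And>y. (\<And>i. y i > 0) \<Longrightarrow> poly_eval f y = 0"
  shows "f = 0"
  using ex_pos_poly_eval_nonzero[of f] assms by blast

text \<open>
  For positive \<open>y\<close> with sum \<open>s\<close> the point \<open>z\<close> with coordinates \<open>x\<close> and \<open>(1 - x) y\<^sub>i / s\<close> lies on the hyperplane.
  Multiplying by \<open>s\<^sup>D\<close> gives the identity after evaluation at \<open>y\<close>, and polynomials agreeing at all positive \<open>y\<close> are equal.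
\<close>

lemma node_system_of_hyperplane_poly:
  assumes p: "p \<in> hyperplane_polys n" and n: "n \<ge> 2"
  shows "node_system (node ` keys p) (node_part p) {1..<n} (poly_degree p)"
proof
  let ?N = "node ` keys p" and ?V = "{1..<n}" and ?D = "poly_degree p"
  have vars: "keys m \<subseteq> {..<n}" if "m \<in> keys p" for m
    using p that by (auto simp: hyperplane_polys_def polys_in_def)
  have nonneg: "lookup p m \<ge> 0" for m using p by (auto simp: hyperplane_polys_def)
  have ev: "poly_eval p x = 1" if "(\<Sum>i<n. x i) = 1" for x
    using p that by (auto simp: hyperplane_polys_def)
  have fsum: "fst (node m) + snd (node m) = monom_degree m" for m
    using monom_degree_strip[of 0 m] by (simp add: node_def)
  have deg_le: "monom_degree m \<le> ?D" if "m \<in> keys p" for m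
    using that unfolding poly_degree_def by (intro Max_ge) auto
  have "p \<noteq> 0"
  proof
    assume "p = 0"
    then show False using ev[of "\<lambda>i. if i = 0 then 1 else 0"] n by simp
  qed
  show "finite ?N" "finite ?V" by auto
  show "?V \<noteq> {}" using n by auto
  show "node_part p t \<noteq> 0" if "t \<in> ?N" for t
  proof -
    have "keys (node_part p t) \<noteq> {}" unfolding keys_node_part using that by auto
    then show ?thesis by auto
  qed
  show "lookup (node_part p t) m \<ge> 0" for t m
    unfolding node_part_def lookup_sum using nonneg
    by (intro sum_nonneg) (auto simp: lookup_single when_def)
  show "monom_degree m = snd t" if "m \<in> keys (node_part p t)" for m t
    using that unfolding keys_node_part by (auto simp: node_def)
  show "keys m \<subseteq> ?V" if m: "m \<in> keys (node_part p t)" for m t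
  proof -
    obtain m' where m': "m' \<in> keys p" "m = strip 0 m'" using m unfolding keys_node_part by auto
    show ?thesis
    proof
      fix i assume "i \<in> keys m"
      then have "i \<noteq> 0" "i \<in> keys m'" unfolding m'(2) by (auto simp: in_keys_iff lookup_strip split: if_splits)
      then show "i \<in> ?V" using vars[OF m'(1)] by (auto simp: Suc_le_eq)
    qed
  qed
  show "fst t + snd t \<le> ?D" if "t \<in> ?N" for t using that fsum deg_le by auto
  show "\<exists>t\<in>?N. fst t + snd t = ?D"
  proof -
    obtain m0 where m0: "m0 \<in> keys p" using \<open>p \<noteq> 0\<close> by fastforce
    have "?D \<in> insert 0 (monom_degree ` keys p)" unfolding poly_degree_def by (intro Max_in) auto
    then obtain m where "m \<in> keys p" "monom_degree m = ?D"
      using m0 deg_le[OF m0] by auto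
    then show ?thesis using fsum[of m] by (intro bexI[of _ "node m"]) auto
  qed
  define T where "T = (\<Sum>t\<in>?N. [:1, -1:] ^ snd t * monom (var_sum ?V ^ (?D - snd t) * node_part p t) (fst t))"
  have main: "map_poly (\<lambda>f. poly_eval f y) T = [:(\<Sum>i\<in>?V. y i) ^ ?D:]" if y: "\<And>i. y i > 0" for y
  proof -
    define s where "s = (\<Sum>i\<in>?V. y i)"
    have s: "s > 0" unfolding s_def using y n by (intro sum_pos) auto
    have T: "map_poly (\<lambda>f. poly_eval f y) T
        = (\<Sum>t\<in>?N. [:1, -1:] ^ snd t * monom (s ^ (?D - snd t) * poly_eval (node_part p t) y) (fst t))"
      unfolding T_def s_def
      by (simp only: map_poly_additive_sum poly_eval_add map_poly_additive_one_minus_x_power_mult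
          map_poly_monom poly_eval_zero poly_eval_mult poly_eval_power poly_eval_var_sum)
    have "poly (map_poly (\<lambda>f. poly_eval f y) T) x = s ^ ?D" for x
    proof -
      define z where "z = (\<lambda>i. (1 - x) / s * y i)(0 := x)"
      have mz: "monom_eval z m * s ^ ?D = x ^ lookup m 0 * (1 - x) ^ snd (node m) * s ^ (?D - snd (node m)) * monom_eval y (strip 0 m)"
        if "m \<in> keys p" for m
      proof -
        have "?D = snd (node m) + (?D - snd (node m))" using fsum[of m] deg_le[OF that] by simp
        then have "s ^ ?D = s ^ snd (node m) * s ^ (?D - snd (node m))" by (metis power_add)
        moreover have "monom_eval z m = x ^ lookup m 0 * (((1 - x) / s) ^ snd (node m) * monom_eval y (strip 0 m))"
          unfolding z_def monom_eval_upd monom_eval_scale by (simp add: node_def)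
        ultimately show ?thesis using s by (simp add: power_divide)
      qed
      have "(\<Sum>i<n. z i) = z 0 + (\<Sum>i\<in>?V. z i)"
        using n by (simp add: lessThan_atLeast0 sum.atLeast_Suc_lessThan)
      also have "(\<Sum>i\<in>?V. z i) = (1 - x) / s * (\<Sum>i\<in>?V. y i)"
        unfolding sum_distrib_left by (intro sum.cong refl) (auto simp: z_def)
      also have "(\<Sum>i\<in>?V. y i) = s" by (simp add: s_def)
      finally have "(\<Sum>i<n. z i) = 1" using s by (simp add: z_def)
      then have "s ^ ?D = poly_eval p z * s ^ ?D" using ev by simp
      also have "\<dots> = (\<Sum>m\<in>keys p. lookup p m * (monom_eval z m * s ^ ?D))"
        by (simp add: poly_eval_def monom_eval_def sum_distrib_right mult.assoc)
      also have "\<dots> = (\<Sum>m\<in>keys p. lookup p m * (x ^ lookup m 0 * (1 - x) ^ snd (node m) * s ^ (?D - snd (node m)) * monom_eval y (strip 0 m)))"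
        by (intro sum.cong refl) (simp only: mz)
      also have "\<dots> = (\<Sum>t\<in>?N. \<Sum>m\<in>{m\<in>keys p. node m = t}.
          lookup p m * (x ^ lookup m 0 * (1 - x) ^ snd (node m) * s ^ (?D - snd (node m)) * monom_eval y (strip 0 m)))"
        by (rule sum.image_gen) simp
      also have "\<dots> = (\<Sum>t\<in>?N. (1 - x) ^ snd t * (s ^ (?D - snd t) * poly_eval (node_part p t) y * x ^ fst t))"
        unfolding poly_eval_node_part sum_distrib_left sum_distrib_right
        by (intro sum.cong refl) (auto simp: node_def)
      also have "\<dots> = poly (map_poly (\<lambda>f. poly_eval f y) T) x"
        unfolding T by (simp add: poly_sum poly_monom)
      finally show ?thesis by simp
    qed
    then have "poly (map_poly (\<lambda>f. poly_eval f y) T) = poly [:s ^ ?D:]" by auto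
    then show ?thesis unfolding s_def by (simp only: poly_eq_poly_eq_iff)
  qed
  have "coeff T k - coeff [:var_sum ?V ^ ?D:] k = 0" for k
  proof (rule rpoly_zero_if_vanishes)
    fix y :: "nat \<Rightarrow> real" assume y: "\<And>i. y i > 0"
    have "poly_eval (coeff T k) y = coeff (map_poly (\<lambda>f. poly_eval f y) T) k"
      by (simp only: map_poly_additive_coeff poly_eval_add)
    also have "\<dots> = coeff [:(\<Sum>i\<in>?V. y i) ^ ?D:] k" using main[OF y] by simp
    also have "\<dots> = poly_eval (coeff [:var_sum ?V ^ ?D:] k) y"
      by (cases k) (auto simp: poly_eval_power)
    finally show "poly_eval (coeff T k - coeff [:var_sum ?V ^ ?D:] k) y = 0"
      by (simp add: poly_eval_diff)
  qed
  then show "(\<Sum>t\<in>?N. [:1, -1:] ^ snd t * monom (var_sum ?V ^ (?D - snd t) * node_part p t) (fst t))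
      = [:var_sum ?V ^ ?D:]"
    unfolding T_def[symmetric] by (intro poly_eqI) simp
qed

lemma monom_eval_single: "monom_eval x (single i k) = x i ^ k"
  by (auto simp: monom_eval_def)

lemma poly_degree_eqI:
  assumes "\<And>m. m \<in> keys p \<Longrightarrow> monom_degree m \<le> d" "m0 \<in> keys p" "monom_degree m0 = d"
  shows "poly_degree p = d"
  unfolding poly_degree_def
proof (rule Max_eqI)
  show "d \<in> insert 0 (monom_degree ` keys p)" using assms(2,3) by blast
qed (use assms(1) in auto)

theorem hyperplane_poly_two_variables:
  assumes "p \<in> hyperplane_polys 2" "poly_degree p \<ge> 1"
  shows "poly_degree p + 3 \<le> 2 * num_terms p"
proof -
  interpret node_system "node ` keys p" "node_part p" "{1..<2}" "poly_degree p"
    by (rule node_system_of_hyperplane_poly[OF assms(1)]) simp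
  show ?thesis using two_variable_bound[OF assms(2)] unfolding sum_num_terms_node_part .
qed

theorem hyperplane_poly_many_variables:
  assumes "p \<in> hyperplane_polys n" "n \<ge> 3"
  shows "(n - 1) * poly_degree p + 1 \<le> num_terms p"
proof -
  interpret node_system "node ` keys p" "node_part p" "{1..<n}" "poly_degree p"
    by (rule node_system_of_hyperplane_poly[OF assms(1)]) (use assms(2) in simp)
  show ?thesis
  proof (cases "n = 3")
    case True
    then show ?thesis using three_variable_bound unfolding sum_num_terms_node_part by simp
  next
    case False
    then have "card {1..<n} \<ge> 3" using assms(2) by simp
    then show ?thesis using many_variables_bound unfolding sum_num_terms_node_part by simp
  qed
qed

section \<open>Polynomials attaining the bounds\<close>

definition sum_monoms :: "(nat \<Rightarrow>\<^sub>0 nat) set \<Rightarrow> rpoly" where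
  "sum_monoms S = (\<Sum>m\<in>S. single m 1)"

lemma lookup_sum_monoms:
  "finite S \<Longrightarrow> lookup (sum_monoms S) m = (if m \<in> S then 1 else 0)"
  unfolding sum_monoms_def lookup_sum lookup_single when_def by simp

lemma keys_sum_monoms: "finite S \<Longrightarrow> keys (sum_monoms S) = S"
  by (auto simp: in_keys_iff lookup_sum_monoms split: if_splits)

lemma poly_eval_sum_monoms: "poly_eval (sum_monoms S) x = (\<Sum>m\<in>S. monom_eval x m)"
  by (simp add: sum_monoms_def poly_eval_sum poly_eval_single)

text \<open>
  The polynomial \<open>\<Sum>\<^sub>j\<^sub><\<^sub>d x\<^sub>0\<^sup>j (x\<^sub>1 + \<dots> + x\<^sub>m) + x\<^sub>0\<^sup>d\<close>, a telescoping geometric sum on the hyperplane.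
\<close>

lemma ex_sharp_many_variables:
  assumes n: "n \<ge> 2"
  shows "\<exists>p\<in>hyperplane_polys n. poly_degree p = d \<and> num_terms p = (n - 1) * d + 1"
proof -
  define f :: "nat \<times> nat \<Rightarrow> (nat \<Rightarrow>\<^sub>0 nat)" where "f t = single 0 (fst t) + single (snd t) 1" for t
  define T where "T = {..<d} \<times> {1..<n}"
  define S where "S = insert (single 0 d) (f ` T)"
  have finT: "finite T" by (simp add: T_def)
  then have fin: "finite S" by (simp add: S_def)
  have lf0: "lookup (f t) 0 = fst t" if "t \<in> T" for t
    using that by (auto simp: f_def T_def lookup_add lookup_single when_def)
  have lfi: "lookup (f t) i = (if i = snd t then 1 else 0)" if "t \<in> T" "i \<ge> 1" for t i
    using that by (auto simp: f_def T_def lookup_add lookup_single when_def)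
  have inj: "inj_on f T"
  proof (rule inj_onI)
    fix s t assume st: "s \<in> T" "t \<in> T" "f s = f t"
    have "fst s = fst t" using lf0[OF st(1)] lf0[OF st(2)] st(3) by simp
    moreover have "snd t \<ge> 1" using st(2) by (auto simp: T_def)
    then have "snd s = snd t" using lfi[OF st(1), of "snd t"] lfi[OF st(2), of "snd t"] st(3) by (auto split: if_splits)
    ultimately show "s = t" by (simp add: prod_eq_iff)
  qed
  have new: "single 0 d \<notin> f ` T"
  proof
    assume "single 0 d \<in> f ` T"
    then obtain t where t: "t \<in> T" "single 0 d = f t" by blast
    then have "snd t \<ge> 1" by (auto simp: T_def)
    then show False using lfi[OF t(1), of "snd t"] unfolding t(2)[symmetric] by (simp add: lookup_single when_def)
  qed
  have card: "card S = (n - 1) * d + 1"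
  proof -
    have "card S = Suc (card (f ` T))" unfolding S_def using new finT by simp
    also have "card (f ` T) = card T" by (rule card_image[OF inj])
    also have "card T = (n - 1) * d" unfolding T_def by simp
    finally show ?thesis by simp
  qed
  have keysS: "keys m \<subseteq> {..<n}" "monom_degree m \<le> d" if "m \<in> S" for m
  proof -
    show "keys m \<subseteq> {..<n}"
    proof
      fix i assume "i \<in> keys m"
      then show "i \<in> {..<n}" using \<open>m \<in> S\<close> n
        by (auto simp: S_def f_def T_def in_keys_iff lookup_add lookup_single when_def split: if_splits)
    qed
    show "monom_degree m \<le> d" using that by (auto simp: S_def f_def T_def monom_degree_add)
  qed
  have "poly_eval (sum_monoms S) x = 1" if x: "(\<Sum>i<n. x i) = 1" for x
  proof -
    have "(\<Sum>i<n. x i) = x 0 + (\<Sum>i\<in>{1..<n}. x i)"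
      using n by (simp add: lessThan_atLeast0 sum.atLeast_Suc_lessThan)
    then have rest: "(\<Sum>i\<in>{1..<n}. x i) = 1 - x 0" using x by simp
    have "poly_eval (sum_monoms S) x = x 0 ^ d + (\<Sum>t\<in>T. monom_eval x (f t))"
    proof -
      have "poly_eval (sum_monoms S) x = x 0 ^ d + (\<Sum>m\<in>f ` T. monom_eval x m)"
        unfolding poly_eval_sum_monoms S_def using new finT by (simp add: monom_eval_single)
      then show ?thesis unfolding sum.reindex[OF inj] o_def .
    qed
    also have "(\<Sum>t\<in>T. monom_eval x (f t)) = (\<Sum>t\<in>T. x 0 ^ fst t * x (snd t))"
      by (intro sum.cong refl) (simp add: f_def monom_eval_add monom_eval_single)
    also have "\<dots> = (\<Sum>j<d. x 0 ^ j) * (\<Sum>i\<in>{1..<n}. x i)"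
      unfolding T_def by (simp add: sum_product sum.cartesian_product split_def)
    also have "\<dots> = 1 - x 0 ^ d" unfolding rest one_diff_power_eq by (simp add: mult.commute)
    finally show ?thesis by simp
  qed
  then have "sum_monoms S \<in> hyperplane_polys n"
    unfolding hyperplane_polys_def polys_in_def using keysS(1)
    by (simp add: keys_sum_monoms[OF fin] lookup_sum_monoms[OF fin])
  moreover have "poly_degree (sum_monoms S) = d"
  proof (rule poly_degree_eqI[of _ _ "single 0 d"])
    show "single 0 d \<in> keys (sum_monoms S)" unfolding keys_sum_monoms[OF fin] by (simp add: S_def)
    show "monom_degree m \<le> d" if "m \<in> keys (sum_monoms S)" for m
      using that keysS(2) unfolding keys_sum_monoms[OF fin] by blast
  qed simp
  moreover have "num_terms (sum_monoms S) = (n - 1) * d + 1"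
    unfolding num_terms_def keys_sum_monoms[OF fin] by (rule card)
  ultimately show ?thesis by blast
qed

text \<open>
  On the line \<open>x\<^sub>0 + x\<^sub>1 = 1\<close> the recursion has characteristic roots \<open>1\<close> and \<open>-x\<^sub>1\<close>, hence the starting value \<open>2\<close>.
\<close>

fun lucas_poly :: "nat \<Rightarrow> rpoly" where
  "lucas_poly 0 = single 0 2"
| "lucas_poly (Suc 0) = single (single 0 1) 1"
| "lucas_poly (Suc (Suc m)) = single (single 0 1) 1 * lucas_poly (Suc m) + single (single 1 1) 1 * lucas_poly m"

lemma lookup_mult_nonneg:
  fixes f g :: rpoly
  assumes "\<And>m. lookup f m \<ge> 0" "\<And>m. lookup g m \<ge> 0"
  shows "lookup (f * g) m \<ge> 0"
proof -
  have "f * g = (\<Sum>i\<in>keys f. \<Sum>j\<in>keys g. single (i + j) (lookup f i * lookup g j))"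
    by (subst rpoly_sum_single[of f], subst rpoly_sum_single[of g]) (simp add: sum_product mult_single)
  then have "lookup (f * g) m = (\<Sum>i\<in>keys f. \<Sum>j\<in>keys g. if i + j = m then lookup f i * lookup g j else 0)"
    by (simp add: lookup_sum lookup_single when_def)
  also have "\<dots> \<ge> 0" using assms by (intro sum_nonneg) auto
  finally show ?thesis .
qed

lemma lookup_lucas_poly_nonneg: "lookup (lucas_poly m) k \<ge> 0"
proof (induction m arbitrary: k rule: lucas_poly.induct)
  case (3 m)
  have s: "lookup (single j (1::real)) k \<ge> 0" for j k :: "nat \<Rightarrow>\<^sub>0 nat" by (simp add: lookup_single when_def)
  show ?case unfolding lucas_poly.simps lookup_add
    by (intro add_nonneg_nonneg lookup_mult_nonneg s 3)
qed (auto simp: lookup_single when_def simp del: single_numeral)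

definition lucas_monom :: "nat \<Rightarrow> nat \<Rightarrow> (nat \<Rightarrow>\<^sub>0 nat)" where
  "lucas_monom m s = single 0 (m - 2 * s) + single 1 s"

lemma keys_lucas_poly: "keys (lucas_poly m) \<subseteq> lucas_monom m ` {s. 2 * s \<le> m}"
proof (induction m rule: lucas_poly.induct)
  case 1
  then show ?case by (auto simp: lucas_monom_def simp del: single_numeral)
next
  case 2
  have eq: "single 0 1 = lucas_monom (Suc 0) 0" by (simp add: lucas_monom_def)
  show ?case unfolding lucas_poly.simps eq by auto
next
  case (3 m)
  show ?case
  proof
    fix k assume "k \<in> keys (lucas_poly (Suc (Suc m)))"
    then have "k \<in> keys (single (single 0 1) 1 * lucas_poly (Suc m)) \<union> keys (single (single 1 1) 1 * lucas_poly m)"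
      unfolding lucas_poly.simps by (rule subsetD[OF Poly_Mapping.keys_add])
    then consider j where "j \<in> keys (lucas_poly (Suc m))" "k = single 0 1 + j"
      | j where "j \<in> keys (lucas_poly m)" "k = single 1 1 + j"
      using keys_mult[of "single (single 0 1) 1" "lucas_poly (Suc m)"]
        keys_mult[of "single (single 1 1) 1" "lucas_poly m"] by auto
    then show "k \<in> lucas_monom (Suc (Suc m)) ` {s. 2 * s \<le> Suc (Suc m)}"
    proof cases
      case 1
      then obtain s where s: "2 * s \<le> Suc m" "j = lucas_monom (Suc m) s" using 3(1) by auto
      then have "Suc (Suc m) - 2 * s = 1 + (Suc m - 2 * s)" by simp
      then have "k = lucas_monom (Suc (Suc m)) s"
        unfolding 1(2) s(2) lucas_monom_def by (simp only: single_add add.assoc)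
      then show ?thesis using s(1) by auto
    next
      case 2
      then obtain s where s: "2 * s \<le> m" "j = lucas_monom m s" using 3(2) by auto
      then have "Suc (Suc m) - 2 * (1 + s) = m - 2 * s" by simp
      then have "k = lucas_monom (Suc (Suc m)) (1 + s)"
        unfolding 2(2) s(2) lucas_monom_def by (simp only: single_add add.left_commute)
      then show ?thesis using s(1) by auto
    qed
  qed
qed

lemma poly_eval_lucas_poly:
  assumes "x 0 + x 1 = 1"
  shows "poly_eval (lucas_poly m) x = 1 + (- x 1) ^ m"
proof (induction m rule: lucas_poly.induct)
  case (3 m)
  define z where "z = - x 1"
  have x: "x 0 = 1 + z" "x 1 = - z" using assms by (auto simp: z_def)
  have "poly_eval (lucas_poly (Suc (Suc m))) x
      = x 0 * poly_eval (lucas_poly (Suc m)) x + x 1 * poly_eval (lucas_poly m) x"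
    by (simp only: lucas_poly.simps poly_eval_add poly_eval_mult poly_eval_single monom_eval_single
        power_one_right mult_1_left)
  also have "\<dots> = (1 + z) * (1 + z ^ Suc m) + (- z) * (1 + z ^ m)"
    unfolding 3 unfolding x minus_minus ..
  also have "\<dots> = 1 + z ^ Suc (Suc m)" by (simp add: algebra_simps)
  finally show ?case unfolding z_def .
qed (use assms in \<open>auto simp: poly_eval_single monom_eval_single simp del: single_numeral\<close>)

lemma lucas_monom_props:
  assumes "2 * s \<le> m"
  shows "keys (lucas_monom m s) \<subseteq> {..<2}" "monom_degree (lucas_monom m s) \<le> m"
proof -
  show "keys (lucas_monom m s) \<subseteq> {..<2}"
    by (auto simp: lucas_monom_def in_keys_iff lookup_add lookup_single when_def split: if_splits)
  show "monom_degree (lucas_monom m s) \<le> m" using assms by (simp add: lucas_monom_def monom_degree_add)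
qed

text \<open>
  It is enough to bound the number of terms from above, because the general lower bound supplies the other inequality
  and thereby excludes coincidences of monomials.
\<close>

lemma ex_lucas_completion:
  assumes E: "finite E" "\<And>k. k \<in> E \<Longrightarrow> keys k \<subseteq> {..<2} \<and> monom_degree k \<le> d" "m0 \<in> E" "monom_degree m0 = d"
    and md: "m \<le> d"
    and ev: "\<And>x. x 0 + x 1 = 1 \<Longrightarrow> (\<Sum>k\<in>E. monom_eval x k) = - ((- x 1) ^ m)"
  shows "\<exists>p\<in>hyperplane_polys 2. poly_degree p = d \<and> num_terms p \<le> m div 2 + 1 + card E"
proof -
  define p where "p = lucas_poly m + sum_monoms E"
  have kp: "keys p \<subseteq> lucas_monom m ` {s. 2 * s \<le> m} \<union> E"
    using Poly_Mapping.keys_add[of "lucas_poly m" "sum_monoms E"] keys_lucas_poly[of m]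
    unfolding p_def keys_sum_monoms[OF E(1)] by blast
  have nonneg: "lookup p k \<ge> 0" for k
    unfolding p_def lookup_add lookup_sum_monoms[OF E(1)] using lookup_lucas_poly_nonneg by simp
  have props: "keys k \<subseteq> {..<2} \<and> monom_degree k \<le> d" if "k \<in> keys p" for k
  proof -
    consider s where "2 * s \<le> m" "k = lucas_monom m s" | "k \<in> E" using kp \<open>k \<in> keys p\<close> by blast
    then show ?thesis
    proof cases
      case 1
      then show ?thesis using lucas_monom_props[of s m] md by auto
    qed (rule E(2))
  qed
  have "poly_eval p x = 1" if "(\<Sum>i<2. x i) = 1" for x
  proof -
    have x: "x 0 + x 1 = 1" using that by (simp add: numeral_2_eq_2)
    show ?thesis unfolding p_def poly_eval_add poly_eval_sum_monoms poly_eval_lucas_poly[OF x] ev[OF x] by simp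
  qed
  then have "p \<in> hyperplane_polys 2"
    unfolding hyperplane_polys_def polys_in_def using props nonneg by blast
  moreover have "poly_degree p = d"
  proof (rule poly_degree_eqI[OF _ _ E(4)])
    have "lookup p m0 \<ge> 1"
      unfolding p_def lookup_add lookup_sum_monoms[OF E(1)] using lookup_lucas_poly_nonneg[of m m0] E(3) by simp
    then show "m0 \<in> keys p" by (simp add: in_keys_iff)
  qed (use props in blast)
  moreover have "num_terms p \<le> m div 2 + 1 + card E"
  proof -
    have eq: "{s. 2 * s \<le> m} = {..m div 2}" by auto
    have "num_terms p \<le> card (lucas_monom m ` {s. 2 * s \<le> m} \<union> E)"
      unfolding num_terms_def by (rule card_mono[OF _ kp]) (simp add: eq E(1))
    also have "\<dots> \<le> card (lucas_monom m ` {s. 2 * s \<le> m}) + card E" by (rule card_Un_le)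
    also have "card (lucas_monom m ` {s. 2 * s \<le> m}) \<le> card {..m div 2}" unfolding eq by (rule card_image_le) simp
    finally show ?thesis by simp
  qed
  ultimately show ?thesis by blast
qed

lemma ex_two_variables_odd:
  assumes "odd d"
  shows "\<exists>p\<in>hyperplane_polys 2. poly_degree p = d \<and> d + 3 = 2 * num_terms p"
proof -
  have "\<exists>p\<in>hyperplane_polys 2. poly_degree p = d \<and> num_terms p \<le> d div 2 + 1 + card {single 1 d :: nat \<Rightarrow>\<^sub>0 nat}"
  proof (rule ex_lucas_completion[of _ _ "single 1 d"])
    fix x :: "nat \<Rightarrow> real"
    show "(\<Sum>k\<in>{single 1 d}. monom_eval x k) = - ((- x 1) ^ d)" using assms by (simp add: monom_eval_single)
  qed auto
  then obtain p where p: "p \<in> hyperplane_polys 2" "poly_degree p = d" "num_terms p \<le> d div 2 + 2" by auto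
  obtain k where k: "d = 2 * k + 1" using assms by (rule oddE)
  have "d + 3 \<le> 2 * num_terms p" using hyperplane_poly_two_variables[OF p(1)] p(2) k by simp
  then have "d + 3 = 2 * num_terms p" using p(3) k by simp
  then show ?thesis using p(1,2) by blast
qed

lemma ex_two_variables_even:
  assumes "even d" "d \<ge> 2"
  shows "\<exists>p\<in>hyperplane_polys 2. poly_degree p = d \<and> d + 4 = 2 * num_terms p"
proof -
  obtain k where "d = 2 * k" using assms(1) by (rule evenE)
  then have k: "d = 2 * (k - 1) + 2" using assms(2) by simp
  define m where "m = 2 * (k - 1) + 1"
  have m: "odd m" "d = Suc m" using k by (simp_all add: m_def)
  define E where "E = {single 0 1 + single 1 m, single 1 (Suc m) :: nat \<Rightarrow>\<^sub>0 nat}"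
  have ne: "single 0 1 + single 1 m \<noteq> (single 1 (Suc m) :: nat \<Rightarrow>\<^sub>0 nat)"
  proof
    assume "single 0 1 + single 1 m = (single 1 (Suc m) :: nat \<Rightarrow>\<^sub>0 nat)"
    from arg_cong[OF this, of "\<lambda>k. lookup k 0"] show False
      by (simp add: lookup_add lookup_single when_def)
  qed
  have "\<exists>p\<in>hyperplane_polys 2. poly_degree p = d \<and> num_terms p \<le> m div 2 + 1 + card E"
  proof (rule ex_lucas_completion[of _ _ "single 1 (Suc m)"])
    fix x :: "nat \<Rightarrow> real" assume x: "x 0 + x 1 = 1"
    have "(\<Sum>k\<in>E. monom_eval x k) = x 0 * x 1 ^ m + x 1 ^ Suc m"
      unfolding E_def using ne by (simp add: monom_eval_add monom_eval_single)
    also have "\<dots> = (x 0 + x 1) * x 1 ^ m" by (simp add: algebra_simps)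
    finally show "(\<Sum>k\<in>E. monom_eval x k) = - ((- x 1) ^ m)" using x m(1) by simp
  next
    fix k assume "k \<in> E"
    then show "keys k \<subseteq> {..<2} \<and> monom_degree k \<le> d" unfolding E_def m(2)
      by (auto simp: monom_degree_add in_keys_iff lookup_add lookup_single when_def split: if_splits)
  qed (auto simp: E_def m(2))
  moreover have "card E \<le> 2" unfolding E_def by (simp add: card_insert_if)
  ultimately obtain p where p: "p \<in> hyperplane_polys 2" "poly_degree p = d" "num_terms p \<le> m div 2 + 3" by fastforce
  have "d + 3 \<le> 2 * num_terms p" using hyperplane_poly_two_variables[OF p(1)] p(2) assms(2) by simp
  moreover have "m div 2 = k - 1" by (simp add: m_def)
  then have "num_terms p \<le> k - 1 + 3" using p(3) by simp
  ultimately have "d + 4 = 2 * num_terms p" using k by presburger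
  then show ?thesis using p(1,2) by blast
qed

section \<open>The degree estimate and its sharpness\<close>

theorem theorem1p1:
  fixes n :: nat
  assumes "n \<ge> 2"
  shows
    "(\<forall>p\<in>hyperplane_polys n. (n = 2 \<longrightarrow> poly_degree p \<ge> 1) \<longrightarrow>
        real (poly_degree p) \<le> degree_bound n (num_terms p)) \<and>
     (n \<ge> 3 \<longrightarrow>
        (\<forall>d. \<exists>p\<in>hyperplane_polys n. poly_degree p = d \<and>
               real d = degree_bound n (num_terms p))) \<and>
     (n = 2 \<longrightarrow>
        (\<forall>p\<in>hyperplane_polys n. real (poly_degree p) = degree_bound n (num_terms p) \<longrightarrow>
               odd (poly_degree p)) \<and>
        (\<forall>d. odd d \<longrightarrow> (\<exists>p\<in>hyperplane_polys n. poly_degree p = d \<and>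
               real d = degree_bound n (num_terms p))) \<and>
        (\<forall>d. even d \<and> d \<ge> 2 \<longrightarrow> (\<exists>p\<in>hyperplane_polys n. poly_degree p = d \<and>
               degree_bound n (num_terms p) = real d + 1)))"
proof (cases "n = 2")
  case True
  have b: "degree_bound n N = real (2 * N) - 3" for N using True by (simp add: degree_bound_def)
  have "real (poly_degree p) \<le> degree_bound n (num_terms p)"
    if "p \<in> hyperplane_polys n" "poly_degree p \<ge> 1" for p
  proof -
    have "poly_degree p + 3 \<le> 2 * num_terms p"
      using that unfolding True by (rule hyperplane_poly_two_variables)
    then show ?thesis unfolding b by linarith
  qed
  moreover have "odd (poly_degree p)" if "real (poly_degree p) = degree_bound n (num_terms p)" for p
  proof -
    have "poly_degree p + 3 = 2 * num_terms p" using that unfolding b by linarith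
    then show ?thesis by presburger
  qed
  moreover have "\<exists>p\<in>hyperplane_polys n. poly_degree p = d \<and> real d = degree_bound n (num_terms p)"
    if "odd d" for d
  proof -
    obtain p where "p \<in> hyperplane_polys 2" "poly_degree p = d" "d + 3 = 2 * num_terms p"
      using ex_two_variables_odd[OF \<open>odd d\<close>] by blast
    moreover from this(3) have "real d = degree_bound n (num_terms p)" unfolding b by linarith
    ultimately show ?thesis unfolding True by blast
  qed
  moreover have "\<exists>p\<in>hyperplane_polys n. poly_degree p = d \<and> degree_bound n (num_terms p) = real d + 1"
    if "even d \<and> d \<ge> 2" for d
  proof -
    obtain p where "p \<in> hyperplane_polys 2" "poly_degree p = d" "d + 4 = 2 * num_terms p"
      using ex_two_variables_even[of d] \<open>even d \<and> d \<ge> 2\<close> by blast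
    moreover from this(3) have "degree_bound n (num_terms p) = real d + 1" unfolding b by linarith
    ultimately show ?thesis unfolding True by blast
  qed
  ultimately show ?thesis using True by simp
next
  case False
  then have n: "n \<ge> 3" using assms by simp
  have b: "degree_bound n N = (real N - 1) / real (n - 1)" for N
    using n by (simp add: degree_bound_def of_nat_diff)
  have pos: "real (n - 1) > 0" using n by simp
  have "real (poly_degree p) \<le> degree_bound n (num_terms p)" if "p \<in> hyperplane_polys n" for p
  proof -
    have "real ((n - 1) * poly_degree p + 1) \<le> real (num_terms p)"
      using hyperplane_poly_many_variables[OF that n] by (simp only: of_nat_le_iff)
    then show ?thesis unfolding b using pos by (simp add: pos_le_divide_eq mult.commute)
  qed
  moreover have "\<exists>p\<in>hyperplane_polys n. poly_degree p = d \<and> real d = degree_bound n (num_terms p)" for d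
  proof -
    obtain p where "p \<in> hyperplane_polys n" "poly_degree p = d" "num_terms p = (n - 1) * d + 1"
      using ex_sharp_many_variables[OF assms, of d] by blast
    moreover from this(3) have "real d = degree_bound n (num_terms p)" unfolding b using pos by simp
    ultimately show ?thesis by blast
  qed
  ultimately show ?thesis using False by simp
qed

end
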